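(* Let $\Bbbk$ be an algebraically closed field of characteristic zero, let $G=\mathbb{Z}_{m_1}\times\cdots\times\mathbb{Z}_{m_n}$ with $m_i\mid m_{i+1}$ for $1\le i\le n-1$, and let $(B_\bullet,\partial_\bullet)$ be the normalized bar resolution of $G$. Let $k\ge1$. The $k$-cochains $\omega\in\operatorname{Hom}_{\mathbb{Z}G}(B_k,\Bbbk^* )$ given by $$\omega([g^{\alpha_1},\dots,g^{\alpha_k}])=\prod_{l=1}^{k}\ \prod_{\substack{1\le r_1<\cdots<r_l\le n\\ \lambda_1+\cdots+\lambda_l=k,\ \lambda_1\text{ odd}\\ \lambda_i\ge1\text{ for }1\le i\le l}}\zeta_{m_{r_1}}^{(-1)^{\sum_{1\le i<j\le l}\lambda_i\lambda_j}\,\eta^{\alpha}_{r_1,[a_1,b_1]}\cdots\eta^{\alpha}_{r_l,[a_l,b_l]}\,a_{r_1^{\lambda_1}\cdots r_l^{\lambda_l}}},$$ where $a_u=\sum_{i=u+1}^l\lambda_i+1$, $b_u=\sum_{i=u}^l\lambda_i$, and where the parameters $a_{r_1^{\lambda_1}\cdots r_l^{\lambda_l}}$ range over all integers with $0\le a_{r_1^{\lambda_1}\cdots r_l^{\lambda_l}}<m_{r_1}$, form a complete set of representatives of $k$-cocycles of the complex $(B_\bullet^*,\partial_\bullet^* )=\operatorname{Hom}_{\mathbb{Z}G}(B_\bullet,\Bbbk^* )$; that is, each such $\omega$ is a normalized $k$-cocycle, and every normalized $k$-cocycle is cohomologous to the $\omega$ of exactly one choice of the parameters.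
   Context: $\Bbbk^*=\Bbbk\setminus\{0\}$ is the multiplicative group with trivial $G$-action. $\zeta_m$ denotes a fixed primitive $m$-th root of unity in $\Bbbk$. For each $i$ fix a generator $g_i$ of $\mathbb{Z}_{m_i}$ (written multiplicatively). Write $\alpha=(\alpha_1,\dots,\alpha_k)$, $\alpha_u=(\alpha_{u1},\dots,\alpha_{un})$ with integers $0\le\alpha_{uj}<m_j$, and $g^{\alpha_u}=g_1^{\alpha_{u1}}\cdots g_n^{\alpha_{un}}$. Normalized bar resolution: $B_k$ is the free $\mathbb{Z}G$-module on symbols $[h_1,\dots,h_k]$ with $h_i\in G\setminus\{1\}$, with the convention that a symbol is $0$ if some $h_i=1$, and $\partial_k[h_1,\dots,h_k]=h_1[h_2,\dots,h_k]+\sum_{u=1}^{k-1}(-1)^u[h_1,\dots,h_uh_{u+1},\dots,h_k]+(-1)^k[h_1,\dots,h_{k-1}]$. The differential $\partial^*$ is precomposition with $\partial$. $[\frac{s}{r}]$ denotes the integer part. For $1\le r\le n$ and integers $1\le a\le b\le k$, $$\eta^{\alpha}_{r,[a,b]}=\left[\tfrac{\alpha_{br}+\alpha_{b-1,r}}{m_r}\right]\left[\tfrac{\alpha_{b-2,r}+\alpha_{b-3,r}}{m_r}\right]\cdots\left[\tfrac{\alpha_{a+1,r}+\alpha_{ar}}{m_r}\right]\quad\text{if }b-a\text{ is odd},$$ $$\eta^{\alpha}_{r,[a,b]}=\left[\tfrac{\alpha_{br}+\alpha_{b-1,r}}{m_r}\right]\cdots\left[\tfrac{\alpha_{a+2,r}+\alpha_{a+1,r}}{m_r}\right]\alpha_{ar}\quad\text{if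 }b-a\text{ is even}$$ (integer parts over consecutive disjoint pairs; an empty product is $1$, so $\eta^\alpha_{r,[a,a]}=\alpha_{ar}$). *)

theory Defs
  imports
    "HOL-Algebra.Product_Groups"
    "HOL-Algebra.Free_Abelian_Groups"
    "HOL-Computational_Algebra.Polynomial"
begin

section \<open>The group and the coefficients\<close>

definition cyclic_product :: "nat \<Rightarrow> (nat \<Rightarrow> nat) \<Rightarrow> (nat \<Rightarrow> int) monoid" where
  "cyclic_product n m = product_group {1..n} (\<lambda>i. integer_mod_group (m i))"

text \<open>The element \<open>x\<close> of the \<open>i\<close>-th factor, viewed inside the direct product.\<close>

definition factor_embed :: "nat \<Rightarrow> nat \<Rightarrow> int \<Rightarrow> (nat \<Rightarrow> int)" where
  "factor_embed n i x = (\<lambda>j\<in>{1..n}. if j = i then x else 0)"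

definition gen_power ::
  "nat \<Rightarrow> (nat \<Rightarrow> nat) \<Rightarrow> (nat \<Rightarrow> int) \<Rightarrow> (nat \<Rightarrow> nat) \<Rightarrow> (nat \<Rightarrow> int)" where
  "gen_power n m g \<alpha> =
     (\<Otimes>\<^bsub>cyclic_product n m\<^esub>j\<in>{1..n}. factor_embed n j (g j) [^]\<^bsub>cyclic_product n m\<^esub> \<alpha> j)"

definition nonzero_mult_group :: "'k::field monoid" where
  "nonzero_mult_group = \<lparr>carrier = UNIV - {0}, monoid.mult = (*), one = 1\<rparr>"

definition primitive_root_of_unity :: "nat \<Rightarrow> 'k::field \<Rightarrow> bool" where
  "primitive_root_of_unity d z \<longleftrightarrow> z ^ d = 1 \<and> (\<forall>e. 0 < e \<and> e < d \<longrightarrow> z ^ e \<noteq> 1)"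

section \<open>The normalized bar resolution\<close>

definition bar_basis :: "('g, 'x) monoid_scheme \<Rightarrow> nat \<Rightarrow> 'g list set" where
  "bar_basis G k = {hs. length hs = k \<and> set hs \<subseteq> carrier G - {\<one>\<^bsub>G\<^esub>}}"

text \<open>
  A \<open>\<int>G\<close>-module is an abelian group with an action of \<open>G\<close> by automorphisms.  The free
  \<open>\<int>G\<close>-module on a set \<open>S\<close> is realised as the free abelian group on \<open>G \<times> S\<close>, the pair
  \<open>(h, s)\<close> standing for the element \<open>h s\<close>, with \<open>G\<close> acting by left translation of \<open>h\<close>.
\<close>

definition bar_module :: "('g, 'x) monoid_scheme \<Rightarrow> nat \<Rightarrow> (('g \<times> 'g list) \<Rightarrow>\<^sub>0 int) monoid" where
  "bar_module G k = free_Abelian_group (carrier G \<times> bar_basis G k)"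

definition bar_act ::
  "('g, 'x) monoid_scheme \<Rightarrow> 'g \<Rightarrow> (('g \<times> 'g list) \<Rightarrow>\<^sub>0 int) \<Rightarrow> (('g \<times> 'g list) \<Rightarrow>\<^sub>0 int)" where
  "bar_act G g = frag_extend (\<lambda>(h, hs). frag_of (g \<otimes>\<^bsub>G\<^esub> h, hs))"

definition bar_symbol :: "('g, 'x) monoid_scheme \<Rightarrow> 'g list \<Rightarrow> (('g \<times> 'g list) \<Rightarrow>\<^sub>0 int)" where
  "bar_symbol G hs = (if \<one>\<^bsub>G\<^esub> \<in> set hs then 0 else frag_of (\<one>\<^bsub>G\<^esub>, hs))"

text \<open>
  Multiplies the adjacent entries \<open>h\<^sub>u\<close> and \<open>h\<^bsub>u+1\<^esub>\<close> (entries counted from 1, \<open>1 \<le> u < length hs\<close>).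
\<close>

definition merge_at :: "('g, 'x) monoid_scheme \<Rightarrow> nat \<Rightarrow> 'g list \<Rightarrow> 'g list" where
  "merge_at G u hs = take (u - 1) hs @ [hs ! (u - 1) \<otimes>\<^bsub>G\<^esub> hs ! u] @ drop (u + 1) hs"

definition bar_boundary_symbol ::
  "('g, 'x) monoid_scheme \<Rightarrow> nat \<Rightarrow> 'g list \<Rightarrow> (('g \<times> 'g list) \<Rightarrow>\<^sub>0 int)" where
  "bar_boundary_symbol G k hs =
     bar_act G (hd hs) (bar_symbol G (tl hs))
     + (\<Sum>u=1..k-1. frag_cmul ((-1) ^ u) (bar_symbol G (merge_at G u hs)))
     + frag_cmul ((-1) ^ k) (bar_symbol G (butlast hs))"

text \<open>\<open>\<partial>\<^sub>k : B\<^sub>k \<rightarrow> B\<^bsub>k-1\<^esub>\<close> for \<open>k \<ge> 1\<close>, the \<open>\<int>G\<close>-linear extension of the above.\<close>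

definition bar_boundary ::
  "('g, 'x) monoid_scheme \<Rightarrow> nat \<Rightarrow> (('g \<times> 'g list) \<Rightarrow>\<^sub>0 int) \<Rightarrow> (('g \<times> 'g list) \<Rightarrow>\<^sub>0 int)" where
  "bar_boundary G k = frag_extend (\<lambda>(h, hs). bar_act G h (bar_boundary_symbol G k hs))"

section \<open>The cochain complex\<close>

text \<open>
  \<open>Hom\<^bsub>\<int>G\<^esub>(B\<^sub>k, \<k>\<^sup>*)\<close> for the trivial action on \<open>\<k>\<^sup>*\<close>: additive-to-multiplicative homomorphisms
  with \<open>f (g c) = f c\<close>.  Extensionality makes equality of cochains equality on \<open>B\<^sub>k\<close>.
\<close>

definition bar_cochains ::
  "('g, 'x) monoid_scheme \<Rightarrow> nat \<Rightarrow> ((('g \<times> 'g list) \<Rightarrow>\<^sub>0 int) \<Rightarrow> 'k::field) set" where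
  "bar_cochains G k =
     {f. f \<in> hom (bar_module G k) nonzero_mult_group
       \<and> f \<in> extensional (carrier (bar_module G k))
       \<and> (\<forall>g\<in>carrier G. \<forall>c\<in>carrier (bar_module G k). f (bar_act G g c) = f c)}"

text \<open>\<open>\<partial>\<^sub>k\<^sup>* : B\<^bsub>k-1\<^esub>\<^sup>* \<rightarrow> B\<^sub>k\<^sup>*\<close>.\<close>

definition bar_coboundary ::
  "('g, 'x) monoid_scheme \<Rightarrow> nat \<Rightarrow> ((('g \<times> 'g list) \<Rightarrow>\<^sub>0 int) \<Rightarrow> 'k::field)
     \<Rightarrow> ((('g \<times> 'g list) \<Rightarrow>\<^sub>0 int) \<Rightarrow> 'k)" where
  "bar_coboundary G k f = (\<lambda>c\<in>carrier (bar_module G k). f (bar_boundary G k c))"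

definition bar_cocycles ::
  "('g, 'x) monoid_scheme \<Rightarrow> nat \<Rightarrow> ((('g \<times> 'g list) \<Rightarrow>\<^sub>0 int) \<Rightarrow> 'k::field) set" where
  "bar_cocycles G k =
     {f \<in> bar_cochains G k.
        \<forall>c\<in>carrier (bar_module G (k + 1)). bar_coboundary G (k + 1) f c = 1}"

definition cohomologous ::
  "('g, 'x) monoid_scheme \<Rightarrow> nat \<Rightarrow> ((('g \<times> 'g list) \<Rightarrow>\<^sub>0 int) \<Rightarrow> 'k::field)
     \<Rightarrow> ((('g \<times> 'g list) \<Rightarrow>\<^sub>0 int) \<Rightarrow> 'k) \<Rightarrow> bool" where
  "cohomologous G k f f' \<longleftrightarrow>
     (\<exists>h\<in>bar_cochains G (k - 1).
        \<forall>c\<in>carrier (bar_module G k). f c = f' c * bar_coboundary G k h c)"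

section \<open>The explicit cochains\<close>

definition eta :: "(nat \<Rightarrow> nat) \<Rightarrow> (nat \<Rightarrow> nat \<Rightarrow> nat) \<Rightarrow> nat \<Rightarrow> nat \<Rightarrow> nat \<Rightarrow> nat" where
  "eta m \<alpha> r a b =
     (if odd (b - a)
      then \<Prod>i<(b - a + 1) div 2. (\<alpha> (b - 2 * i) r + \<alpha> (b - 2 * i - 1) r) div m r
      else (\<Prod>i<(b - a) div 2. (\<alpha> (b - 2 * i) r + \<alpha> (b - 2 * i - 1) r) div m r) * \<alpha> a r)"

text \<open>
  The sequences \<open>(r\<^sub>1, \<dots>, r\<^sub>l)\<close> and \<open>(\<lambda>\<^sub>1, \<dots>, \<lambda>\<^sub>l)\<close> are lists, so \<open>r\<^sub>u = rs ! (u - 1)\<close> and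
  \<open>\<lambda>\<^sub>u = ls ! (u - 1)\<close>; all positions below are shifted down by one accordingly.
\<close>

definition index_set :: "nat \<Rightarrow> nat \<Rightarrow> nat \<Rightarrow> (nat list \<times> nat list) set" where
  "index_set n k l =
     {(rs, ls). length rs = l \<and> length ls = l
        \<and> sorted_wrt (<) rs \<and> set rs \<subseteq> {1..n}
        \<and> sum_list ls = k \<and> (\<forall>i<l. 1 \<le> ls ! i) \<and> odd (ls ! 0)}"

definition block_lo :: "nat list \<Rightarrow> nat \<Rightarrow> nat" where
  "block_lo ls u = (\<Sum>i\<in>{u+1..<length ls}. ls ! i) + 1"

definition block_hi :: "nat list \<Rightarrow> nat \<Rightarrow> nat" where
  "block_hi ls u = (\<Sum>i\<in>{u..<length ls}. ls ! i)"

definition sign_exponent :: "nat list \<Rightarrow> nat" where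
  "sign_exponent ls = (\<Sum>j<length ls. \<Sum>i<j. ls ! i * ls ! j)"

definition parameters ::
  "nat \<Rightarrow> (nat \<Rightarrow> nat) \<Rightarrow> nat \<Rightarrow> (nat list \<times> nat list \<Rightarrow> int) set" where
  "parameters n m k =
     (\<Pi>\<^sub>E (rs, ls) \<in> (\<Union>l\<in>{1..k}. index_set n k l). {0..<int (m (rs ! 0))})"

definition omega_value ::
  "nat \<Rightarrow> (nat \<Rightarrow> nat) \<Rightarrow> (nat \<Rightarrow> 'k::field) \<Rightarrow> nat \<Rightarrow> (nat list \<times> nat list \<Rightarrow> int)
     \<Rightarrow> (nat \<Rightarrow> nat \<Rightarrow> nat) \<Rightarrow> 'k" where
  "omega_value n m \<zeta> k a \<alpha> =
     (\<Prod>l=1..k. \<Prod>(rs, ls)\<in>index_set n k l.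
        \<zeta> (m (rs ! 0)) powi
          ((-1) ^ sign_exponent ls
           * (\<Prod>u<l. int (eta m \<alpha> (rs ! u) (block_lo ls u) (block_hi ls u)))
           * a (rs, ls)))"

text \<open>
  \<open>\<omega>\<close> is the \<open>k\<close>-cochain with the prescribed values on the symbols
  \<open>[g\<^bsup>\<alpha>\<^sub>1\<^esup>, \<dots>, g\<^bsup>\<alpha>\<^sub>k\<^esup>]\<close>.  Symbols with a trivial entry are not excluded, so the formula is
  also required to be compatible with the convention that they vanish.
\<close>

definition is_omega ::
  "nat \<Rightarrow> (nat \<Rightarrow> nat) \<Rightarrow> (nat \<Rightarrow> int) \<Rightarrow> (nat \<Rightarrow> 'k::field) \<Rightarrow> nat
     \<Rightarrow> (nat list \<times> nat list \<Rightarrow> int)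
     \<Rightarrow> ((((nat \<Rightarrow> int) \<times> (nat \<Rightarrow> int) list) \<Rightarrow>\<^sub>0 int) \<Rightarrow> 'k) \<Rightarrow> bool" where
  "is_omega n m g \<zeta> k a \<omega> \<longleftrightarrow>
     \<omega> \<in> bar_cochains (cyclic_product n m) k
     \<and> (\<forall>\<alpha>. (\<forall>u\<in>{1..k}. \<forall>j\<in>{1..n}. \<alpha> u j < m j) \<longrightarrow>
          \<omega> (bar_symbol (cyclic_product n m) (map (\<lambda>u. gen_power n m g (\<alpha> u)) [1..<k+1]))
            = omega_value n m \<zeta> k a \<alpha>)"

end

theory Submission
  imports Defs
begin

text \<open>
  The group \<open>G\<close> has, besides the bar resolution, a much smaller free resolution: the tensor product
  of the periodic resolutions of its cyclic factors.  It has one basis element for every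
  multidegree \<open>l\<close>, a function that assigns to each factor \<open>r\<close> a degree \<open>l r\<close>.  Both resolutions carry
  an explicit contraction of the underlying complexes of abelian groups (\<open>bar_contraction\<close>,
  \<open>total_contraction\<close>).  Filling cycles with these contractions yields chain maps in both directions
  and a homotopy from the identity of the bar resolution to the round trip (\<open>bar_homotopy\<close>).  Hence
  restricting a bar cocycle to the small resolution detects whether it is a coboundary
  (\<open>coboundary_if_pullback\<close>).

  With trivial action the small cochain complex is elementary: a cochain is a function on
  multidegrees, and its coboundary at \<open>l\<close> is the product, over the factors \<open>r\<close> with \<open>l r\<close> even and
  positive, of \<open>\<plusminus> m r\<close>-th powers of the values at \<open>l\<close> lowered by one in \<open>r\<close>.  Let \<open>r\<close> be the lowest
  factor on which \<open>l\<close> is positive; then \<open>m r\<close> divides all other orders that matter.  If \<open>l r\<close> is even,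
  an \<open>m r\<close>-th root removes the value at \<open>l\<close> by a coboundary.  Once all these values are trivial, the
  cocycle condition makes the value at \<open>l\<close> with \<open>l r\<close> odd an \<open>m r\<close>-th root of unity
  (\<open>normal_form_exists\<close>), and coboundaries cannot change it (\<open>normal_form_unique\<close>).  So the classes
  correspond to the choices of an \<open>m r\<close>-th root of unity for each multidegree whose lowest component
  is odd.

  The explicit cochains realise these choices.  The exponent of one parameter is a cup product of
  exponent functions, which are cocycles modulo the order of the factor, and of carries, which are
  integral cocycles; modulo \<open>m r\<close> the product is therefore a cocycle (\<open>cup_cocycle\<close>).  The chain map
  from the small resolution has a closed recursive form, since its contraction only prepends group
  elements, and evaluating the cup products on it gives the dual basis (\<open>cup_value_to_bar\<close>).
\<close>

section \<open>Integer combinations and their functionals\<close>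

lemmas frag_extend_linear =
  frag_extend_add frag_extend_diff frag_extend_minus frag_extend_cmul

lemma frag_induct [case_names zero of diff]:
  assumes "P 0" "\<And>x. P (frag_of x)" "\<And>a b. P a \<Longrightarrow> P b \<Longrightarrow> P (a - b)"
  shows "P (c :: 'a \<Rightarrow>\<^sub>0 int)"
  by (rule frag_induction[of c UNIV P]) (use assms in auto)

lemma frag_extend_restrict:
  assumes "Poly_Mapping.keys c \<subseteq> K" "\<And>x. x \<in> K \<Longrightarrow> F x = F' x"
  shows "frag_extend F c = frag_extend F' c"
  by (rule frag_extend_eq) (use assms in auto)

lemma frag_extend_frag_extend:
  "frag_extend F (frag_extend F' c) = frag_extend (\<lambda>x. frag_extend F (F' x)) c"
  by (induction c rule: frag_induct) (auto simp: frag_extend_diff)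

lemma frag_extend_diff_fun:
  "frag_extend (\<lambda>x. F x - F' x) c = frag_extend F c - frag_extend F' c"
  by (induction c rule: frag_induct) (auto simp: frag_extend_diff)

lemma frag_cmul_right_diff: "frag_cmul e (x - y) = frag_cmul e x - frag_cmul e y"
  by (rule poly_mapping_eqI) (simp add: lookup_minus right_diff_distrib)

lemma frag_extend_cmul_fun:
  "frag_extend (\<lambda>x. frag_cmul e (F x)) c = frag_cmul e (frag_extend F c)"
  by (induction c rule: frag_induct) (auto simp: frag_extend_diff frag_cmul_right_diff)

lemma frag_extend_swap:
  "frag_extend (\<lambda>x. frag_extend (F x) b) a = frag_extend (\<lambda>y. frag_extend (\<lambda>x. F x y) a) b"
proof (induction b rule: frag_induct)
  case zero
  then show ?case by (auto intro: frag_extend_eq_0)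
qed (auto simp: frag_extend_diff frag_extend_diff_fun)

lemma frag_extend_sum': "frag_extend F (sum f A) = (\<Sum>i\<in>A. frag_extend F (f i))"
  by (induction A rule: infinite_finite_induct) (auto simp: frag_extend_add)

lemma keys_sum_subset:
  "(\<And>i. i \<in> A \<Longrightarrow> Poly_Mapping.keys (f i :: 'b \<Rightarrow>\<^sub>0 int) \<subseteq> K) \<Longrightarrow> Poly_Mapping.keys (sum f A) \<subseteq> K"
  by (induction A rule: infinite_finite_induct) (auto dest: subsetD[OF keys_add])

lemma sum_frag_of_const: "(\<Sum>j<(M::nat). frag_of x) = frag_cmul (int M) (frag_of x)"
  by (induction M) (auto simp: frag_cmul_distrib)

text \<open>
  The integer functional with prescribed values on the basis, computed in the free abelian group on
  one point so that it inherits linearity from \<open>frag_extend\<close>.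
\<close>

definition int_ext :: "('a \<Rightarrow> int) \<Rightarrow> ('a \<Rightarrow>\<^sub>0 int) \<Rightarrow> int" where
  "int_ext w c = Poly_Mapping.lookup (frag_extend (\<lambda>x. frag_cmul (w x) (frag_of ())) c) ()"

lemma int_ext_zero [simp]: "int_ext w 0 = 0"
  by (simp add: int_ext_def)

lemma int_ext_of [simp]: "int_ext w (frag_of x) = w x"
  by (simp add: int_ext_def)

lemma int_ext_add: "int_ext w (a + b) = int_ext w a + int_ext w b"
  by (simp add: int_ext_def frag_extend_add lookup_add)

lemma int_ext_diff: "int_ext w (a - b) = int_ext w a - int_ext w b"
  by (simp add: int_ext_def frag_extend_diff lookup_minus)

lemma int_ext_minus: "int_ext w (- a) = - int_ext w a"
  by (simp add: int_ext_def frag_extend_minus)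

lemma int_ext_cmul: "int_ext w (frag_cmul z a) = z * int_ext w a"
  by (simp add: int_ext_def frag_extend_cmul)

lemma int_ext_sum: "int_ext w (sum f A) = (\<Sum>i\<in>A. int_ext w (f i))"
  by (induction A rule: infinite_finite_induct) (auto simp: int_ext_add)

lemmas int_ext_linear = int_ext_add int_ext_diff int_ext_minus int_ext_cmul int_ext_sum

definition mult_ext :: "('a \<Rightarrow> 'k::field) \<Rightarrow> ('a \<Rightarrow>\<^sub>0 int) \<Rightarrow> 'k" where
  "mult_ext \<phi> c = (\<Prod>x\<in>Poly_Mapping.keys c. \<phi> x powi Poly_Mapping.lookup c x)"

lemma mult_ext_zero [simp]: "mult_ext \<phi> 0 = 1"
  by (simp add: mult_ext_def)

lemma mult_ext_of [simp]: "mult_ext \<phi> (frag_of x) = \<phi> x"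
  by (simp add: mult_ext_def)

lemma mult_ext_superset:
  assumes "finite A" "Poly_Mapping.keys c \<subseteq> A"
  shows "mult_ext \<phi> c = (\<Prod>x\<in>A. \<phi> x powi Poly_Mapping.lookup c x)"
  unfolding mult_ext_def
  by (rule prod.mono_neutral_left) (use assms in \<open>auto simp: in_keys_iff\<close>)

lemma mult_ext_add:
  assumes "\<And>x. \<phi> x \<noteq> 0"
  shows "mult_ext \<phi> (a + b) = mult_ext \<phi> a * mult_ext \<phi> b"
proof -
  let ?A = "Poly_Mapping.keys a \<union> Poly_Mapping.keys b"
  have "mult_ext \<phi> (a + b) = (\<Prod>x\<in>?A. \<phi> x powi Poly_Mapping.lookup (a + b) x)"
    by (rule mult_ext_superset) (auto dest: subsetD[OF keys_add])
  also have "\<dots> = (\<Prod>x\<in>?A. \<phi> x powi Poly_Mapping.lookup a x) *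
      (\<Prod>x\<in>?A. \<phi> x powi Poly_Mapping.lookup b x)"
    by (simp add: lookup_add power_int_add assms prod.distrib)
  also have "\<dots> = mult_ext \<phi> a * mult_ext \<phi> b"
    by (simp add: mult_ext_superset[of ?A a] mult_ext_superset[of ?A b])
  finally show ?thesis .
qed

lemma mult_ext_nonzero:
  assumes "\<And>x. \<phi> x \<noteq> 0"
  shows "mult_ext \<phi> a \<noteq> 0"
  by (simp add: mult_ext_def assms power_int_eq_0_iff)

lemma prod_powi: "(\<Prod>x\<in>A. f x) powi z = (\<Prod>x\<in>A. f x powi z :: 'k :: field)"
  by (induction A rule: infinite_finite_induct) (auto simp: power_int_mult_distrib)

lemma mult_ext_cmul: "mult_ext \<phi> (frag_cmul z a) = mult_ext \<phi> a powi z"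
proof -
  have "mult_ext \<phi> (frag_cmul z a) =
      (\<Prod>x\<in>Poly_Mapping.keys a. \<phi> x powi Poly_Mapping.lookup (frag_cmul z a) x)"
    by (rule mult_ext_superset) auto
  also have "\<dots> = (\<Prod>x\<in>Poly_Mapping.keys a. (\<phi> x powi Poly_Mapping.lookup a x) powi z)"
    by (simp add: mult.commute[of z] power_int_mult)
  also have "\<dots> = mult_ext \<phi> a powi z"
    unfolding mult_ext_def
    by (simp add: prod_powi)
  finally show ?thesis .
qed

lemma mult_ext_diff:
  assumes "\<And>x. \<phi> x \<noteq> 0"
  shows "mult_ext \<phi> (a - b) = mult_ext \<phi> a / mult_ext \<phi> b"
  using mult_ext_add[of \<phi> "a - b" b, OF assms] mult_ext_nonzero[of \<phi> b] assms
  by (simp add: field_simps)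

lemma mult_ext_sum:
  assumes "\<And>x. \<phi> x \<noteq> 0"
  shows "mult_ext \<phi> (sum f A) = (\<Prod>i\<in>A. mult_ext \<phi> (f i))"
  by (induction A rule: infinite_finite_induct) (auto simp: mult_ext_add assms)

lemma mult_ext_extend:
  assumes "\<And>x. \<phi> x \<noteq> 0"
  shows "mult_ext \<phi> (frag_extend \<psi> c) = mult_ext (\<lambda>x. mult_ext \<phi> (\<psi> x)) c"
  by (induction c rule: frag_induct)
    (auto simp: frag_extend_diff mult_ext_diff mult_ext_nonzero assms)

section \<open>Free modules over a group ring\<close>

text \<open>
  The free \<open>\<int>G\<close>-module on a set is the free abelian group on pairs of a group element and a basis
  element.  An equivariant map is determined by its values on the pairs whose group element is
  \<open>\<one>\<close>, and \<open>module_ext\<close> extends such values.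
\<close>

definition act ::
  "('g, 'x) monoid_scheme \<Rightarrow> 'g \<Rightarrow> (('g \<times> 'b) \<Rightarrow>\<^sub>0 int) \<Rightarrow> (('g \<times> 'b) \<Rightarrow>\<^sub>0 int)" where
  "act G g = frag_extend (\<lambda>(h, b). frag_of (g \<otimes>\<^bsub>G\<^esub> h, b))"

definition module_ext ::
  "('g, 'x) monoid_scheme \<Rightarrow> ('b \<Rightarrow> (('g \<times> 'c) \<Rightarrow>\<^sub>0 int)) \<Rightarrow> (('g \<times> 'b) \<Rightarrow>\<^sub>0 int) \<Rightarrow>
    (('g \<times> 'c) \<Rightarrow>\<^sub>0 int)" where
  "module_ext G \<phi> = frag_extend (\<lambda>(h, b). act G h (\<phi> b))"

definition free_chains :: "('g, 'x) monoid_scheme \<Rightarrow> 'b set \<Rightarrow> (('g \<times> 'b) \<Rightarrow>\<^sub>0 int) set" where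
  "free_chains G S = {c. Poly_Mapping.keys c \<subseteq> carrier G \<times> S}"

lemma act_zero [simp]: "act G g 0 = 0"
  by (simp add: act_def)

lemma act_of [simp]: "act G g (frag_of (h, b)) = frag_of (g \<otimes>\<^bsub>G\<^esub> h, b)"
  by (simp add: act_def)

lemma act_linear:
  "act G g (a + b) = act G g a + act G g b"
  "act G g (a - b) = act G g a - act G g b"
  "act G g (- a) = - act G g a"
  "act G g (frag_cmul z a) = frag_cmul z (act G g a)"
  by (simp_all add: act_def frag_extend_linear)

lemma act_sum: "act G g (sum f A) = (\<Sum>i\<in>A. act G g (f i))"
  by (induction A rule: infinite_finite_induct) (auto simp: act_linear)

lemma module_ext_zero [simp]: "module_ext G \<phi> 0 = 0"
  by (simp add: module_ext_def)

lemma module_ext_of [simp]: "module_ext G \<phi> (frag_of (h, b)) = act G h (\<phi> b)"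
  by (simp add: module_ext_def)

lemma module_ext_linear:
  "module_ext G \<phi> (a + b) = module_ext G \<phi> a + module_ext G \<phi> b"
  "module_ext G \<phi> (a - b) = module_ext G \<phi> a - module_ext G \<phi> b"
  "module_ext G \<phi> (- a) = - module_ext G \<phi> a"
  "module_ext G \<phi> (frag_cmul z a) = frag_cmul z (module_ext G \<phi> a)"
  by (simp_all add: module_ext_def frag_extend_linear)

lemma module_ext_sum: "module_ext G \<phi> (sum f A) = (\<Sum>i\<in>A. module_ext G \<phi> (f i))"
  by (induction A rule: infinite_finite_induct) (auto simp: module_ext_linear)

lemma chains_zero [simp]: "0 \<in> free_chains G S"
  by (simp add: free_chains_def)

lemma chains_of [simp]: "frag_of (h, b) \<in> free_chains G S \<longleftrightarrow> h \<in> carrier G \<and> b \<in> S"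
  by (simp add: free_chains_def)

lemma chains_diff: "a \<in> free_chains G S \<Longrightarrow> b \<in> free_chains G S \<Longrightarrow> a - b \<in> free_chains G S"
  using keys_diff[of a b] by (auto simp: free_chains_def)

lemma chains_add: "a \<in> free_chains G S \<Longrightarrow> b \<in> free_chains G S \<Longrightarrow> a + b \<in> free_chains G S"
  using keys_add[of a b] by (auto simp: free_chains_def)

lemma chains_minus: "a \<in> free_chains G S \<Longrightarrow> - a \<in> free_chains G S"
  by (auto simp: free_chains_def)

lemma chains_cmul: "a \<in> free_chains G S \<Longrightarrow> frag_cmul z a \<in> free_chains G S"
  using keys_cmul[of z a] by (auto simp: free_chains_def)

lemma chains_sum: "(\<And>i. i \<in> A \<Longrightarrow> f i \<in> free_chains G S) \<Longrightarrow> sum f A \<in> free_chains G S"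
  by (induction A rule: infinite_finite_induct) (auto simp: chains_add)

lemmas chains_closed = chains_add chains_diff chains_minus chains_cmul chains_sum

lemma chains_induct [consumes 1, case_names zero of diff]:
  assumes "c \<in> free_chains G S"
    and "P 0"
    and "\<And>h b. h \<in> carrier G \<Longrightarrow> b \<in> S \<Longrightarrow> P (frag_of (h, b))"
    and "\<And>a b. a \<in> free_chains G S \<Longrightarrow> b \<in> free_chains G S \<Longrightarrow> P a \<Longrightarrow> P b \<Longrightarrow> P (a - b)"
  shows "P c"
  by (rule free_Abelian_group_induct[of c "carrier G \<times> S"])
    (use assms in \<open>auto simp: free_chains_def\<close>)

lemma frag_extend_in_chains:
  assumes "c \<in> free_chains G S" "\<And>h b. h \<in> carrier G \<Longrightarrow> b \<in> S \<Longrightarrow> \<psi> (h, b) \<in> free_chains G' S'"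
  shows "frag_extend \<psi> c \<in> free_chains G' S'"
  using assms(1) by (induction rule: chains_induct) (auto simp: frag_extend_diff chains_diff assms(2))

context group
begin

lemma act_in_chains:
  assumes "h \<in> carrier G" "c \<in> free_chains G S"
  shows "act G h c \<in> free_chains G S"
  unfolding act_def using assms(2) by (rule frag_extend_in_chains) (use assms(1) in auto)

lemma act_act:
  assumes "g \<in> carrier G" "h \<in> carrier G" "c \<in> free_chains G S"
  shows "act G g (act G h c) = act G (g \<otimes> h) c"
  using assms(3)
  by (induction rule: chains_induct) (use assms in \<open>auto simp: act_linear m_assoc\<close>)

lemma act_one:
  assumes "c \<in> free_chains G S"
  shows "act G \<one> c = c"
  using assms by (induction rule: chains_induct) (auto simp: act_linear)

lemma module_ext_act:
  assumes "g \<in> carrier G" "c \<in> free_chains G S" "\<And>b. b \<in> S \<Longrightarrow> \<phi> b \<in> free_chains G S'"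
  shows "module_ext G \<phi> (act G g c) = act G g (module_ext G \<phi> c)"
  using assms(2)
  by (induction rule: chains_induct)
    (use assms in \<open>auto simp: act_linear module_ext_linear act_act[of _ _ _ S']\<close>)

lemma module_ext_in_chains:
  assumes "c \<in> free_chains G S" "\<And>b. b \<in> S \<Longrightarrow> \<phi> b \<in> free_chains G S'"
  shows "module_ext G \<phi> c \<in> free_chains G S'"
  unfolding module_ext_def using assms(1)
  by (rule frag_extend_in_chains) (use assms(2) in \<open>auto simp: act_in_chains\<close>)

text \<open>For equivariant maps, an identity between composites need only be checked on the basis.\<close>

lemma module_ext_compose:
  assumes "c \<in> free_chains G S" "\<And>b. b \<in> S \<Longrightarrow> \<psi> b \<in> free_chains G S'"
    "\<And>b. b \<in> S' \<Longrightarrow> \<phi> b \<in> free_chains G S''"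
  shows "module_ext G \<phi> (module_ext G \<psi> c) = module_ext G (\<lambda>b. module_ext G \<phi> (\<psi> b)) c"
  using assms(1)
  by (induction rule: chains_induct)
    (use assms in \<open>auto simp: module_ext_linear module_ext_act[of _ _ S' \<phi> S'']\<close>)

lemma module_ext_cong:
  assumes "c \<in> free_chains G S" "\<And>b. b \<in> S \<Longrightarrow> \<phi> b = \<psi> b"
  shows "module_ext G \<phi> c = module_ext G \<psi> c"
  using assms(1) by (induction rule: chains_induct) (auto simp: module_ext_linear assms(2))

lemma module_ext_basis:
  assumes "c \<in> free_chains G S"
  shows "module_ext G (\<lambda>b. frag_of (\<one>, b)) c = c"
  using assms by (induction rule: chains_induct) (auto simp: module_ext_linear)

lemma module_ext_minus:
  "module_ext G (\<lambda>b. \<phi> b - \<psi> b) c = module_ext G \<phi> c - module_ext G \<psi> c"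
  by (induction c rule: frag_induct)
    (auto simp: module_ext_linear act_linear)

end

section \<open>Contractible complexes and the comparison of resolutions\<close>

definition collapse :: "('g, 'x) monoid_scheme \<Rightarrow> (('g \<times> 'b) \<Rightarrow>\<^sub>0 int) \<Rightarrow> (('g \<times> 'b) \<Rightarrow>\<^sub>0 int)" where
  "collapse G = frag_extend (\<lambda>(h, b). frag_of (\<one>\<^bsub>G\<^esub>, b))"

lemma collapse_act: "collapse G (act G h c) = collapse G c"
  by (induction c rule: frag_induct) (auto simp: collapse_def act_linear frag_extend_diff)

text \<open>
  A free resolution of the trivial module: \<open>S k\<close> is the basis in degree \<open>k\<close>, \<open>d\<close> the boundary on
  the basis, and \<open>s\<close> a contraction of the underlying complex of abelian groups, which is not
  equivariant.  In degree \<open>0\<close> it contracts relative to the augmentation, represented by the map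
  \<open>collapse\<close> that replaces the group element by \<open>\<one>\<close>.  The condition \<open>d \<circ> d = 0\<close> is split off
  because for the bar resolution it follows from the contraction.
\<close>

locale contracted_modules = group G for G (structure) +
  fixes S :: "nat \<Rightarrow> 'b set"
    and d :: "'b \<Rightarrow> (('a \<times> 'b) \<Rightarrow>\<^sub>0 int)"
    and s :: "'a \<times> 'b \<Rightarrow> (('a \<times> 'b) \<Rightarrow>\<^sub>0 int)"
  assumes d_in: "b \<in> S (Suc k) \<Longrightarrow> d b \<in> free_chains G (S k)"
    and s_in: "h \<in> carrier G \<Longrightarrow> b \<in> S k \<Longrightarrow> s (h, b) \<in> free_chains G (S (Suc k))"
    and contraction_0: "h \<in> carrier G \<Longrightarrow> b \<in> S 0 \<Longrightarrow>
      module_ext G d (s (h, b)) = frag_of (h, b) - frag_of (\<one>, b)"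
    and contraction: "h \<in> carrier G \<Longrightarrow> b \<in> S (Suc k) \<Longrightarrow>
      module_ext G d (s (h, b)) + frag_extend s (act G h (d b)) = frag_of (h, b)"
    and collapse_d: "b \<in> S 1 \<Longrightarrow> collapse G (d b) = 0"
begin

abbreviation bd where "bd \<equiv> module_ext G d"

lemma bd_in: "c \<in> free_chains G (S (Suc k)) \<Longrightarrow> bd c \<in> free_chains G (S k)"
  by (rule module_ext_in_chains) (auto intro: d_in)

lemma s_ext_in: "c \<in> free_chains G (S k) \<Longrightarrow> frag_extend s c \<in> free_chains G (S (Suc k))"
  by (rule frag_extend_in_chains) (auto intro: s_in)

text \<open>
  On cycles the contraction formula loses its second term, so the contraction is a primitive.
\<close>

lemma fill_cycle:
  assumes "c \<in> free_chains G (S (Suc k))" "bd c = 0"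
  shows "bd (frag_extend s c) = c"
proof -
  have "bd (frag_extend s c) + frag_extend s (bd c) = c"
    using assms(1) by (induction rule: chains_induct)
      (auto simp: frag_extend_diff module_ext_linear contraction, simp add: algebra_simps)
  then show ?thesis using assms(2) by simp
qed

lemma fill_cycle_0:
  assumes "c \<in> free_chains G (S 0)" "collapse G c = 0"
  shows "bd (frag_extend s c) = c"
proof -
  have "bd (frag_extend s c) = c - collapse G c"
    using assms(1) by (induction rule: chains_induct)
      (auto simp: collapse_def frag_extend_diff module_ext_linear contraction_0)
  then show ?thesis using assms(2) by simp
qed

text \<open>
  The contraction forces \<open>d \<circ> d = 0\<close> as soon as it produces the basis one degree up: the boundary
  of \<open>s x\<close> is \<open>x - s (d x)\<close>, and by induction \<open>s (d x)\<close> has boundary \<open>d x\<close>.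
\<close>

lemma d_d_of_generation:
  assumes "\<And>b k. b \<in> S (Suc k) \<Longrightarrow> \<exists>h\<in>carrier G. \<exists>b'\<in>S k. s (h, b') = frag_of (\<one>, b)"
  shows "b \<in> S (Suc (Suc k)) \<Longrightarrow> bd (d b) = 0"
proof (induction k arbitrary: b)
  case 0
  obtain h t where ht: "h \<in> carrier G" "t \<in> S (Suc 0)" "s (h, t) = frag_of (\<one>, b)"
    using assms[OF 0] by blast
  let ?c = "act G h (d t)"
  have c: "?c \<in> free_chains G (S 0)" using ht by (auto intro: act_in_chains d_in)
  have "collapse G ?c = 0" using collapse_d[of t] ht by (simp add: collapse_act)
  then have fill: "bd (frag_extend s ?c) = ?c" using c by (intro fill_cycle_0)
  have "d b = bd (s (h, t))" using ht 0 by (simp add: act_one[OF d_in])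
  also have "\<dots> = frag_of (h, t) - frag_extend s ?c"
    using contraction[OF ht(1,2)] by (simp add: algebra_simps)
  finally show ?case using fill by (simp add: module_ext_linear)
next
  case (Suc k)
  obtain h t where ht: "h \<in> carrier G" "t \<in> S (Suc (Suc k))" "s (h, t) = frag_of (\<one>, b)"
    using assms[OF Suc.prems] by blast
  let ?c = "act G h (d t)"
  have c: "?c \<in> free_chains G (S (Suc k))" using ht by (auto intro: act_in_chains d_in)
  have "bd ?c = 0"
    using ht Suc.IH[of t] by (simp add: module_ext_act[OF _ d_in d_in])
  then have fill: "bd (frag_extend s ?c) = ?c" using c by (intro fill_cycle)
  have "d b = bd (s (h, t))" using ht Suc.prems by (simp add: act_one[OF d_in])
  also have "\<dots> = frag_of (h, t) - frag_extend s ?c"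
    using contraction[OF ht(1,2)] by (simp add: algebra_simps)
  finally show ?case using fill by (simp add: module_ext_linear)
qed

end

locale contracted_resolution = contracted_modules G S d s
  for G (structure) and S :: "nat \<Rightarrow> 'b set" and d s +
  assumes d_d: "b \<in> S (Suc (Suc k)) \<Longrightarrow> module_ext G d (d b) = 0"
begin

text \<open>
  The value of a chain map on a basis element is the contraction of its value on the boundary:
  that value is a cycle by induction, so the contraction fills it.
\<close>

primrec lift :: "('v \<Rightarrow> 'b) \<Rightarrow> ('v \<Rightarrow> (('a \<times> 'v) \<Rightarrow>\<^sub>0 int)) \<Rightarrow> nat \<Rightarrow> 'v \<Rightarrow> (('a \<times> 'b) \<Rightarrow>\<^sub>0 int)" where
  "lift i dP 0 b = frag_of (\<one>, i b)"
| "lift i dP (Suc k) b = frag_extend s (module_ext G (lift i dP k) (dP b))"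

text \<open>
  A self-map that is the identity in degree zero is homotopic to the identity for the same reason:
  what the homotopy in degree \<open>k\<close> leaves uncorrected in degree \<open>k + 1\<close> is a cycle, which can be filled.
\<close>

primrec homotopy ::
  "(nat \<Rightarrow> 'b \<Rightarrow> (('a \<times> 'b) \<Rightarrow>\<^sub>0 int)) \<Rightarrow> nat \<Rightarrow> 'b \<Rightarrow> (('a \<times> 'b) \<Rightarrow>\<^sub>0 int)" where
  "homotopy M 0 b = 0"
| "homotopy M (Suc k) b =
     frag_extend s (frag_of (\<one>, b) - M (Suc k) b - module_ext G (homotopy M k) (d b))"

lemma homotopy_identity:
  assumes M_in: "\<And>k b. b \<in> S k \<Longrightarrow> M k b \<in> free_chains G (S k)"
    and M_0: "\<And>b. b \<in> S 0 \<Longrightarrow> M 0 b = frag_of (\<one>, b)"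
    and M_chain: "\<And>k b. b \<in> S (Suc k) \<Longrightarrow> bd (M (Suc k) b) = module_ext G (M k) (d b)"
  shows "b \<in> S k \<Longrightarrow> homotopy M k b \<in> free_chains G (S (Suc k))"
    and "b \<in> S (Suc k) \<Longrightarrow>
      bd (homotopy M (Suc k) b) = frag_of (\<one>, b) - M (Suc k) b - module_ext G (homotopy M k) (d b)"
proof -
  show H_in: "b \<in> S k \<Longrightarrow> homotopy M k b \<in> free_chains G (S (Suc k))" for b k
  proof (induction k arbitrary: b)
    case (Suc k)
    have "module_ext G (homotopy M k) (d b) \<in> free_chains G (S (Suc k))"
      by (rule module_ext_in_chains[OF d_in]) (use Suc in auto)
    then show ?case
      using Suc.prems by (auto intro!: s_ext_in chains_closed M_in)
  qed simp
  show "b \<in> S (Suc k) \<Longrightarrow>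
      bd (homotopy M (Suc k) b) = frag_of (\<one>, b) - M (Suc k) b - module_ext G (homotopy M k) (d b)"
  proof (induction k arbitrary: b)
    case 0
    have "module_ext G (M 0) (d b) = d b"
      using module_ext_cong[of "d b" "S 0" "M 0" "\<lambda>b. frag_of (\<one>, b)"] M_0 d_in[OF 0]
        module_ext_basis[of "d b" "S 0"] by auto
    moreover have H0: "module_ext G (homotopy M 0) (d b) = 0"
      using module_ext_cong[OF d_in[OF 0], of "homotopy M 0" "\<lambda>_. 0 - 0"]
      by (simp only: module_ext_minus, simp)
    moreover have "bd (frag_of (\<one>, b)) = d b"
      using 0 by (simp add: act_one[OF d_in])
    ultimately show ?case
      using 0 by (simp only: homotopy.simps(2))
        (intro fill_cycle[of _ 0], auto intro!: chains_closed M_in simp: module_ext_linear M_chain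
          act_one[OF d_in])
  next
    case (Suc k)
    have db: "d b \<in> free_chains G (S (Suc k))" using Suc.prems by (rule d_in)
    have Hd: "module_ext G (homotopy M (Suc k)) (d b) \<in> free_chains G (S (Suc (Suc k)))"
      by (rule module_ext_in_chains[OF db]) (rule H_in)
    have "bd (module_ext G (homotopy M (Suc k)) (d b)) =
        module_ext G (\<lambda>b. bd (homotopy M (Suc k) b)) (d b)"
      by (rule module_ext_compose[OF db, where S' = "S (Suc (Suc k))" and S'' = "S (Suc k)"])
        (auto intro: H_in d_in simp del: homotopy.simps)
    also have "\<dots> = module_ext G (\<lambda>b. frag_of (\<one>, b) - M (Suc k) b -
        module_ext G (homotopy M k) (d b)) (d b)"
      by (rule module_ext_cong[OF db]) (rule Suc.IH)
    also have "\<dots> = d b - module_ext G (M (Suc k)) (d b) -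
        module_ext G (\<lambda>b. module_ext G (homotopy M k) (d b)) (d b)"
      by (simp add: module_ext_minus module_ext_basis[OF db])
    also have "module_ext G (\<lambda>b. module_ext G (homotopy M k) (d b)) (d b) =
        module_ext G (homotopy M k) (bd (d b))"
      by (rule module_ext_compose[OF db, where S' = "S k" and S'' = "S (Suc k)", symmetric])
        (auto intro: H_in d_in)
    finally have *: "bd (module_ext G (homotopy M (Suc k)) (d b)) =
        d b - module_ext G (M (Suc k)) (d b)"
      using d_d[OF Suc.prems] by (simp del: homotopy.simps)
    have "bd (frag_of (\<one>, b)) = d b"
      using Suc.prems by (simp add: act_one[OF d_in])
    then show ?case
      unfolding homotopy.simps(2)[of M "Suc k"]
      by (intro fill_cycle[of _ "Suc k"])
        (use Suc.prems Hd * in \<open>auto intro!: chains_closed M_in simp: module_ext_linear M_chain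
          simp del: homotopy.simps module_ext_of\<close>)
  qed
qed

end

lemma lift_in_chains:
  assumes "contracted_resolution G SP dP sP" "contracted_resolution G SQ dQ sQ"
    and "\<And>b. b \<in> SP 0 \<Longrightarrow> i b \<in> SQ 0"
  shows "b \<in> SP k \<Longrightarrow> contracted_resolution.lift G sQ i dP k b \<in> free_chains G (SQ k)"
proof (induction k arbitrary: b)
  interpret P: contracted_resolution G SP dP sP by fact
  interpret Q: contracted_resolution G SQ dQ sQ by fact
  {
    case 0
    then show ?case using assms(3) by simp
  next
    case (Suc k)
    then show ?case
      by (auto intro!: Q.s_ext_in P.module_ext_in_chains[OF P.d_in])
  }
qed

text \<open>
  The element to be filled is a cycle: in positive degrees by induction and \<open>d \<circ> d = 0\<close>, in degree
  zero because the map preserves the augmentation.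
\<close>

lemma lift_chain_map:
  assumes "contracted_resolution G SP dP sP" "contracted_resolution G SQ dQ sQ"
    and i: "\<And>b. b \<in> SP 0 \<Longrightarrow> i b \<in> SQ 0"
    and "b \<in> SP (Suc k)"
  shows "module_ext G dQ (contracted_resolution.lift G sQ i dP (Suc k) b) =
    module_ext G (contracted_resolution.lift G sQ i dP k) (dP b)"
  using assms(4)
proof (induction k arbitrary: b)
  interpret P: contracted_resolution G SP dP sP by fact
  interpret Q: contracted_resolution G SQ dQ sQ by fact
  note lift_in = lift_in_chains[OF assms(1,2), of i, OF i]
  {
    case 0
    have db: "dP b \<in> free_chains G (SP 0)" using 0 by (rule P.d_in)
    have "collapse G (module_ext G (Q.lift i dP 0) (dP b)) =
        frag_extend (\<lambda>(h, b). frag_of (h, i b)) (collapse G (dP b))"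
      using db by (induction rule: chains_induct)
        (auto simp: collapse_def frag_extend_diff module_ext_linear)
    then have "collapse G (module_ext G (Q.lift i dP 0) (dP b)) = 0"
      using P.collapse_d 0 by simp
    then show ?case
      unfolding Q.lift.simps(2)
      by (intro Q.fill_cycle_0 P.module_ext_in_chains[OF db]) (auto intro: lift_in i)
  next
    case (Suc k)
    have db: "dP b \<in> free_chains G (SP (Suc k))" using Suc.prems by (rule P.d_in)
    have "Q.bd (module_ext G (Q.lift i dP (Suc k)) (dP b)) =
        module_ext G (\<lambda>b. Q.bd (Q.lift i dP (Suc k) b)) (dP b)"
      by (rule P.module_ext_compose[OF db]) (auto intro: lift_in Q.d_in simp del: Q.lift.simps)
    also have "\<dots> = module_ext G (\<lambda>b. module_ext G (Q.lift i dP k) (dP b)) (dP b)"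
      by (rule P.module_ext_cong[OF db]) (rule Suc.IH)
    also have "\<dots> = module_ext G (Q.lift i dP k) (P.bd (dP b))"
      by (rule P.module_ext_compose[OF db, symmetric])
        (auto intro: lift_in P.d_in simp del: Q.lift.simps)
    also have "\<dots> = 0" using P.d_d[OF Suc.prems] by simp
    finally show ?case
      unfolding Q.lift.simps(2)[of i dP "Suc k"]
      by (intro Q.fill_cycle[of _ k] P.module_ext_in_chains[OF db])
        (auto intro: lift_in simp del: Q.lift.simps)
  }
qed

section \<open>The normalized bar resolution\<close>

text \<open>
  All faces but the first, arranged for induction on the list: the later faces of \<open>h # x\<close> keep
  the entry \<open>h\<close> and are faces of \<open>x\<close>, with the opposite sign.
\<close>

fun later_faces :: "('g, 'x) monoid_scheme \<Rightarrow> ('g list \<Rightarrow> 'a::ab_group_add) \<Rightarrow> 'g list \<Rightarrow> 'a" where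
  "later_faces G F [] = 0"
| "later_faces G F [h] = - F []"
| "later_faces G F (h # h' # t) = - F ((h \<otimes>\<^bsub>G\<^esub> h') # t) - later_faces G (\<lambda>x. F (h # x)) (h' # t)"

lemma later_faces_sum:
  assumes "hs \<noteq> []"
  shows "(\<Sum>u=1..length hs - 1. frag_cmul ((-1) ^ u) (F (merge_at G u hs)))
      + frag_cmul ((-1) ^ length hs) (F (butlast hs)) = later_faces G F hs"
  using assms
proof (induction G F hs rule: later_faces.induct)
  case (3 G F h h' t)
  let ?hs = "h # h' # t" and ?k = "length t"
  have m1: "merge_at G 1 ?hs = (h \<otimes>\<^bsub>G\<^esub> h') # t"
    by (simp add: merge_at_def)
  have m: "merge_at G (Suc u) ?hs = h # merge_at G u (h' # t)" if "u \<ge> 1" for u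
    using that by (cases u) (auto simp: merge_at_def)
  define S where "S = (\<Sum>u=1..?k. frag_cmul ((-1) ^ u) (F (h # merge_at G u (h' # t))))"
  have IH: "later_faces G (\<lambda>x. F (h # x)) (h' # t) =
      S + frag_cmul ((-1) ^ Suc ?k) (F (h # butlast (h' # t)))"
    unfolding S_def using 3 by (simp del: butlast.simps)
  have "(\<Sum>u=1..length ?hs - 1. frag_cmul ((-1) ^ u) (F (merge_at G u ?hs))) =
      (\<Sum>u=1..Suc ?k. frag_cmul ((-1) ^ u) (F (merge_at G u ?hs)))"
    by simp
  also have "\<dots> = - F ((h \<otimes>\<^bsub>G\<^esub> h') # t) +
      (\<Sum>u=Suc 1..Suc ?k. frag_cmul ((-1) ^ u) (F (merge_at G u ?hs)))"
    by (subst sum.atLeast_Suc_atMost) (use m1 in auto)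
  also have "(\<Sum>u=Suc 1..Suc ?k. frag_cmul ((-1) ^ u) (F (merge_at G u ?hs))) =
      (\<Sum>u=1..?k. frag_cmul ((-1) ^ Suc u) (F (merge_at G (Suc u) ?hs)))"
    by (subst sum.shift_bounds_cl_Suc_ivl) simp
  also have "\<dots> = (\<Sum>u=1..?k. - frag_cmul ((-1) ^ u) (F (h # merge_at G u (h' # t))))"
    by (rule sum.cong) (auto simp: m)
  also have "\<dots> = - S" by (simp only: S_def sum_negf)
  finally have faces: "(\<Sum>u=1..length ?hs - 1. frag_cmul ((-1) ^ u) (F (merge_at G u ?hs))) =
      - F ((h \<otimes>\<^bsub>G\<^esub> h') # t) + - S" .
  have "frag_cmul ((-1) ^ length ?hs) (F (butlast ?hs)) =
      - frag_cmul ((-1) ^ Suc ?k) (F (h # butlast (h' # t)))"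
    by simp
  then show ?case
    unfolding faces later_faces.simps(3) IH by (simp del: butlast.simps)
qed auto

lemma later_faces_additive:
  assumes "\<And>a b. T (a - b) = T a - T b" "\<And>a. T (- a) = - T a" "T 0 = 0"
  shows "T (later_faces G F hs) = later_faces G (\<lambda>x. T (F x)) hs"
  by (induction G F hs rule: later_faces.induct) (auto simp: assms)

lemma later_faces_zero: "later_faces G (\<lambda>_. 0) hs = (0 :: 'a :: ab_group_add)"
  by (induction hs rule: induct_list012) auto

lemma (in monoid) later_faces_cong:
  assumes "set hs \<subseteq> carrier G"
    "\<And>x. set x \<subseteq> carrier G \<Longrightarrow> Suc (length x) = length hs \<Longrightarrow> F x = F' x"
  shows "later_faces G F hs = later_faces G F' hs"
  using assms
proof (induction hs arbitrary: F F' rule: induct_list012)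
  case (3 h h' t)
  have "later_faces G (\<lambda>x. F (h # x)) (h' # t) = later_faces G (\<lambda>x. F' (h # x)) (h' # t)"
    by (rule "3.IH"(2)) (use 3 in auto)
  moreover have "F ((h \<otimes> h') # t) = F' ((h \<otimes> h') # t)"
    by (rule "3.prems"(2)) (use "3.prems"(1) in auto)
  ultimately show ?case by simp
qed auto

lemma (in monoid) later_faces_in_chains:
  assumes "set hs \<subseteq> carrier G"
    "\<And>x. set x \<subseteq> carrier G \<Longrightarrow> Suc (length x) = length hs \<Longrightarrow> F x \<in> free_chains G S"
  shows "later_faces G F hs \<in> free_chains G S"
  using assms
proof (induction hs arbitrary: F rule: induct_list012)
  case (3 h h' t)
  have "later_faces G (\<lambda>x. F (h # x)) (h' # t) \<in> free_chains G S"
    by (rule "3.IH"(2)) (use 3 in auto)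
  then show ?case using 3 by (auto intro!: chains_closed)
qed (auto intro: chains_closed)

definition bar_d :: "('g, 'x) monoid_scheme \<Rightarrow> 'g list \<Rightarrow> (('g \<times> 'g list) \<Rightarrow>\<^sub>0 int)" where
  "bar_d G hs = (if hs = [] then 0 else bar_boundary_symbol G (length hs) hs)"

text \<open>
  The contraction moves the group coefficient into the first slot of the symbol.
\<close>

definition bar_s :: "('g, 'x) monoid_scheme \<Rightarrow> 'g \<times> 'g list \<Rightarrow> (('g \<times> 'g list) \<Rightarrow>\<^sub>0 int)" where
  "bar_s G = (\<lambda>(h, hs). bar_symbol G (h # hs))"

lemma bar_act_eq: "bar_act G = act G"
  by (simp add: bar_act_def act_def fun_eq_iff)

lemma bar_d_Cons: "bar_d G (h # t) = act G h (bar_symbol G t) + later_faces G (bar_symbol G) (h # t)"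
  using later_faces_sum[of "h # t" "bar_symbol G" G]
  by (simp add: bar_d_def bar_boundary_symbol_def bar_act_eq algebra_simps)

lemma bar_boundary_eq:
  assumes "c \<in> free_chains G (bar_basis G (Suc k))"
  shows "bar_boundary G (Suc k) c = module_ext G (bar_d G) c"
  unfolding bar_boundary_def module_ext_def bar_act_eq
  by (rule frag_extend_eq) (use assms in \<open>auto simp: free_chains_def bar_d_def bar_basis_def split: prod.splits\<close>)

lemma carrier_bar_module: "carrier (bar_module G k) = free_chains G (bar_basis G k)"
  by (auto simp: bar_module_def free_chains_def)

context group
begin

lemma bar_symbol_in_chains:
  "set hs \<subseteq> carrier G \<Longrightarrow> length hs = k \<Longrightarrow> bar_symbol G hs \<in> free_chains G (bar_basis G k)"
  by (auto simp: bar_symbol_def bar_basis_def)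

lemma bar_d_in_chains:
  assumes "hs \<in> bar_basis G (Suc k)"
  shows "bar_d G hs \<in> free_chains G (bar_basis G k)"
proof -
  obtain h t where [simp]: "hs = h # t" using assms by (cases hs) (auto simp: bar_basis_def)
  have hs: "set hs \<subseteq> carrier G" "length hs = Suc k" using assms by (auto simp: bar_basis_def)
  show ?thesis
    using hs by (auto simp: bar_d_Cons intro!: chains_add act_in_chains bar_symbol_in_chains
      later_faces_in_chains)
qed

text \<open>
  The first face of \<open>[h | hs]\<close> is \<open>h [hs]\<close>; its second face and the remaining ones cancel against the
  contraction of the boundary of \<open>h [hs]\<close>.  For \<open>h = \<one>\<close> the symbol \<open>[h | hs]\<close> vanishes by
  normalization and the roles are exchanged: the first face of \<open>[hs]\<close> is then contracted to \<open>[hs]\<close>.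
\<close>

lemma bar_contraction:
  assumes h: "h \<in> carrier G" and "hs \<in> bar_basis G (Suc k)"
  shows "module_ext G (bar_d G) (bar_s G (h, hs)) + frag_extend (bar_s G) (act G h (bar_d G hs)) =
    frag_of (h, hs)"
proof -
  obtain h' t where [simp]: "hs = h' # t"
    using assms by (cases hs) (auto simp: bar_basis_def)
  have hs: "h' \<in> carrier G" "set t \<subseteq> carrier G" "\<one> \<notin> set t" "h' \<noteq> \<one>" "length t = k"
    using assms by (auto simp: bar_basis_def)
  define T where "T c = frag_extend (bar_s G) (act G h c)" for c
  have T: "T (a - b) = T a - T b" "T (- a) = - T a" "T 0 = 0" "T (a + b) = T a + T b" for a b
    by (auto simp: T_def act_linear frag_extend_linear)
  have T_symbol: "T (bar_symbol G x) = bar_symbol G (h # x)" for x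
    using h by (auto simp: T_def bar_symbol_def bar_s_def)
  have "T (bar_d G hs) = T (act G h' (bar_symbol G t)) +
      later_faces G (\<lambda>x. bar_symbol G (h # x)) (h' # t)"
    by (simp add: bar_d_Cons T later_faces_additive[of T] T_symbol)
  also have "T (act G h' (bar_symbol G t)) = bar_symbol G ((h \<otimes> h') # t)"
    using h hs by (auto simp: T_def bar_symbol_def bar_s_def)
  finally have Td: "T (bar_d G hs) = bar_symbol G ((h \<otimes> h') # t) +
      later_faces G (\<lambda>x. bar_symbol G (h # x)) (h' # t)" .
  show ?thesis
  proof (cases "h = \<one>")
    case True
    then have "(\<lambda>x. bar_symbol G (h # x)) = (\<lambda>_. 0)"
      by (auto simp: bar_symbol_def)
    then show ?thesis
      using Td True hs by (simp add: T_def later_faces_zero bar_s_def bar_symbol_def)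
  next
    case False
    have "bar_s G (h, hs) = frag_of (\<one>, h # hs)"
      using False hs by (auto simp: bar_s_def bar_symbol_def)
    moreover have "h # hs \<in> bar_basis G (Suc (Suc k))"
      using False assms by (auto simp: bar_basis_def)
    ultimately have "module_ext G (bar_d G) (bar_s G (h, hs)) = bar_d G (h # hs)"
      by (simp add: act_one[OF bar_d_in_chains])
    also have "\<dots> = frag_of (h, hs) - bar_symbol G ((h \<otimes> h') # t) -
      later_faces G (\<lambda>x. bar_symbol G (h # x)) (h' # t)"
    proof -
      have "act G h (bar_symbol G hs) = frag_of (h, hs)"
        using h hs by (simp add: bar_symbol_def)
      then show ?thesis by (simp add: bar_d_Cons)
    qed
    finally show ?thesis
      using Td by (simp add: T_def)
  qed
qed

lemma bar_contracted: "contracted_modules G (bar_basis G) (bar_d G) (bar_s G)"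
proof
  fix b k h
  show "b \<in> bar_basis G (Suc k) \<Longrightarrow> bar_d G b \<in> free_chains G (bar_basis G k)"
    by (rule bar_d_in_chains)
  show "h \<in> carrier G \<Longrightarrow> b \<in> bar_basis G k \<Longrightarrow> bar_s G (h, b) \<in> free_chains G (bar_basis G (Suc k))"
    by (auto simp: bar_s_def bar_basis_def bar_symbol_def)
  show "h \<in> carrier G \<Longrightarrow> b \<in> bar_basis G (Suc k) \<Longrightarrow>
      module_ext G (bar_d G) (bar_s G (h, b)) + frag_extend (bar_s G) (act G h (bar_d G b)) =
      frag_of (h, b)"
    by (rule bar_contraction)
  show "module_ext G (bar_d G) (bar_s G (h, b)) = frag_of (h, b) - frag_of (\<one>, b)"
    if "h \<in> carrier G" "b \<in> bar_basis G 0"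
    using that
    by (cases "h = \<one>")
      (auto simp: bar_basis_def bar_s_def bar_symbol_def bar_d_Cons act_linear)
  show "collapse G (bar_d G b) = 0" if b: "b \<in> bar_basis G 1"
  proof -
    obtain h where "b = [h]" "h \<in> carrier G" "h \<noteq> \<one>"
      using b by (cases b; cases "tl b") (auto simp: bar_basis_def)
    then show ?thesis
      by (simp add: bar_d_Cons bar_symbol_def collapse_def frag_extend_diff)
  qed
qed

text \<open>
  Every basis symbol \<open>[h | t]\<close> is the contraction of \<open>h [t]\<close>, so \<open>d_d_of_generation\<close> applies.
\<close>

lemma bar_resolution: "contracted_resolution G (bar_basis G) (bar_d G) (bar_s G)"
proof -
  interpret contracted_modules G "bar_basis G" "bar_d G" "bar_s G" by (rule bar_contracted)
  show ?thesis
  proof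
    fix b k assume b: "b \<in> bar_basis G (Suc (Suc k))"
    show "bd (bar_d G b) = 0"
    proof (rule d_d_of_generation[OF _ b])
      fix b k assume b: "b \<in> bar_basis G (Suc k)"
      obtain h t where [simp]: "b = h # t" using b by (cases b) (auto simp: bar_basis_def)
      have "bar_s G (h, t) = frag_of (\<one>, b)"
        using b by (auto simp: bar_s_def bar_symbol_def bar_basis_def)
      moreover have "h \<in> carrier G" "t \<in> bar_basis G k"
        using b by (auto simp: bar_basis_def)
      ultimately show "\<exists>h\<in>carrier G. \<exists>b'\<in>bar_basis G k. bar_s G (h, b') = frag_of (\<one>, b)"
        by blast
    qed
  qed
qed

end

section \<open>Cochains with multiplicative values\<close>

context group
begin

context
  fixes f :: "(('a \<times> 'a list) \<Rightarrow>\<^sub>0 int) \<Rightarrow> 'k :: field" and k :: nat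
  assumes f: "f \<in> bar_cochains G k"
begin

lemma cochain_nonzero: "c \<in> free_chains G (bar_basis G k) \<Longrightarrow> f c \<noteq> 0"
  using f by (auto simp: bar_cochains_def hom_def carrier_bar_module nonzero_mult_group_def)

lemma cochain_add:
  "a \<in> free_chains G (bar_basis G k) \<Longrightarrow> b \<in> free_chains G (bar_basis G k) \<Longrightarrow> f (a + b) = f a * f b"
  using f hom_mult[of f "bar_module G k" nonzero_mult_group a b]
  by (simp add: bar_cochains_def carrier_bar_module)
    (simp add: nonzero_mult_group_def bar_module_def)

lemma cochain_zero: "f 0 = 1"
  using cochain_add[of 0 0] cochain_nonzero[of 0] by simp

lemma cochain_diff:
  "a \<in> free_chains G (bar_basis G k) \<Longrightarrow> b \<in> free_chains G (bar_basis G k) \<Longrightarrow> f (a - b) = f a / f b"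
  using cochain_add[of "a - b" b] cochain_nonzero[of b] by (simp add: chains_diff)

lemma cochain_act:
  "h \<in> carrier G \<Longrightarrow> c \<in> free_chains G (bar_basis G k) \<Longrightarrow> f (act G h c) = f c"
  using f by (auto simp: bar_cochains_def carrier_bar_module bar_act_eq)

lemma cochain_extensional: "c \<notin> free_chains G (bar_basis G k) \<Longrightarrow> f c = undefined"
  using f by (auto simp: bar_cochains_def carrier_bar_module extensional_def)

text \<open>
  An invariant cochain does not see the group coefficients, so its composite with an equivariant map
  depends only on the image of the chain in the coinvariants.
\<close>

lemma cochain_module_ext:
  assumes "c \<in> free_chains G S" "\<And>b. b \<in> S \<Longrightarrow> \<phi> b \<in> free_chains G (bar_basis G k)"
    and "\<And>b. \<psi> b \<noteq> 0" "\<And>b. b \<in> S \<Longrightarrow> \<psi> b = f (\<phi> b)"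
  shows "f (module_ext G \<phi> c) = mult_ext \<psi> (frag_extend (\<lambda>(h, b). frag_of b) c)"
  using assms(1)
proof (induction rule: chains_induct)
  case zero
  then show ?case by (simp add: cochain_zero)
next
  case (of h b)
  then show ?case by (simp add: cochain_act assms(2,4))
next
  case (diff a b)
  have "module_ext G \<phi> a \<in> free_chains G (bar_basis G k)" "module_ext G \<phi> b \<in> free_chains G (bar_basis G k)"
    using diff.hyps assms(2) by (auto intro: module_ext_in_chains)
  then show ?case
    by (simp add: module_ext_linear frag_extend_diff mult_ext_diff assms(3) cochain_diff diff.IH)
qed

end

lemma cochainI:
  assumes "\<And>c. c \<in> free_chains G (bar_basis G k) \<Longrightarrow> f c \<noteq> (0 :: 'k :: field)"
    and "\<And>a b. a \<in> free_chains G (bar_basis G k) \<Longrightarrow> b \<in> free_chains G (bar_basis G k) \<Longrightarrow> f (a + b) = f a * f b"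
    and "\<And>h c. h \<in> carrier G \<Longrightarrow> c \<in> free_chains G (bar_basis G k) \<Longrightarrow> f (act G h c) = f c"
  shows "restrict f (free_chains G (bar_basis G k)) \<in> bar_cochains G k"
proof -
  let ?C = "free_chains G (bar_basis G k)"
  have "restrict f ?C \<in> hom (bar_module G k) nonzero_mult_group"
  proof (rule homI, unfold carrier_bar_module)
    fix a b assume ab: "a \<in> ?C" "b \<in> ?C"
    have "a \<otimes>\<^bsub>bar_module G k\<^esub> b = a + b"
      by (simp add: bar_module_def)
    moreover have "x \<otimes>\<^bsub>nonzero_mult_group\<^esub> y = x * (y :: 'k)" for x y
      by (simp add: nonzero_mult_group_def)
    ultimately show "restrict f ?C (a \<otimes>\<^bsub>bar_module G k\<^esub> b) =
      restrict f ?C a \<otimes>\<^bsub>nonzero_mult_group\<^esub> restrict f ?C b"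
      using ab chains_add[OF ab] assms(2)[OF ab] by simp
  next
    fix a assume "a \<in> ?C"
    then show "restrict f ?C a \<in> carrier nonzero_mult_group"
      using assms(1)[of a] by (simp add: nonzero_mult_group_def)
  qed
  moreover have "restrict f ?C (act G h c) = restrict f ?C c" if "h \<in> carrier G" "c \<in> ?C" for h c
    using that assms(3)[OF that] act_in_chains[OF that] by simp
  ultimately show ?thesis
    unfolding bar_cochains_def carrier_bar_module bar_act_eq mem_Collect_eq
    by (intro conjI ballI restrict_extensional)
qed

lemma cochain_eqI:
  assumes "f \<in> bar_cochains G k" "f' \<in> bar_cochains G k"
    and "\<And>hs. hs \<in> bar_basis G k \<Longrightarrow> f (frag_of (\<one>, hs)) = (f' (frag_of (\<one>, hs)) :: 'k :: field)"
  shows "f = f'"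
proof
  fix c
  show "f c = f' c"
  proof (cases "c \<in> free_chains G (bar_basis G k)")
    case True
    then show ?thesis
    proof (induction rule: chains_induct)
      case (of h b)
      have "f (act G h (frag_of (\<one>, b))) = f' (act G h (frag_of (\<one>, b)))"
        using of by (simp only: cochain_act[OF assms(1)] cochain_act[OF assms(2)] assms(3)
          chains_of one_closed simp_thms)
      then show ?case using of by simp
    qed (auto simp: cochain_zero[OF assms(1)] cochain_zero[OF assms(2)]
        cochain_diff[OF assms(1)] cochain_diff[OF assms(2)])
  qed (simp add: cochain_extensional[OF assms(1)] cochain_extensional[OF assms(2)])
qed

end

section \<open>The small resolution of a product of cyclic groups\<close>

text \<open>
  A finite abelian group is handled through coordinates: an element is determined by its exponent
  vector with respect to fixed generators of the cyclic factors.
\<close>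

definition exponent_vectors :: "nat \<Rightarrow> (nat \<Rightarrow> nat) \<Rightarrow> (nat \<Rightarrow> nat) set" where
  "exponent_vectors n m = {x. \<forall>j. if j \<in> {1..n} then x j < m j else x j = 0}"

locale cyclic_coordinates = group G for G (structure) +
  fixes n :: nat and m :: "nat \<Rightarrow> nat" and coord :: "'a \<Rightarrow> nat \<Rightarrow> nat"
  assumes m_pos: "j \<in> {1..n} \<Longrightarrow> 0 < m j"
    and coord_bij: "bij_betw coord (carrier G) (exponent_vectors n m)"
    and coord_mult: "\<lbrakk>h \<in> carrier G; h' \<in> carrier G; j \<in> {1..n}\<rbrakk> \<Longrightarrow>
      coord (h \<otimes> h') j = (coord h j + coord h' j) mod m j"
begin

definition element :: "(nat \<Rightarrow> nat) \<Rightarrow> 'a" where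
  "element = inv_into (carrier G) coord"

lemma coord_in: "h \<in> carrier G \<Longrightarrow> coord h \<in> exponent_vectors n m"
  using coord_bij by (auto simp: bij_betw_def)

lemma coord_less: "h \<in> carrier G \<Longrightarrow> j \<in> {1..n} \<Longrightarrow> coord h j < m j"
  using coord_in[of h] by (auto simp: exponent_vectors_def split: if_splits)

lemma coord_outside: "h \<in> carrier G \<Longrightarrow> j \<notin> {1..n} \<Longrightarrow> coord h j = 0"
  using coord_in[of h] by (auto simp: exponent_vectors_def split: if_splits)

lemma element_in: "x \<in> exponent_vectors n m \<Longrightarrow> element x \<in> carrier G"
  using bij_betw_imp_surj_on[OF coord_bij] by (auto simp: element_def intro: inv_into_into)

lemma coord_element: "x \<in> exponent_vectors n m \<Longrightarrow> coord (element x) = x"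
  using bij_betw_imp_surj_on[OF coord_bij] by (auto simp: element_def intro: f_inv_into_f)

lemma element_coord: "h \<in> carrier G \<Longrightarrow> element (coord h) = h"
  using bij_betw_imp_inj_on[OF coord_bij] by (simp add: element_def)

lemma coord_eqD: "h \<in> carrier G \<Longrightarrow> h' \<in> carrier G \<Longrightarrow> coord h = coord h' \<Longrightarrow> h = h'"
  using bij_betw_imp_inj_on[OF coord_bij] by (auto dest: inj_onD)

lemma coord_one: "coord \<one> = (\<lambda>_. 0)"
proof
  fix j
  show "coord \<one> j = 0"
  proof (cases "j \<in> {1..n}")
    case True
    then have "coord \<one> j = (coord \<one> j + coord \<one> j) mod m j" "coord \<one> j < m j"
      using coord_mult[of \<one> \<one> j] coord_less[of \<one> j] by auto
    then show ?thesis
      by (cases "coord \<one> j + coord \<one> j < m j") (auto simp: le_mod_geq)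
  qed (simp add: coord_outside)
qed

definition set_coord :: "'a \<Rightarrow> nat \<Rightarrow> nat \<Rightarrow> 'a" where
  "set_coord h r i = element ((coord h)(r := i))"

lemma upd_in: "h \<in> carrier G \<Longrightarrow> r \<in> {1..n} \<Longrightarrow> i < m r \<Longrightarrow> (coord h)(r := i) \<in> exponent_vectors n m"
  using coord_in[of h] by (auto simp: exponent_vectors_def)

lemma set_coord_in: "h \<in> carrier G \<Longrightarrow> r \<in> {1..n} \<Longrightarrow> i < m r \<Longrightarrow> set_coord h r i \<in> carrier G"
  by (simp add: set_coord_def element_in upd_in)

lemma coord_set_coord:
  "h \<in> carrier G \<Longrightarrow> r \<in> {1..n} \<Longrightarrow> i < m r \<Longrightarrow> coord (set_coord h r i) = (coord h)(r := i)"
  by (simp add: set_coord_def coord_element upd_in)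

lemma mult_set_coord:
  assumes "h \<in> carrier G" "r \<in> {1..n}" "i < m r"
  shows "h \<otimes> set_coord \<one> r i = set_coord h r ((coord h r + i) mod m r)"
proof (rule coord_eqD)
  have lt: "(coord h r + i) mod m r < m r"
    using assms by (simp add: m_pos)
  note in_carrier = set_coord_in[OF one_closed assms(2,3)] set_coord_in[OF assms(1,2) lt]
  show "h \<otimes> set_coord \<one> r i \<in> carrier G" "set_coord h r ((coord h r + i) mod m r) \<in> carrier G"
    using in_carrier assms by auto
  show "coord (h \<otimes> set_coord \<one> r i) = coord (set_coord h r ((coord h r + i) mod m r))"
  proof
    fix j
    show "coord (h \<otimes> set_coord \<one> r i) j = coord (set_coord h r ((coord h r + i) mod m r)) j"
    proof (cases "j \<in> {1..n}")
      case True
      then show ?thesis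
        using assms in_carrier lt coord_less[of h j]
        by (auto simp: coord_mult coord_set_coord coord_one)
    next
      case False
      then have "coord (h \<otimes> set_coord \<one> r i) j = 0"
        "coord (set_coord h r ((coord h r + i) mod m r)) j = 0"
        using in_carrier assms by (auto intro!: coord_outside)
      then show ?thesis by simp
    qed
  qed
qed

subsection \<open>Maps in a single factor\<close>

definition multidegrees :: "(nat \<Rightarrow> nat) set" where
  "multidegrees = {l. \<forall>j. j \<notin> {1..n} \<longrightarrow> l j = 0}"

definition small_basis :: "nat \<Rightarrow> (nat \<Rightarrow> nat) set" where
  "small_basis k = {l \<in> multidegrees. (\<Sum>j\<in>{1..n}. l j) = k}"

text \<open>
  The small resolution is the tensor product of the periodic resolutions of the factors, so its
  maps are built from maps changing only one coordinate of the group element and the degree in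
  the same factor.  \<open>local_op r \<phi>\<close> applies the map \<open>\<phi>\<close>, given on pairs of an exponent and a
  degree, in the factor \<open>r\<close>.
\<close>

definition put :: "nat \<Rightarrow> 'a \<times> (nat \<Rightarrow> nat) \<Rightarrow> nat \<times> nat \<Rightarrow> (('a \<times> (nat \<Rightarrow> nat)) \<Rightarrow>\<^sub>0 int)" where
  "put r = (\<lambda>(h, l) (i, k). frag_of (set_coord h r i, l(r := k)))"

definition local_op :: "nat \<Rightarrow> (nat \<times> nat \<Rightarrow> ((nat \<times> nat) \<Rightarrow>\<^sub>0 int)) \<Rightarrow>
    'a \<times> (nat \<Rightarrow> nat) \<Rightarrow> (('a \<times> (nat \<Rightarrow> nat)) \<Rightarrow>\<^sub>0 int)" where
  "local_op r \<phi> = (\<lambda>(h, l). frag_extend (put r (h, l)) (\<phi> (coord h r, l r)))"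

text \<open>
  The coordinate of a group element only represents exponents below the order of the factor, so local
  maps are required to preserve these.
\<close>

definition local_states :: "nat \<Rightarrow> (nat \<times> nat) set" where
  "local_states r = {(i, k). i < m r}"

definition local_map :: "nat \<Rightarrow> (nat \<times> nat \<Rightarrow> ((nat \<times> nat) \<Rightarrow>\<^sub>0 int)) \<Rightarrow> bool" where
  "local_map r \<phi> \<longleftrightarrow> (\<forall>p\<in>local_states r. Poly_Mapping.keys (\<phi> p) \<subseteq> local_states r)"

lemma local_state: "h \<in> carrier G \<Longrightarrow> r \<in> {1..n} \<Longrightarrow> (coord h r, k) \<in> local_states r"
  by (simp add: local_states_def coord_less)

lemma put_keys:
  assumes "Poly_Mapping.keys c \<subseteq> local_states r"
  shows "Poly_Mapping.keys (frag_extend (put r (h, l)) c) \<subseteq>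
    (\<lambda>(i, k). (set_coord h r i, l(r := k))) ` Poly_Mapping.keys c"
  using keys_frag_extend[of "put r (h, l)" c] by (fastforce simp: put_def)

lemma local_op_in:
  assumes "h \<in> carrier G" "l \<in> multidegrees" "r \<in> {1..n}" "local_map r \<phi>"
  shows "local_op r \<phi> (h, l) \<in> free_chains G multidegrees"
proof -
  have keys: "Poly_Mapping.keys (\<phi> (coord h r, l r)) \<subseteq> local_states r"
    using assms local_state[of h r "l r"] by (auto simp: local_map_def)
  show ?thesis
    using put_keys[OF keys, of h l] keys assms
    by (fastforce simp: free_chains_def local_op_def local_states_def multidegrees_def intro: set_coord_in)
qed

lemma set_coord_twice:
  "\<lbrakk>h \<in> carrier G; r \<in> {1..n}; i < m r\<rbrakk> \<Longrightarrow> set_coord (set_coord h r i) r j = set_coord h r j"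
  by (simp add: set_coord_def[of _ _ j] coord_set_coord)

lemma set_coord_swap:
  "\<lbrakk>h \<in> carrier G; r \<in> {1..n}; i < m r; q \<in> {1..n}; j < m q; r \<noteq> q\<rbrakk> \<Longrightarrow>
    set_coord (set_coord h r i) q j = set_coord (set_coord h q j) r i"
  by (simp add: set_coord_def[of "set_coord _ _ _"] coord_set_coord fun_upd_twist)

lemma set_coord_same: "h \<in> carrier G \<Longrightarrow> set_coord h r (coord h r) = h"
  by (simp add: set_coord_def element_coord)

lemma local_op_compose:
  assumes "h \<in> carrier G" "r \<in> {1..n}" "local_map r \<phi>" "local_map r \<psi>"
  shows "frag_extend (local_op r \<phi>) (local_op r \<psi> (h, l)) =
    local_op r (\<lambda>p. frag_extend \<phi> (\<psi> p)) (h, l)"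
proof -
  let ?c = "\<psi> (coord h r, l r)"
  have c: "Poly_Mapping.keys ?c \<subseteq> local_states r"
    using assms local_state[of h r "l r"] by (auto simp: local_map_def)
  have "frag_extend (local_op r \<phi>) (local_op r \<psi> (h, l)) =
      frag_extend (\<lambda>p. frag_extend (local_op r \<phi>) (put r (h, l) p)) ?c"
    by (simp add: local_op_def[of r \<psi>] frag_extend_frag_extend)
  also have "\<dots> = frag_extend (\<lambda>p. frag_extend (put r (h, l)) (\<phi> p)) ?c"
  proof (rule frag_extend_restrict[OF c])
    fix p assume p: "p \<in> local_states r"
    obtain i k where [simp]: "p = (i, k)" by (cases p)
    have i: "i < m r" using p by (simp add: local_states_def)
    have "Poly_Mapping.keys (\<phi> p) \<subseteq> local_states r"
      using assms p by (auto simp: local_map_def)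
    then have "frag_extend (put r (set_coord h r i, l(r := k))) (\<phi> p) =
        frag_extend (put r (h, l)) (\<phi> p)"
      by (rule frag_extend_restrict) (use assms i in \<open>auto simp: put_def set_coord_twice\<close>)
    then show "frag_extend (local_op r \<phi>) (put r (h, l) p) = frag_extend (put r (h, l)) (\<phi> p)"
      using assms i by (simp add: put_def[of r] local_op_def coord_set_coord)
  qed
  finally show ?thesis
    by (simp add: local_op_def frag_extend_frag_extend)
qed

text \<open>
  Both composites are the same double sum over the two changed coordinates, in exchanged order.
\<close>

lemma local_op_commute:
  assumes "h \<in> carrier G" "r \<in> {1..n}" "q \<in> {1..n}" "r \<noteq> q" "local_map r \<phi>" "local_map q \<psi>"
  shows "frag_extend (local_op r \<phi>) (local_op q \<psi> (h, l)) =
    frag_extend (local_op q \<psi>) (local_op r \<phi> (h, l))"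
proof -
  have nested: "frag_extend (local_op r \<phi>) (local_op q \<psi> (h, l)) =
      frag_extend (\<lambda>(j, k'). frag_extend (\<lambda>(i, k).
        frag_of (set_coord (set_coord h q j) r i, l(q := k', r := k))) (\<phi> (coord h r, l r)))
        (\<psi> (coord h q, l q))"
    if "r \<in> {1..n}" "q \<in> {1..n}" "r \<noteq> q" "local_map r \<phi>" "local_map q \<psi>" for r q \<phi> \<psi>
  proof -
    have "Poly_Mapping.keys (\<psi> (coord h q, l q)) \<subseteq> local_states q"
      using that assms(1) local_state[of h q "l q"] by (auto simp: local_map_def)
    then show ?thesis
      unfolding local_op_def[of q \<psi>] case_prod_conv frag_extend_frag_extend
      by (rule frag_extend_restrict)
        (use that assms(1) in \<open>auto simp: put_def local_op_def coord_set_coord local_states_def\<close>)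
  qed
  have in_states: "Poly_Mapping.keys (\<psi> (coord h q, l q)) \<subseteq> local_states q"
    "Poly_Mapping.keys (\<phi> (coord h r, l r)) \<subseteq> local_states r"
    using assms local_state[of h q "l q"] local_state[of h r "l r"] by (auto simp: local_map_def)
  have "frag_extend (local_op r \<phi>) (local_op q \<psi> (h, l)) =
      frag_extend (\<lambda>p'. frag_extend (\<lambda>p. frag_of (set_coord (set_coord h q (fst p')) r (fst p),
        l(q := snd p', r := snd p))) (\<phi> (coord h r, l r))) (\<psi> (coord h q, l q))"
    using nested[OF assms(2-6)] by (simp add: case_prod_unfold)
  also have "\<dots> = frag_extend (\<lambda>p'. frag_extend (\<lambda>p. frag_of (set_coord (set_coord h r (fst p)) q (fst p'),
        l(r := snd p, q := snd p'))) (\<phi> (coord h r, l r))) (\<psi> (coord h q, l q))"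
    by (intro frag_extend_restrict[OF in_states(1)] frag_extend_restrict[OF in_states(2)])
      (use assms in \<open>auto simp: local_states_def set_coord_swap fun_upd_twist\<close>)
  also have "\<dots> = frag_extend (local_op q \<psi>) (local_op r \<phi> (h, l))"
    using nested[OF assms(3,2) assms(4)[symmetric] assms(6,5)]
    by (subst frag_extend_swap) (simp add: case_prod_unfold)
  finally show ?thesis .
qed

subsection \<open>Koszul signs\<close>

text \<open>
  The Koszul sign of a map in the factor \<open>r\<close> counts the degrees in the later factors.  It is
  constant on the image of a map of definite parity in another factor \<open>q\<close>, and gets reversed by a map of odd degree
  exactly when \<open>q\<close> comes later than \<open>r\<close>; this is why signed maps of odd degree anticommute.
\<close>

definition koszul_sign :: "nat \<Rightarrow> (nat \<Rightarrow> nat) \<Rightarrow> int" where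
  "koszul_sign r l = (-1) ^ (\<Sum>j\<in>{r<..n}. l j)"

definition signed_op :: "nat \<Rightarrow> (nat \<times> nat \<Rightarrow> ((nat \<times> nat) \<Rightarrow>\<^sub>0 int)) \<Rightarrow>
    'a \<times> (nat \<Rightarrow> nat) \<Rightarrow> (('a \<times> (nat \<Rightarrow> nat)) \<Rightarrow>\<^sub>0 int)" where
  "signed_op r \<phi> = (\<lambda>(h, l). frag_cmul (koszul_sign r l) (local_op r \<phi> (h, l)))"

lemma koszul_sign_square [simp]: "koszul_sign r l * koszul_sign r l = 1"
  by (simp add: koszul_sign_def flip: power_add mult_2)

lemma koszul_sign_upd_le: "q \<le> r \<Longrightarrow> koszul_sign r (l(q := k)) = koszul_sign r l"
  by (auto simp: koszul_sign_def intro!: arg_cong[where f = "power (- 1)"] sum.cong)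

lemma koszul_sign_upd_gr:
  assumes "r < q" "q \<le> n"
  shows "koszul_sign r (l(q := k)) = (-1) ^ (l q + k) * koszul_sign r l"
proof -
  have "(\<Sum>j\<in>{r<..n}. (l(q := k)) j) = k + (\<Sum>j\<in>{r<..n} - {q}. l j)"
    using assms by (simp add: sum.remove[of _ q])
  moreover have "(\<Sum>j\<in>{r<..n}. l j) = l q + (\<Sum>j\<in>{r<..n} - {q}. l j)"
    using assms by (simp add: sum.remove[of _ q])
  ultimately show ?thesis
    by (simp add: koszul_sign_def power_add)
qed

lemma signed_op_after:
  assumes "h \<in> carrier G" "q \<in> {1..n}" "local_map q \<psi>"
    and "\<And>i k. (i, k) \<in> Poly_Mapping.keys (\<psi> (coord h q, l q)) \<Longrightarrow> koszul_sign r (l(q := k)) = e"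
  shows "frag_extend (signed_op r \<phi>) (local_op q \<psi> (h, l)) =
    frag_cmul e (frag_extend (local_op r \<phi>) (local_op q \<psi> (h, l)))"
  unfolding local_op_def[of q \<psi>] case_prod_conv frag_extend_frag_extend
    frag_extend_cmul_fun[symmetric]
  by (rule frag_extend_eq) (use assms(4) in \<open>auto simp: put_def signed_op_def\<close>)

definition parity_map :: "nat \<Rightarrow> (nat \<times> nat \<Rightarrow> ((nat \<times> nat) \<Rightarrow>\<^sub>0 int)) \<Rightarrow> bool" where
  "parity_map e \<phi> \<longleftrightarrow> (\<forall>p. \<forall>q\<in>Poly_Mapping.keys (\<phi> p). even (snd p + snd q + e))"

lemma signed_op_same:
  assumes "h \<in> carrier G" "r \<in> {1..n}" "local_map r \<phi>" "local_map r \<psi>"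
  shows "frag_extend (signed_op r \<phi>) (signed_op r \<psi> (h, l)) =
    local_op r (\<lambda>p. frag_extend \<phi> (\<psi> p)) (h, l)"
  using signed_op_after[OF assms(1,2,4), of l r "koszul_sign r l" \<phi>] local_op_compose[OF assms]
  by (simp add: koszul_sign_upd_le signed_op_def[of r \<psi>] frag_extend_cmul)

lemma signed_op_anticommute:
  assumes "h \<in> carrier G" "r \<in> {1..n}" "q \<in> {1..n}" "r \<noteq> q" "local_map r \<phi>" "local_map q \<psi>"
    and odd: "parity_map 1 \<phi>" "parity_map 1 \<psi>"
  shows "frag_extend (signed_op r \<phi>) (signed_op q \<psi> (h, l)) =
    - frag_extend (signed_op q \<psi>) (signed_op r \<phi> (h, l))"
proof -
  have less: "frag_extend (signed_op r \<phi>) (signed_op q \<psi> (h, l)) =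
      - frag_extend (signed_op q \<psi>) (signed_op r \<phi> (h, l))"
    if "r < q" "r \<in> {1..n}" "q \<in> {1..n}" "local_map r \<phi>" "local_map q \<psi>"
      "parity_map 1 \<psi>" for r q \<phi> \<psi>
  proof -
    have "frag_extend (signed_op r \<phi>) (local_op q \<psi> (h, l)) =
        frag_cmul (- koszul_sign r l) (frag_extend (local_op r \<phi>) (local_op q \<psi> (h, l)))"
    proof (rule signed_op_after[OF assms(1) that(3,5)])
      fix i k assume "(i, k) \<in> Poly_Mapping.keys (\<psi> (coord h q, l q))"
      then have "odd (l q + k)"
        using that(6) by (fastforce simp: parity_map_def)
      then show "koszul_sign r (l(q := k)) = - koszul_sign r l"
        using that by (simp add: koszul_sign_upd_gr)
    qed
    moreover have "frag_extend (signed_op q \<psi>) (local_op r \<phi> (h, l)) =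
        frag_cmul (koszul_sign q l) (frag_extend (local_op q \<psi>) (local_op r \<phi> (h, l)))"
      by (rule signed_op_after[OF assms(1) that(2,4)]) (use that in \<open>simp add: koszul_sign_upd_le\<close>)
    ultimately show ?thesis
      using local_op_commute[OF assms(1) that(2,3) _ that(4,5), of l] that(1)
      by (simp add: signed_op_def[of q \<psi>] signed_op_def[of r \<phi>] frag_extend_cmul mult.commute)
  qed
  consider "r < q" | "q < r" using assms(4) by linarith
  then show ?thesis
  proof cases
    case 1
    then show ?thesis using less[of r q \<phi> \<psi>] assms by simp
  next
    case 2
    then show ?thesis using less[of q r \<psi> \<phi>] assms by simp
  qed
qed

lemma signed_op_commute_even:
  assumes "h \<in> carrier G" "r \<in> {1..n}" "q \<in> {1..n}" "r \<noteq> q" "local_map r \<phi>" "local_map q \<psi>"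
    and even: "parity_map 0 \<psi>"
  shows "frag_extend (signed_op r \<phi>) (local_op q \<psi> (h, l)) =
    frag_extend (local_op q \<psi>) (signed_op r \<phi> (h, l))"
proof -
  have "frag_extend (signed_op r \<phi>) (local_op q \<psi> (h, l)) =
      frag_cmul (koszul_sign r l) (frag_extend (local_op r \<phi>) (local_op q \<psi> (h, l)))"
  proof (rule signed_op_after[OF assms(1,3,6)])
    fix i k assume "(i, k) \<in> Poly_Mapping.keys (\<psi> (coord h q, l q))"
    then have "even (l q + k)"
      using even by (fastforce simp: parity_map_def)
    then show "koszul_sign r (l(q := k)) = koszul_sign r l"
      using assms koszul_sign_upd_le[of q r] koszul_sign_upd_gr[of r q] by (cases "q \<le> r") auto
  qed
  then show ?thesis
    using local_op_commute[OF assms(1-6), of l] by (simp add: signed_op_def frag_extend_cmul)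
qed

subsection \<open>The periodic resolution of a cyclic group\<close>

text \<open>
  The periodic resolution of one cyclic factor, its contraction, and the projection to the
  augmentation: \<open>(i, k)\<close> is the \<open>i\<close>-th power of the generator times the basis element of degree
  \<open>k\<close>.  The boundary is the norm in even positive degrees and the generator minus one in odd
  degrees.
\<close>

definition cyc_d :: "nat \<Rightarrow> nat \<times> nat \<Rightarrow> ((nat \<times> nat) \<Rightarrow>\<^sub>0 int)" where
  "cyc_d r = (\<lambda>(i, k). if k = 0 then 0
     else if odd k then frag_of (Suc i mod m r, k - 1) - frag_of (i, k - 1)
     else (\<Sum>j<m r. frag_of (j, k - 1)))"

definition cyc_s :: "nat \<Rightarrow> nat \<times> nat \<Rightarrow> ((nat \<times> nat) \<Rightarrow>\<^sub>0 int)" where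
  "cyc_s r = (\<lambda>(i, k). if even k then (\<Sum>j<i. frag_of (j, Suc k))
     else if Suc i = m r then frag_of (0, Suc k) else 0)"

definition cyc_p :: "nat \<times> nat \<Rightarrow> ((nat \<times> nat) \<Rightarrow>\<^sub>0 int)" where
  "cyc_p = (\<lambda>(i, k). if k = 0 then frag_of (0, 0) else 0)"

lemma cyc_d_keys: "Poly_Mapping.keys (cyc_d r (i, k)) \<subseteq> {(j, k'). (0 < m r \<longrightarrow> i < m r \<longrightarrow> j < m r) \<and> Suc k' = k}"
proof -
  consider "k = 0" | "odd k" | "even k" "0 < k" by auto
  then show ?thesis
  proof cases
    case 2
    then show ?thesis
      by (simp add: cyc_d_def odd_pos) (rule order_trans[OF keys_diff], auto)
  next
    case 3
    have "Poly_Mapping.keys (\<Sum>j<m r. frag_of (j, k - 1)) \<subseteq>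
        {(j, k'). (0 < m r \<longrightarrow> i < m r \<longrightarrow> j < m r) \<and> Suc k' = k}"
      by (rule keys_sum_subset) (use 3 in auto)
    then show ?thesis using 3 by (simp add: cyc_d_def)
  qed (simp add: cyc_d_def)
qed

lemma cyc_s_keys: "Poly_Mapping.keys (cyc_s r (i, k)) \<subseteq> {(j, k'). (i < m r \<longrightarrow> j < m r) \<and> k' = Suc k}"
proof (cases "even k")
  case True
  have "Poly_Mapping.keys (\<Sum>j<i. frag_of (j, Suc k)) \<subseteq> {(j, k'). (i < m r \<longrightarrow> j < m r) \<and> k' = Suc k}"
    by (rule keys_sum_subset) auto
  then show ?thesis using True by (simp add: cyc_s_def)
next
  case False
  then show ?thesis by (auto simp: cyc_s_def)
qed

lemma cyc_p_keys: "Poly_Mapping.keys (cyc_p (i, k)) \<subseteq> {(j, k'). j = 0 \<and> k' = k}"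
  by (auto simp: cyc_p_def)

lemma local_map_cyc: "local_map r (cyc_d r)" "local_map r (cyc_s r)" "local_map r cyc_p"
proof -
  have "Poly_Mapping.keys (cyc_d r (i, k)) \<subseteq> local_states r" if "i < m r" for i k
    using that cyc_d_keys[of r i k] by (auto simp: local_states_def)
  then show "local_map r (cyc_d r)" by (simp add: local_map_def local_states_def)
  have "Poly_Mapping.keys (cyc_s r (i, k)) \<subseteq> local_states r" if "i < m r" for i k
    using that cyc_s_keys[of r i k] by (auto simp: local_states_def)
  then show "local_map r (cyc_s r)" by (simp add: local_map_def local_states_def)
  have "Poly_Mapping.keys (cyc_p (i, k)) \<subseteq> local_states r" if "i < m r" for i k
    using that cyc_p_keys[of i k] by (auto simp: local_states_def)
  then show "local_map r cyc_p" by (simp add: local_map_def local_states_def)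
qed

lemma parity_map_cyc: "parity_map 1 (cyc_d r)" "parity_map 1 (cyc_s r)" "parity_map 0 cyc_p"
proof -
  have "odd (k + k')" if "(j, k') \<in> Poly_Mapping.keys (cyc_d r (i, k))" for i j k k'
    using that cyc_d_keys[of r i k] by auto
  then show "parity_map 1 (cyc_d r)" by (auto simp: parity_map_def)
  have "odd (k + k')" if "(j, k') \<in> Poly_Mapping.keys (cyc_s r (i, k))" for i j k k'
    using that cyc_s_keys[of r i k] by auto
  then show "parity_map 1 (cyc_s r)" by (auto simp: parity_map_def)
  have "even (k + k')" if "(j, k') \<in> Poly_Mapping.keys (cyc_p (i, k))" for i j k k'
    using that cyc_p_keys[of i k] by auto
  then show "parity_map 0 cyc_p" by (auto simp: parity_map_def)
qed

text \<open>
  The norm is invariant under translation.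
\<close>

lemma sum_mod_shift: "(\<Sum>j<M. F ((a + j) mod M)) = (\<Sum>j<(M::nat). F j :: 'v :: ab_group_add)"
proof (induction a arbitrary: F)
  case (Suc a)
  have "(\<Sum>j<M. F ((Suc a + j) mod M)) = (\<Sum>j<M. F (Suc ((a + j) mod M) mod M))"
    by (simp add: mod_Suc_eq)
  also have "\<dots> = (\<Sum>j<M. F (Suc j mod M))"
    by (rule Suc.IH)
  also have "\<dots> = (\<Sum>j<M. F j)"
  proof (cases M)
    case (Suc M')
    have "(\<Sum>j<M. F (Suc j mod M)) = (\<Sum>j<M'. F (Suc j mod M)) + F 0"
      by (simp add: Suc)
    also have "(\<Sum>j<M'. F (Suc j mod M)) = (\<Sum>j<M'. F (Suc j))"
      by (rule sum.cong) (auto simp: Suc)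
    finally show ?thesis
      unfolding Suc by (subst sum.lessThan_Suc_shift) simp
  qed simp
  finally show ?case .
qed simp

lemma cyc_d_d: "frag_extend (cyc_d r) (cyc_d r (i, k)) = 0"
proof -
  consider "k = 0" | "odd k" | k' where "k = Suc (Suc k')" "even k'"
    by (metis evenE mult_2 nat.exhaust odd_Suc_minus_one even_Suc)
  then show ?thesis
  proof cases
    case 2
    then show ?thesis
      by (cases "k - 1 = 0") (auto simp: cyc_d_def frag_extend_diff)
  next
    case 3
    have "(\<Sum>j<m r. frag_of (Suc j mod m r, k')) = (\<Sum>j<m r. frag_of (j, k'))"
      using sum_mod_shift[of "\<lambda>j. frag_of (j, k')" 1 "m r"] by simp
    then show ?thesis
      using 3 by (simp add: cyc_d_def frag_extend_sum' sum_subtractf)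
  qed (simp add: cyc_d_def)
qed

lemma cyc_p_d: "frag_extend cyc_p (cyc_d r (i, k)) = 0"
  by (auto simp: cyc_d_def cyc_p_def frag_extend_diff frag_extend_sum')

lemma cyc_d_p: "frag_extend (cyc_d r) (cyc_p p) = 0"
  by (auto simp: cyc_d_def cyc_p_def split: prod.splits)

text \<open>
  In even degrees the boundary of the contraction telescopes to the difference with the zeroth power,
  which the norm supplies through its last summand; in odd degrees two partial sums of the norm cancel
  except for one term.
\<close>

lemma cyc_contraction:
  assumes "i < m r"
  shows "frag_extend (cyc_d r) (cyc_s r (i, k)) + frag_extend (cyc_s r) (cyc_d r (i, k)) =
    frag_of (i, k) - cyc_p (i, k)"
proof (cases "even k")
  case True
  have "frag_extend (cyc_d r) (cyc_s r (i, k)) =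
      (\<Sum>j<i. frag_of (Suc j mod m r, k) - frag_of (j, k))"
    using True by (simp add: cyc_s_def cyc_d_def frag_extend_sum')
  also have "\<dots> = (\<Sum>j<i. frag_of (Suc j, k) - frag_of (j, k))"
    using assms by (intro sum.cong) auto
  also have "\<dots> = frag_of (i, k) - frag_of (0, k)"
    by (rule sum_lessThan_telescope)
  finally have ds: "frag_extend (cyc_d r) (cyc_s r (i, k)) = frag_of (i, k) - frag_of (0, k)" .
  show ?thesis
  proof (cases "k = 0")
    case False
    then have "odd (k - 1)" using True by simp
    have "frag_extend (cyc_s r) (cyc_d r (i, k)) = (\<Sum>j<m r. cyc_s r (j, k - 1))"
      using True False by (simp add: cyc_d_def frag_extend_sum')
    also have "\<dots> = (\<Sum>j<m r. if j = m r - 1 then frag_of (0, k) else 0)"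
      using True False \<open>odd (k - 1)\<close> by (intro sum.cong) (auto simp: cyc_s_def)
    also have "\<dots> = frag_of (0, k)"
      using assms by simp
    finally show ?thesis using ds False by (simp add: cyc_p_def)
  next
    case True
    then show ?thesis using ds by (simp add: cyc_p_def cyc_d_def)
  qed
next
  case False
  then have k: "k > 0" "even (k - 1)" "Suc (k - 1) = k" by (auto elim: oddE)
  have sd: "frag_extend (cyc_s r) (cyc_d r (i, k)) =
      (\<Sum>j<Suc i mod m r. frag_of (j, k)) - (\<Sum>j<i. frag_of (j, k))"
    using False k by (auto simp: cyc_s_def cyc_d_def frag_extend_diff)
  show ?thesis
  proof (cases "Suc i = m r")
    case True
    then have "frag_extend (cyc_d r) (cyc_s r (i, k)) = (\<Sum>j<Suc i. frag_of (j, k))"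
      using False by (simp add: cyc_s_def cyc_d_def)
    then have "frag_extend (cyc_d r) (cyc_s r (i, k)) = (\<Sum>j<i. frag_of (j, k)) + frag_of (i, k)"
      by (simp only: sum.lessThan_Suc)
    then show ?thesis
      using sd True k by (cases "k = 0") (auto simp: cyc_p_def)
  next
    case False
    then show ?thesis
      using sd assms \<open>odd k\<close> odd_pos[OF \<open>odd k\<close>] by (auto simp: cyc_s_def cyc_p_def)
  qed
qed

subsection \<open>The contraction of the tensor product\<close>

definition op_d where "op_d r = frag_extend (signed_op r (cyc_d r))"
definition op_s where "op_s r = frag_extend (signed_op r (cyc_s r))"
definition op_p where "op_p r = frag_extend (local_op r cyc_p)"

abbreviation "small_chains \<equiv> free_chains G multidegrees"

lemma op_linear [simp]:
  "op_d r 0 = 0" "op_s r 0 = 0" "op_p r 0 = 0"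
  "op_d r (- a) = - op_d r a" "op_s r (- a) = - op_s r a" "op_p r (- a) = - op_p r a"
  "op_d r (a - b) = op_d r a - op_d r b" "op_s r (a - b) = op_s r a - op_s r b"
  "op_p r (a - b) = op_p r a - op_p r b"
  "op_d r (a + b) = op_d r a + op_d r b" "op_s r (a + b) = op_s r a + op_s r b"
  "op_p r (a + b) = op_p r a + op_p r b"
  by (simp_all add: op_d_def op_s_def op_p_def frag_extend_linear)

lemma op_sum:
  "op_d r (sum f A) = (\<Sum>i\<in>A. op_d r (f i))" "op_s r (sum f A) = (\<Sum>i\<in>A. op_s r (f i))"
  by (simp_all add: op_d_def op_s_def frag_extend_sum')

lemma op_in:
  assumes "c \<in> small_chains" "r \<in> {1..n}"
  shows "op_d r c \<in> small_chains" "op_s r c \<in> small_chains" "op_p r c \<in> small_chains"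
  unfolding op_d_def op_s_def op_p_def
  by (rule frag_extend_in_chains[OF assms(1)];
    use assms in \<open>auto simp: signed_op_def local_map_cyc intro!: chains_cmul local_op_in\<close>)+

lemma op_contraction:
  assumes "c \<in> small_chains" "r \<in> {1..n}"
  shows "op_d r (op_s r c) + op_s r (op_d r c) = c - op_p r c"
  using assms(1)
proof (induction rule: chains_induct)
  case (of h l)
  have "op_d r (op_s r (frag_of (h, l))) + op_s r (op_d r (frag_of (h, l))) =
      local_op r (\<lambda>p. frag_extend (cyc_d r) (cyc_s r p)) (h, l) +
      local_op r (\<lambda>p. frag_extend (cyc_s r) (cyc_d r p)) (h, l)"
    using of assms(2) by (simp add: op_d_def op_s_def signed_op_same local_map_cyc)
  also have "\<dots> = frag_extend (put r (h, l)) (frag_of (coord h r, l r) - cyc_p (coord h r, l r))"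
    using of assms(2) by (simp add: local_op_def cyc_contraction[OF coord_less, symmetric]
      flip: frag_extend_add)
  also have "\<dots> = frag_of (h, l) - op_p r (frag_of (h, l))"
    using of by (simp add: frag_extend_diff put_def set_coord_same op_p_def local_op_def)
  finally show ?case .
qed (auto simp: algebra_simps)

lemma op_d_p:
  assumes "c \<in> small_chains" "r \<in> {1..n}"
  shows "op_d r (op_p r c) = 0" "op_p r (op_d r c) = 0"
proof -
  have dp: "frag_extend (signed_op r (cyc_d r)) (local_op r cyc_p (h, l)) = 0"
    if "h \<in> carrier G" for h l
    using that assms(2) signed_op_after[OF that assms(2) local_map_cyc(3), of l r "koszul_sign r l" "cyc_d r"]
      local_op_compose[OF that assms(2) local_map_cyc(1,3), of l]
    by (simp add: koszul_sign_upd_le cyc_d_p) (simp add: local_op_def)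
  show "op_d r (op_p r c) = 0"
    using assms(1)
    by (induction rule: chains_induct) (auto simp: op_d_def op_p_def frag_extend_diff dp)
  have pd: "frag_extend (local_op r cyc_p) (signed_op r (cyc_d r) (h, l)) = 0"
    if "h \<in> carrier G" for h l
    using that assms(2) local_op_compose[OF that assms(2) local_map_cyc(3,1), of l]
    by (simp add: signed_op_def frag_extend_cmul)
      (simp add: local_op_def[of r "\<lambda>p. frag_extend cyc_p (cyc_d r p)"] cyc_p_d)
  show "op_p r (op_d r c) = 0"
    using assms(1)
    by (induction rule: chains_induct) (auto simp: op_d_def op_p_def frag_extend_diff pd)
qed

lemma op_d_d:
  assumes "c \<in> small_chains" "r \<in> {1..n}"
  shows "op_d r (op_d r c) = 0"
  using assms(1)
  by (induction rule: chains_induct)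
    (use assms(2) in \<open>auto simp: op_d_def frag_extend_diff signed_op_same local_map_cyc local_op_def cyc_d_d\<close>)

lemma op_anticommute:
  assumes "c \<in> small_chains" "r \<in> {1..n}" "q \<in> {1..n}" "r \<noteq> q"
  shows "op_d r (op_d q c) = - op_d q (op_d r c)" "op_d r (op_s q c) = - op_s q (op_d r c)"
    "op_d r (op_p q c) = op_p q (op_d r c)"
proof -
  note loc = local_map_cyc parity_map_cyc parity_map_cyc[unfolded One_nat_def]
  show "op_d r (op_d q c) = - op_d q (op_d r c)"
    using assms(1)
    by (induction rule: chains_induct)
      (use assms(2-) in \<open>auto simp: op_d_def frag_extend_diff loc
        intro!: signed_op_anticommute\<close>)
  show "op_d r (op_s q c) = - op_s q (op_d r c)"
    using assms(1)
    by (induction rule: chains_induct)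
      (use assms(2-) in \<open>auto simp: op_d_def op_s_def frag_extend_diff loc
        intro!: signed_op_anticommute\<close>)
  show "op_d r (op_p q c) = op_p q (op_d r c)"
    using assms(1)
    by (induction rule: chains_induct)
      (use assms(2-) in \<open>auto simp: op_d_def op_p_def frag_extend_diff loc
        intro!: signed_op_commute_even\<close>)
qed

text \<open>
  The projection of the first \<open>r\<close> factors to their augmentations.
\<close>

primrec project :: "nat \<Rightarrow> (('a \<times> (nat \<Rightarrow> nat)) \<Rightarrow>\<^sub>0 int) \<Rightarrow> (('a \<times> (nat \<Rightarrow> nat)) \<Rightarrow>\<^sub>0 int)" where
  "project 0 c = c"
| "project (Suc r) c = op_p (Suc r) (project r c)"

lemma project_linear [simp]:
  "project r 0 = 0" "project r (a - b) = project r a - project r b"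
  by (induction r) auto

lemma project_in: "c \<in> small_chains \<Longrightarrow> r \<le> n \<Longrightarrow> project r c \<in> small_chains"
  by (induction r) (auto intro: op_in)

lemma op_d_project:
  assumes "c \<in> small_chains" "q \<in> {1..n}"
  shows "r < q \<Longrightarrow> op_d q (project r c) = project r (op_d q c)"
    and "q \<le> r \<Longrightarrow> r \<le> n \<Longrightarrow> op_d q (project r c) = 0"
    and "q \<le> r \<Longrightarrow> r \<le> n \<Longrightarrow> project r (op_d q c) = 0"
proof -
  show less: "op_d q (project r c) = project r (op_d q c)" if "r < q" for r
    using that
  proof (induction r)
    case (Suc r)
    then show ?case
      using op_anticommute(3)[OF project_in[OF assms(1)], of r q "Suc r"] assms(2) by simp
  qed simp
  show "op_d q (project r c) = 0" if "q \<le> r" "r \<le> n"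
    using that
  proof (induction r rule: dec_induct)
    case base
    obtain q' where q': "q = Suc q'" using assms(2) by (cases q) auto
    then show ?case using op_d_p(1)[OF project_in[OF assms(1)], of q' q] assms(2) by simp
  next
    case (step r)
    then show ?case
      using op_anticommute(3)[OF project_in[OF assms(1)], of r q "Suc r"] assms(2) by simp
  qed
  show "project r (op_d q c) = 0" if "q \<le> r" "r \<le> n"
    using that
  proof (induction r rule: dec_induct)
    case base
    obtain q' where q': "q = Suc q'" using assms(2) by (cases q) auto
    then show ?case
      using op_d_p(2)[OF project_in[OF assms(1)], of q' q] assms(2) less[of q'] by simp
  qed simp
qed

definition total_d where "total_d c = (\<Sum>r\<in>{1..n}. op_d r c)"
definition total_s where "total_s c = (\<Sum>r\<in>{1..n}. op_s r (project (r - 1) c))"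

lemma total_linear:
  "total_d 0 = 0" "total_d (a - b) = total_d a - total_d b"
  "total_s 0 = 0" "total_s (a - b) = total_s a - total_s b"
  by (simp_all add: total_d_def total_s_def sum_subtractf)

text \<open>
  The contraction of a tensor product: contract the first factor, then the second after projecting
  the first to its augmentation, and so on.  In the anticommutator with the boundary only the
  equal factors survive, and these terms telescope.
\<close>

lemma total_contraction:
  assumes "c \<in> small_chains"
  shows "total_d (total_s c) + total_s (total_d c) = c - project n c"
proof -
  have "total_d (total_s c) + total_s (total_d c) =
      (\<Sum>r\<in>{1..n}. \<Sum>q\<in>{1..n}. op_d q (op_s r (project (r - 1) c)) +
        op_s r (project (r - 1) (op_d q c)))"
  proof -
    have "project r (sum f A) = (\<Sum>i\<in>A. project r (f i))" for r f and A :: "nat set"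
      by (induction r) (auto simp: op_p_def frag_extend_sum')
    then show ?thesis
      unfolding total_d_def total_s_def op_sum sum.distrib
      by (subst sum.swap) (simp add: op_sum)
  qed
  also have "\<dots> = (\<Sum>r\<in>{1..n}. project (r - 1) c - project r c)"
  proof (rule sum.cong)
    fix r assume r: "r \<in> {1..n}"
    have pr: "project (r - 1) c \<in> small_chains" using r by (intro project_in assms) auto
    have "op_d q (op_s r (project (r - 1) c)) + op_s r (project (r - 1) (op_d q c)) =
        (if q = r then project (r - 1) c - project r c else 0)" if q: "q \<in> {1..n}" for q
    proof -
      consider "q < r" | "q = r" | "r < q" by linarith
      then show ?thesis
      proof cases
        case 1
        then show ?thesis
          using op_anticommute(2)[OF pr q r] op_d_project(2,3)[OF assms q, of "r - 1"] r by auto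
      next
        case 2
        have "project r c = op_p r (project (r - 1) c)"
          using r by (cases r) auto
        moreover have "project (r - 1) (op_d r c) = op_d r (project (r - 1) c)"
          using op_d_project(1)[OF assms q, of "r - 1"] r 2 by auto
        ultimately show ?thesis
          using op_contraction[OF pr r] 2 by simp
      next
        case 3
        then have "project (r - 1) (op_d q c) = op_d q (project (r - 1) c)"
          using op_d_project(1)[OF assms q, of "r - 1"] by auto
        then show ?thesis
          using op_anticommute(2)[OF pr q r] 3 by auto
      qed
    qed
    then have "(\<Sum>q\<in>{1..n}. op_d q (op_s r (project (r - 1) c)) +
        op_s r (project (r - 1) (op_d q c))) =
        (\<Sum>q\<in>{1..n}. if q = r then project (r - 1) c - project r c else 0)"
      by (rule sum.cong[OF refl])
    then show "(\<Sum>q\<in>{1..n}. op_d q (op_s r (project (r - 1) c)) +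
        op_s r (project (r - 1) (op_d q c))) = project (r - 1) c - project r c"
      using r by simp
  qed simp
  also have "\<dots> = c - project n c"
    by (induction n) auto
  finally show ?thesis .
qed

lemma total_d_d:
  assumes "c \<in> small_chains"
  shows "total_d (total_d c) = 0"
proof -
  have "total_d (total_d c) = (\<Sum>r\<in>{1..n}. \<Sum>q\<in>{1..n}. op_d r (op_d q c))"
    by (simp add: total_d_def op_sum)
  also have "\<dots> = (\<Sum>r\<in>{1..n}. \<Sum>q\<in>{1..n}. - op_d q (op_d r c))"
  proof (intro sum.cong refl)
    fix r q assume "r \<in> {1..n}" "q \<in> {1..n}"
    then show "op_d r (op_d q c) = - op_d q (op_d r c)"
      using op_anticommute(1)[OF assms, of r q] op_d_d[OF assms, of r] by (cases "r = q") auto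
  qed
  also have "\<dots> = - (\<Sum>q\<in>{1..n}. \<Sum>r\<in>{1..n}. op_d q (op_d r c))"
    by (subst sum.swap) (simp add: sum_negf)
  also have "(\<Sum>q\<in>{1..n}. \<Sum>r\<in>{1..n}. op_d q (op_d r c)) = total_d (total_d c)"
    by (simp add: total_d_def op_sum)
  finally have "total_d (total_d c) = - total_d (total_d c)" .
  then have "frag_cmul 2 (total_d (total_d c)) = 0"
    by (metis add.right_inverse frag_cmul_distrib frag_cmul_one one_add_one)
  then show ?thesis by simp
qed

subsection \<open>Equivariance and grading\<close>

definition small_d :: "(nat \<Rightarrow> nat) \<Rightarrow> (('a \<times> (nat \<Rightarrow> nat)) \<Rightarrow>\<^sub>0 int)" where
  "small_d l = total_d (frag_of (\<one>, l))"

definition small_s :: "'a \<times> (nat \<Rightarrow> nat) \<Rightarrow> (('a \<times> (nat \<Rightarrow> nat)) \<Rightarrow>\<^sub>0 int)" where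
  "small_s z = total_s (frag_of z)"

lemma small_basis_subset: "small_basis k \<subseteq> multidegrees"
  by (auto simp: small_basis_def)

lemma chains_mono: "S \<subseteq> S' \<Longrightarrow> free_chains G S \<subseteq> free_chains G S'"
  by (auto simp: free_chains_def)

lemma frag_extend_small_s: "c \<in> small_chains \<Longrightarrow> frag_extend small_s c = total_s c"
  by (induction rule: chains_induct)
    (auto simp: frag_extend_diff total_linear small_s_def)

definition shift_exponent :: "nat \<Rightarrow> nat \<Rightarrow> nat \<times> nat \<Rightarrow> ((nat \<times> nat) \<Rightarrow>\<^sub>0 int)" where
  "shift_exponent r a = (\<lambda>(i, k). frag_of ((a + i) mod m r, k))"

lemma shift_cyc_d:
  assumes "a < m r"
  shows "frag_extend (shift_exponent r a) (cyc_d r (0, k)) = cyc_d r (a, k)"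
proof -
  have "(\<Sum>j<m r. frag_of ((a + j) mod m r, k - 1)) = (\<Sum>j<m r. frag_of (j, k - 1))"
    by (rule sum_mod_shift)
  then show ?thesis
    using assms by (auto simp: cyc_d_def shift_exponent_def frag_extend_diff frag_extend_sum'
      mod_simps)
qed

text \<open>
  Translation by a group element permutes the summands of the norm and commutes with the generator, so
  the boundary, defined coordinatewise, is equivariant.
\<close>

lemma act_signed_op_d:
  assumes "h \<in> carrier G" "r \<in> {1..n}"
  shows "act G h (signed_op r (cyc_d r) (\<one>, l)) = signed_op r (cyc_d r) (h, l)"
proof -
  let ?c = "cyc_d r (0, l r)"
  have c: "Poly_Mapping.keys ?c \<subseteq> local_states r"
    using local_map_cyc(1)[of r] m_pos[OF assms(2)]
    by (auto simp: local_map_def local_states_def)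
  have "act G h (local_op r (cyc_d r) (\<one>, l)) = frag_extend (\<lambda>p. act G h (put r (\<one>, l) p)) ?c"
    by (simp add: local_op_def coord_one act_def frag_extend_frag_extend)
  also have "\<dots> = frag_extend (\<lambda>p. frag_extend (put r (h, l)) (shift_exponent r (coord h r) p)) ?c"
    by (rule frag_extend_restrict[OF c])
      (use assms in \<open>auto simp: put_def shift_exponent_def local_states_def mult_set_coord\<close>)
  also have "\<dots> = local_op r (cyc_d r) (h, l)"
    using shift_cyc_d[OF coord_less[OF assms]]
    by (simp add: local_op_def flip: frag_extend_frag_extend)
  finally show ?thesis
    by (simp add: signed_op_def act_linear)
qed

lemma small_d_eq: "small_d l = (\<Sum>r\<in>{1..n}. signed_op r (cyc_d r) (\<one>, l))"
  by (simp add: small_d_def total_d_def op_d_def)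

lemma module_ext_small_d: "c \<in> small_chains \<Longrightarrow> module_ext G small_d c = total_d c"
proof (induction rule: chains_induct)
  case (of h l)
  then show ?case
    by (simp add: small_d_eq act_sum act_signed_op_d total_d_def op_d_def)
qed (auto simp: module_ext_linear total_linear)

lemma local_op_degree:
  assumes "h \<in> carrier G" "l \<in> small_basis k" "r \<in> {1..n}" "local_map r \<phi>"
    and "\<And>i k'. (i, k') \<in> Poly_Mapping.keys (\<phi> (coord h r, l r)) \<Longrightarrow> k' + k = l r + K"
  shows "local_op r \<phi> (h, l) \<in> free_chains G (small_basis K)"
proof -
  have keys: "Poly_Mapping.keys (\<phi> (coord h r, l r)) \<subseteq> local_states r"
    using assms local_state[of h r "l r"] by (auto simp: local_map_def)
  have "(set_coord h r i, l(r := k')) \<in> carrier G \<times> small_basis K"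
    if ik: "(i, k') \<in> Poly_Mapping.keys (\<phi> (coord h r, l r))" for i k'
  proof -
    have "(\<Sum>j\<in>{1..n}. (l(r := k')) j) = k' + (\<Sum>j\<in>{1..n} - {r}. l j)"
      using assms(3) by (simp add: sum.remove[of _ r])
    moreover have "k = l r + (\<Sum>j\<in>{1..n} - {r}. l j)"
      using assms(2,3) by (auto simp: small_basis_def sum.remove[of _ r])
    ultimately have "(\<Sum>j\<in>{1..n}. (l(r := k')) j) = K"
      using assms(5)[OF ik] by linarith
    moreover have "i < m r" using ik keys by (auto simp: local_states_def)
    ultimately show ?thesis
      using assms by (auto simp: small_basis_def multidegrees_def intro!: set_coord_in)
  qed
  then show ?thesis
    using put_keys[OF keys, of h l] by (fastforce simp: free_chains_def local_op_def)
qed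

lemma op_degree:
  assumes "r \<in> {1..n}"
  shows "c \<in> free_chains G (small_basis (Suc k)) \<Longrightarrow> op_d r c \<in> free_chains G (small_basis k)"
    and "c \<in> free_chains G (small_basis k) \<Longrightarrow> op_s r c \<in> free_chains G (small_basis (Suc k))"
    and "c \<in> free_chains G (small_basis k) \<Longrightarrow> op_p r c \<in> free_chains G (small_basis k)"
proof -
  have "signed_op r (cyc_d r) (h, l) \<in> free_chains G (small_basis k)"
    if "h \<in> carrier G" "l \<in> small_basis (Suc k)" for h l
    unfolding signed_op_def prod.case using that assms
    by (intro chains_cmul local_op_degree) (use cyc_d_keys[of r "coord h r" "l r"] in \<open>auto simp: local_map_cyc\<close>)
  then show "c \<in> free_chains G (small_basis (Suc k)) \<Longrightarrow> op_d r c \<in> free_chains G (small_basis k)"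
    unfolding op_d_def by (rule frag_extend_in_chains[rotated])
  have "signed_op r (cyc_s r) (h, l) \<in> free_chains G (small_basis (Suc k))"
    if "h \<in> carrier G" "l \<in> small_basis k" for h l
    unfolding signed_op_def prod.case using that assms
    by (intro chains_cmul local_op_degree) (use cyc_s_keys[of r "coord h r" "l r"] in \<open>auto simp: local_map_cyc\<close>)
  then show "c \<in> free_chains G (small_basis k) \<Longrightarrow> op_s r c \<in> free_chains G (small_basis (Suc k))"
    unfolding op_s_def by (rule frag_extend_in_chains[rotated])
  have "local_op r cyc_p (h, l) \<in> free_chains G (small_basis k)"
    if "h \<in> carrier G" "l \<in> small_basis k" for h l
    using that assms
    by (intro local_op_degree) (use cyc_p_keys[of "coord h r" "l r"] in \<open>auto simp: local_map_cyc\<close>)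
  then show "c \<in> free_chains G (small_basis k) \<Longrightarrow> op_p r c \<in> free_chains G (small_basis k)"
    unfolding op_p_def by (rule frag_extend_in_chains[rotated])
qed

lemma project_degree:
  "c \<in> free_chains G (small_basis k) \<Longrightarrow> r \<le> n \<Longrightarrow> project r c \<in> free_chains G (small_basis k)"
  by (induction r) (auto intro: op_degree)

lemma project_of:
  assumes "h \<in> carrier G" "r \<le> n"
  shows "project r (frag_of (h, l)) =
    (if \<forall>j\<in>{1..r}. l j = 0 then frag_of (element (\<lambda>j. if j \<in> {1..r} then 0 else coord h j), l) else 0)"
  using assms(2)
proof (induction r)
  case 0
  then show ?case using assms by (simp add: element_coord)
next
  case (Suc r)
  let ?x = "\<lambda>j. if j \<in> {1..r} then 0 else coord h j"
  have x: "?x \<in> exponent_vectors n m"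
    using coord_in[OF assms(1)] m_pos by (auto simp: exponent_vectors_def)
  have upd: "?x(Suc r := 0) = (\<lambda>j. if j \<in> {1..Suc r} then 0 else coord h j)"
    by auto
  have "l(Suc r := 0) = l" if "l (Suc r) = 0"
    using that by auto
  then show ?case
    using Suc upd coord_element[OF x]
    by (auto simp: op_p_def local_op_def cyc_p_def put_def set_coord_def atLeastAtMostSuc_conv)
qed

lemma collapse_op_d:
  assumes "l r \<le> 1"
  shows "collapse G (op_d r (frag_of (\<one>, l))) = 0"
proof -
  have "l r = 0 \<or> l r = Suc 0" using assms by linarith
  then show ?thesis
    by (auto simp: op_d_def signed_op_def local_op_def cyc_d_def put_def frag_extend_diff
      collapse_def frag_extend_cmul)
qed

lemma small_resolution: "contracted_resolution G small_basis small_d small_s"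
proof
  note sub = chains_mono[OF small_basis_subset, THEN subsetD]
  fix l k h
  show d_in: "l \<in> small_basis (Suc k) \<Longrightarrow> small_d l \<in> free_chains G (small_basis k)"
    unfolding small_d_def total_d_def by (rule chains_sum) (auto intro!: op_degree)
  show s_in: "small_s (h, l) \<in> free_chains G (small_basis (Suc k))"
    if "h \<in> carrier G" "l \<in> small_basis k" for k
    unfolding small_s_def total_s_def using that by (intro chains_sum op_degree project_degree) auto
  have bd_s: "module_ext G small_d (small_s (h, l)) + frag_extend small_s (act G h (small_d l)) =
      frag_of (h, l) - project n (frag_of (h, l))"
    if h: "h \<in> carrier G" and l: "l \<in> small_basis k" for k
  proof -
    have hl: "frag_of (h, l) \<in> small_chains" using h l by (auto simp: small_basis_def)
    have "act G h (small_d l) = total_d (frag_of (h, l))"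
      using module_ext_small_d[OF hl] by simp
    moreover have "total_d (frag_of (h, l)) \<in> small_chains"
      unfolding total_d_def using hl by (intro chains_sum op_in)
    ultimately show ?thesis
      using total_contraction[OF hl] module_ext_small_d[OF sub[OF s_in[OF h l]]]
      by (simp add: frag_extend_small_s) (simp add: small_s_def)
  qed
  show "module_ext G small_d (small_s (h, l)) = frag_of (h, l) - frag_of (\<one>, l)"
    if h: "h \<in> carrier G" and l: "l \<in> small_basis 0"
  proof -
    have z: "l j = 0" for j
      using l by (cases "j \<in> {1..n}") (auto simp: small_basis_def multidegrees_def)
    have "small_d l = 0"
      by (simp add: small_d_eq signed_op_def local_op_def cyc_d_def z)
    moreover have "(\<lambda>j. if j \<in> {1..n} then 0 else coord h j) = coord \<one>"
      using coord_outside[OF h] by (auto simp: coord_one)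
    then have "project n (frag_of (h, l)) = frag_of (\<one>, l)"
      using h by (simp add: project_of z element_coord)
    ultimately show ?thesis using bd_s[OF h l] by simp
  qed
  show "module_ext G small_d (small_s (h, l)) + frag_extend small_s (act G h (small_d l)) =
      frag_of (h, l)"
    if h: "h \<in> carrier G" and l: "l \<in> small_basis (Suc k)"
  proof -
    have "\<not> (\<forall>j\<in>{1..n}. l j = 0)"
    proof
      assume "\<forall>j\<in>{1..n}. l j = 0"
      then have "(\<Sum>j\<in>{1..n}. l j) = 0" by simp
      then show False using l by (simp add: small_basis_def)
    qed
    then show ?thesis using bd_s[OF h l] h by (simp add: project_of)
  qed
  show "collapse G (small_d l) = 0" if "l \<in> small_basis 1"
  proof -
    have "l r \<le> 1" if "r \<in> {1..n}" for r
      using that \<open>l \<in> small_basis 1\<close> member_le_sum[of r "{1..n}" l] by (auto simp: small_basis_def)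
    then have "(\<Sum>r\<in>{1..n}. collapse G (op_d r (frag_of (\<one>, l)))) = 0"
      by (intro sum.neutral ballI collapse_op_d) auto
    then show ?thesis
      by (simp add: small_d_def total_d_def collapse_def frag_extend_sum')
  qed
  show "module_ext G small_d (small_d l) = 0" if l: "l \<in> small_basis (Suc (Suc k))"
  proof -
    have c: "frag_of (\<one>, l) \<in> small_chains" using l by (auto simp: small_basis_def)
    have "small_d l \<in> small_chains"
      unfolding small_d_def total_d_def using c by (intro chains_sum op_in)
    then show ?thesis
      using total_d_d[OF c] by (simp add: module_ext_small_d) (simp add: small_d_def)
  qed
qed

end

section \<open>Restricting cocycles to the small resolution\<close>

definition coinvariants :: "(('g \<times> 'c) \<Rightarrow>\<^sub>0 int) \<Rightarrow> ('c \<Rightarrow>\<^sub>0 int)" where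
  "coinvariants = frag_extend (\<lambda>(h, b). frag_of b)"

lemma coinvariants_simps [simp]:
  "coinvariants 0 = 0" "coinvariants (frag_of (h, x)) = frag_of x"
  "coinvariants (a + b) = coinvariants a + coinvariants b"
  "coinvariants (a - b) = coinvariants a - coinvariants b"
  "coinvariants (- a) = - coinvariants a"
  "coinvariants (frag_cmul z a) = frag_cmul z (coinvariants a)"
  by (simp_all add: coinvariants_def frag_extend_linear)

lemma coinvariants_sum: "coinvariants (sum f A) = (\<Sum>i\<in>A. coinvariants (f i))"
  by (induction A rule: infinite_finite_induct) auto

lemma coinvariants_act [simp]: "coinvariants (act G h c) = coinvariants c"
  by (induction c rule: frag_induct) (auto simp: act_linear)

lemma coinvariants_module_ext:
  "coinvariants (module_ext G \<phi> c) = frag_extend (\<lambda>b. coinvariants (\<phi> b)) (coinvariants c)"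
  by (induction c rule: frag_induct) (auto simp: module_ext_linear frag_extend_diff)

context cyclic_coordinates
begin

sublocale bar: contracted_resolution G "bar_basis G" "bar_d G" "bar_s G"
  by (rule bar_resolution)

sublocale small: contracted_resolution G small_basis small_d small_s
  by (rule small_resolution)

text \<open>
  On coinvariants the generator minus one vanishes and the norm becomes multiplication by the
  order of the factor.
\<close>

definition reduced_d :: "(nat \<Rightarrow> nat) \<Rightarrow> ((nat \<Rightarrow> nat) \<Rightarrow>\<^sub>0 int)" where
  "reduced_d l = (\<Sum>r\<in>{1..n}. if even (l r) \<and> 0 < l r
     then frag_cmul (koszul_sign r l * int (m r)) (frag_of (l(r := l r - 1))) else 0)"

lemma coinvariants_small_d: "coinvariants (small_d l) = reduced_d l"
  unfolding small_d_eq coinvariants_sum reduced_d_def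
  by (rule sum.cong)
    (auto simp: signed_op_def local_op_def cyc_d_def put_def frag_extend_diff frag_extend_sum'
      coinvariants_sum sum_frag_of_const)

lemma coinvariants_bd:
  "coinvariants (module_ext G small_d c) = frag_extend reduced_d (coinvariants c)"
  by (simp add: coinvariants_module_ext coinvariants_small_d)

lemma reduced_d_d:
  assumes "l \<in> small_basis (Suc (Suc k))"
  shows "frag_extend reduced_d (reduced_d l) = 0"
  using small.d_d[OF assms] coinvariants_bd[of "small_d l"] by (simp add: coinvariants_small_d)

text \<open>
  The comparison maps start with the identity of \<open>\<int>G\<close> in degree zero: the empty symbol corresponds to
  the multidegree zero.
\<close>

definition to_bar :: "nat \<Rightarrow> (nat \<Rightarrow> nat) \<Rightarrow> (('a \<times> 'a list) \<Rightarrow>\<^sub>0 int)" where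
  "to_bar = bar.lift (\<lambda>_. []) small_d"

definition to_small :: "nat \<Rightarrow> 'a list \<Rightarrow> (('a \<times> (nat \<Rightarrow> nat)) \<Rightarrow>\<^sub>0 int)" where
  "to_small = small.lift (\<lambda>_ _. 0) (bar_d G)"

lemma to_bar_in: "l \<in> small_basis k \<Longrightarrow> to_bar k l \<in> free_chains G (bar_basis G k)"
  unfolding to_bar_def by (rule lift_in_chains[OF small_resolution bar_resolution])
    (auto simp: bar_basis_def)

lemma to_small_in: "hs \<in> bar_basis G k \<Longrightarrow> to_small k hs \<in> free_chains G (small_basis k)"
  unfolding to_small_def by (rule lift_in_chains[OF bar_resolution small_resolution])
    (auto simp: small_basis_def multidegrees_def)

lemma to_bar_chain_map:
  "l \<in> small_basis (Suc k) \<Longrightarrow>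
    module_ext G (bar_d G) (to_bar (Suc k) l) = module_ext G (to_bar k) (small_d l)"
  unfolding to_bar_def by (rule lift_chain_map[OF small_resolution bar_resolution])
    (auto simp: bar_basis_def)

lemma to_small_chain_map:
  "hs \<in> bar_basis G (Suc k) \<Longrightarrow>
    module_ext G small_d (to_small (Suc k) hs) = module_ext G (to_small k) (bar_d G hs)"
  unfolding to_small_def by (rule lift_chain_map[OF bar_resolution small_resolution])
    (auto simp: small_basis_def multidegrees_def)

definition round_trip :: "nat \<Rightarrow> 'a list \<Rightarrow> (('a \<times> 'a list) \<Rightarrow>\<^sub>0 int)" where
  "round_trip k hs = module_ext G (to_bar k) (to_small k hs)"

abbreviation "bar_homotopy \<equiv> bar.homotopy round_trip"

lemma round_trip_in: "hs \<in> bar_basis G k \<Longrightarrow> round_trip k hs \<in> free_chains G (bar_basis G k)"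
  unfolding round_trip_def by (rule module_ext_in_chains[OF to_small_in]) (auto intro: to_bar_in)

lemma round_trip_0: "hs \<in> bar_basis G 0 \<Longrightarrow> round_trip 0 hs = frag_of (\<one>, hs)"
  by (simp add: round_trip_def to_small_def to_bar_def bar_basis_def)

lemma round_trip_chain_map:
  assumes "hs \<in> bar_basis G (Suc k)"
  shows "module_ext G (bar_d G) (round_trip (Suc k) hs) = module_ext G (round_trip k) (bar_d G hs)"
proof -
  note ts = to_small_in[OF assms] and bd = bar.d_in[OF assms]
  have "module_ext G (bar_d G) (round_trip (Suc k) hs) =
      module_ext G (\<lambda>l. module_ext G (bar_d G) (to_bar (Suc k) l)) (to_small (Suc k) hs)"
    unfolding round_trip_def
    by (rule module_ext_compose[OF ts]) (auto intro: to_bar_in bar.d_in)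
  also have "\<dots> = module_ext G (\<lambda>l. module_ext G (to_bar k) (small_d l)) (to_small (Suc k) hs)"
    by (rule module_ext_cong[OF ts]) (rule to_bar_chain_map)
  also have "\<dots> = module_ext G (to_bar k) (module_ext G small_d (to_small (Suc k) hs))"
    by (rule module_ext_compose[OF ts, symmetric]) (auto intro: to_bar_in small.d_in)
  also have "\<dots> = module_ext G (to_bar k) (module_ext G (to_small k) (bar_d G hs))"
    by (simp add: to_small_chain_map[OF assms])
  also have "\<dots> = module_ext G (round_trip k) (bar_d G hs)"
    unfolding round_trip_def[abs_def]
    by (rule module_ext_compose[OF bd]) (auto intro: to_bar_in to_small_in)
  finally show ?thesis .
qed

lemmas bar_homotopy_in = bar.homotopy_identity(1)[of round_trip, OF round_trip_in round_trip_0
    round_trip_chain_map]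

lemma bar_homotopy:
  assumes c: "c \<in> free_chains G (bar_basis G (Suc k))"
  shows "bar.bd (module_ext G (bar_homotopy (Suc k)) c) =
    c - module_ext G (to_bar (Suc k)) (module_ext G (to_small (Suc k)) c) -
    module_ext G (bar_homotopy k) (bar.bd c)"
proof -
  have "bar.bd (module_ext G (bar_homotopy (Suc k)) c) =
      module_ext G (\<lambda>b. bar.bd (bar_homotopy (Suc k) b)) c"
    by (rule module_ext_compose[OF c, where S' = "bar_basis G (Suc (Suc k))"])
      (auto intro: bar_homotopy_in bar.d_in simp del: bar.homotopy.simps)
  also have "\<dots> = module_ext G (\<lambda>b. frag_of (\<one>, b) - round_trip (Suc k) b -
      module_ext G (bar_homotopy k) (bar_d G b)) c"
    by (rule module_ext_cong[OF c])
      (rule bar.homotopy_identity(2)[of round_trip, OF round_trip_in round_trip_0 round_trip_chain_map])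
  also have "\<dots> = c - module_ext G (round_trip (Suc k)) c -
      module_ext G (\<lambda>b. module_ext G (bar_homotopy k) (bar_d G b)) c"
    by (simp add: module_ext_minus module_ext_basis[OF c])
  also have "module_ext G (\<lambda>b. module_ext G (bar_homotopy k) (bar_d G b)) c =
      module_ext G (bar_homotopy k) (bar.bd c)"
    by (rule module_ext_compose[OF c, symmetric, where S' = "bar_basis G k"])
      (auto intro: bar_homotopy_in bar.d_in)
  also have "module_ext G (round_trip (Suc k)) c =
      module_ext G (to_bar (Suc k)) (module_ext G (to_small (Suc k)) c)"
    unfolding round_trip_def[abs_def]
    by (rule module_ext_compose[OF c, symmetric]) (auto intro: to_bar_in to_small_in)
  finally show ?thesis .
qed

definition pullback ::
  "((('a \<times> 'a list) \<Rightarrow>\<^sub>0 int) \<Rightarrow> 'k::field) \<Rightarrow> nat \<Rightarrow> (nat \<Rightarrow> nat) \<Rightarrow> 'k" where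
  "pullback f k l = (if l \<in> small_basis k then f (to_bar k l) else 1)"

lemma pullback_nonzero: "f \<in> bar_cochains G k \<Longrightarrow> pullback f k l \<noteq> 0"
  by (simp add: pullback_def cochain_nonzero to_bar_in)

lemma pullback_coboundary:
  assumes f: "f \<in> bar_cochains G k" and l: "l \<in> small_basis (Suc k)"
  shows "f (bar.bd (to_bar (Suc k) l)) = mult_ext (pullback f k) (reduced_d l)"
proof -
  have "f (bar.bd (to_bar (Suc k) l)) = f (module_ext G (to_bar k) (small_d l))"
    by (simp add: to_bar_chain_map[OF l])
  also have "\<dots> = mult_ext (pullback f k) (coinvariants (small_d l))"
    unfolding coinvariants_def
  proof (rule cochain_module_ext[OF f small.d_in[OF l]])
    show "pullback f k l \<noteq> 0" for l by (rule pullback_nonzero[OF f])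
  qed (simp_all add: to_bar_in pullback_def)
  finally show ?thesis by (simp add: coinvariants_small_d)
qed

lemma pullback_cocycle:
  assumes f: "f \<in> bar_cochains G k" and l: "l \<in> small_basis (Suc k)"
    and cocycle: "\<And>c. c \<in> free_chains G (bar_basis G (Suc k)) \<Longrightarrow> f (bar.bd c) = 1"
  shows "mult_ext (pullback f k) (reduced_d l) = 1"
  using pullback_coboundary[OF f l] cocycle[OF to_bar_in[OF l]] by simp

text \<open>
  Restriction to the small resolution detects coboundaries.  A cocycle \<open>f\<close> agrees with its
  pullback along the round trip up to the coboundary of \<open>f\<close> composed with the homotopy; if its
  restriction is the coboundary of \<open>h\<close>, then the round trip contributes the coboundary of \<open>h\<close>
  pulled back to the bar resolution.
\<close>

theorem coboundary_if_pullback: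
  assumes f: "(f :: (('a \<times> 'a list) \<Rightarrow>\<^sub>0 int) \<Rightarrow> 'k :: field) \<in> bar_cochains G (Suc k)"
    and cocycle: "\<And>c. c \<in> free_chains G (bar_basis G (Suc (Suc k))) \<Longrightarrow> f (bar.bd c) = 1"
    and h: "\<And>l. h l \<noteq> 0"
    and eq: "\<And>l. l \<in> small_basis (Suc k) \<Longrightarrow> pullback f (Suc k) l = mult_ext h (reduced_d l)"
  shows "\<exists>u\<in>bar_cochains G k. \<forall>c\<in>free_chains G (bar_basis G (Suc k)). f c = u (bar.bd c)"
proof -
  let ?C = "free_chains G (bar_basis G k)"
  define u where "u c = f (module_ext G (bar_homotopy k) c) *
    mult_ext h (coinvariants (module_ext G (to_small k) c))" for c
  have H_in: "module_ext G (bar_homotopy k) c \<in> free_chains G (bar_basis G (Suc k))" if "c \<in> ?C" for c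
    using that by (rule module_ext_in_chains) (rule bar_homotopy_in)
  have "restrict u ?C \<in> bar_cochains G k"
  proof (rule cochainI)
    show "u c \<noteq> 0" if "c \<in> ?C" for c
      using cochain_nonzero[OF f H_in[OF that]] by (simp add: u_def mult_ext_nonzero h)
    show "u (a + b) = u a * u b" if "a \<in> ?C" "b \<in> ?C" for a b
      using cochain_add[OF f H_in[OF that(1)] H_in[OF that(2)]]
      by (simp add: u_def module_ext_linear mult_ext_add h)
    show "u (act G g c) = u c" if g: "g \<in> carrier G" and c: "c \<in> ?C" for g c
    proof -
      have "module_ext G (bar_homotopy k) (act G g c) = act G g (module_ext G (bar_homotopy k) c)"
        by (rule module_ext_act[OF g c]) (rule bar_homotopy_in)
      moreover have "module_ext G (to_small k) (act G g c) = act G g (module_ext G (to_small k) c)"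
        by (rule module_ext_act[OF g c]) (rule to_small_in)
      ultimately show ?thesis
        using cochain_act[OF f g H_in[OF c]] by (simp add: u_def)
    qed
  qed
  moreover have "f c = u (bar.bd c)" if c: "c \<in> free_chains G (bar_basis G (Suc k))" for c
  proof -
    let ?P = "module_ext G (to_small (Suc k)) c"
    have P: "?P \<in> free_chains G (small_basis (Suc k))"
      using c by (rule module_ext_in_chains) (rule to_small_in)
    have HS: "module_ext G (bar_homotopy (Suc k)) c \<in> free_chains G (bar_basis G (Suc (Suc k)))"
      using c by (rule module_ext_in_chains) (rule bar_homotopy_in)
    have PB: "module_ext G (to_bar (Suc k)) ?P \<in> free_chains G (bar_basis G (Suc k))"
      using P by (rule module_ext_in_chains) (rule to_bar_in)
    have "f c = f (bar.bd (module_ext G (bar_homotopy (Suc k)) c) +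
        (module_ext G (to_bar (Suc k)) ?P + module_ext G (bar_homotopy k) (bar.bd c)))"
      by (simp add: bar_homotopy[OF c] del: bar.homotopy.simps)
    also have "\<dots> = f (module_ext G (to_bar (Suc k)) ?P) * f (module_ext G (bar_homotopy k) (bar.bd c))"
      using cocycle[OF HS]
      by (simp add: cochain_add[OF f] chains_add PB H_in bar.bd_in c HS del: bar.homotopy.simps)
    also have "f (module_ext G (to_bar (Suc k)) ?P) =
        mult_ext (\<lambda>l. mult_ext h (reduced_d l)) (coinvariants ?P)"
      unfolding coinvariants_def
      by (rule cochain_module_ext[OF f P])
        (auto simp: to_bar_in mult_ext_nonzero h simp flip: eq, simp add: pullback_def)
    also have "\<dots> = mult_ext h (coinvariants (module_ext G small_d ?P))"
      by (simp add: coinvariants_bd mult_ext_extend h)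
    also have "module_ext G small_d ?P = module_ext G (to_small k) (bar.bd c)"
    proof -
      have "module_ext G small_d ?P = module_ext G (\<lambda>b. module_ext G small_d (to_small (Suc k) b)) c"
        by (rule module_ext_compose[OF c]) (auto intro: to_small_in small.d_in)
      also have "\<dots> = module_ext G (\<lambda>b. module_ext G (to_small k) (bar_d G b)) c"
        by (rule module_ext_cong[OF c]) (rule to_small_chain_map)
      also have "\<dots> = module_ext G (to_small k) (bar.bd c)"
        by (rule module_ext_compose[OF c, symmetric]) (auto intro: to_small_in bar.d_in)
      finally show ?thesis .
    qed
    finally show ?thesis
      by (simp add: u_def mult.commute)
  qed
  ultimately show ?thesis
    using bar.bd_in by (intro bexI[of _ "restrict u ?C"] ballI) auto
qed

end

section \<open>Cup products of exponents and carries\<close>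

context cyclic_coordinates
begin

definition carry :: "nat \<Rightarrow> 'a \<Rightarrow> 'a \<Rightarrow> nat" where
  "carry r h h' = (coord h r + coord h' r) div m r"

text \<open>
  A word encodes a cup product of integral cochains: the letter \<open>(r, False)\<close> is the exponent of
  the \<open>r\<close>-th generator, a cocycle of degree one modulo \<open>m r\<close>, and \<open>(r, True)\<close> is the carry in the
  \<open>r\<close>-th coordinate, an integral cocycle of degree two.
\<close>

fun cup :: "(nat \<times> bool) list \<Rightarrow> 'a list \<Rightarrow> int" where
  "cup [] hs = (if hs = [] then 1 else 0)"
| "cup ((r, False) # w) (h # hs) = int (coord h r) * cup w hs"
| "cup ((r, True) # w) (h # h' # hs) = int (carry r h h') * cup w hs"
| "cup ((r, b) # w) hs = 0"

definition cup_value :: "(nat \<times> bool) list \<Rightarrow> (('a \<times> 'a list) \<Rightarrow>\<^sub>0 int) \<Rightarrow> int" where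
  "cup_value w c = int_ext (cup w) (coinvariants c)"

lemma cup_value_simps [simp]:
  "cup_value w 0 = 0" "cup_value w (frag_of (h, hs)) = cup w hs"
  "cup_value w (act G h c) = cup_value w c"
  by (simp_all add: cup_value_def)

lemma cup_value_linear:
  "cup_value w (a + b) = cup_value w a + cup_value w b"
  "cup_value w (a - b) = cup_value w a - cup_value w b"
  "cup_value w (- a) = - cup_value w a"
  "cup_value w (frag_cmul z a) = z * cup_value w a"
  by (simp_all add: cup_value_def int_ext_linear)

abbreviation letters_in_range :: "(nat \<times> bool) list \<Rightarrow> bool" where
  "letters_in_range w \<equiv> fst ` set w \<subseteq> {1..n}"

lemma carry_one:
  "h \<in> carrier G \<Longrightarrow> r \<in> {1..n} \<Longrightarrow> carry r \<one> h = 0"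
  "h \<in> carrier G \<Longrightarrow> r \<in> {1..n} \<Longrightarrow> carry r h \<one> = 0"
  by (simp_all add: carry_def coord_one coord_less)

text \<open>
  Every position of the argument is consumed by a letter that vanishes on \<open>\<one>\<close>.
\<close>

lemma cup_normalized:
  "\<one> \<in> set hs \<Longrightarrow> set hs \<subseteq> carrier G \<Longrightarrow> letters_in_range w \<Longrightarrow> cup w hs = 0"
  by (induction w hs rule: cup.induct) (auto simp: coord_one carry_one)

lemma cup_value_symbol:
  "set hs \<subseteq> carrier G \<Longrightarrow> letters_in_range w \<Longrightarrow> cup_value w (bar_symbol G hs) = cup w hs"
  by (auto simp: bar_symbol_def cup_normalized)

lemma carry_mult:
  assumes "h \<in> carrier G" "h' \<in> carrier G" "r \<in> {1..n}"
  shows "int (m r) * int (carry r h h') = int (coord h r) + int (coord h' r) - int (coord (h \<otimes> h') r)"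
proof -
  have "m r * carry r h h' + coord (h \<otimes> h') r = coord h r + coord h' r"
    by (simp add: carry_def coord_mult[OF assms])
  then show ?thesis by (metis add_diff_cancel_right' of_nat_add of_nat_mult)
qed

text \<open>
  After multiplication by \<open>m r\<close> the carry becomes the coboundary of the integer-valued coordinate, so
  the alternating sum telescopes.
\<close>

lemma carry_cocycle:
  assumes "a \<in> carrier G" "b \<in> carrier G" "c \<in> carrier G" "r \<in> {1..n}"
  shows "int (carry r b c) - int (carry r (a \<otimes> b) c) + int (carry r a (b \<otimes> c)) - int (carry r a b) = 0"
proof -
  have "int (m r) * (int (carry r b c) - int (carry r (a \<otimes> b) c) + int (carry r a (b \<otimes> c)) -
      int (carry r a b)) = 0"
    using assms by (simp add: right_diff_distrib distrib_left carry_mult m_assoc)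
  then show ?thesis using m_pos[OF assms(4)] by simp
qed

lemma later_faces_mult:
  "later_faces G (\<lambda>x. z * F x) hs = z * later_faces G F hs" for z :: int
  by (rule later_faces_additive[symmetric]) (auto simp: algebra_simps)

text \<open>The Leibniz rule, one letter at a time: the coboundary of the first letter vanishes modulo \<open>M\<close>.\<close>

lemma cup_cocycle:
  assumes "letters_in_range w" "\<And>r b. (r, b) \<in> set w \<Longrightarrow> M dvd m r" "set (h # t) \<subseteq> carrier G"
  shows "int M dvd cup w t + later_faces G (cup w) (h # t)"
  using assms
proof (induction w arbitrary: h t)
  case Nil
  have "later_faces G (\<lambda>x. cup [] (h # x)) hs = 0" for hs
    by (simp add: later_faces_zero)
  then show ?case by (cases t) (auto simp del: cup.simps(1), auto)
next
  case (Cons l w)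
  obtain r b where l: "l = (r, b)" by (cases l)
  have r: "r \<in> {1..n}" and M: "int M dvd int (m r)" using Cons.prems l by auto
  have IH: "int M dvd cup w t + later_faces G (cup w) (h # t)" if "set (h # t) \<subseteq> carrier G" for h t
    using Cons.IH[of h t] Cons.prems that by auto
  show ?case
  proof (cases b)
    case False
    show ?thesis
    proof (cases t)
      case (Cons h' t')
      let ?c = "\<lambda>h. int (coord h r)"
      have hh: "h \<in> carrier G" "h' \<in> carrier G" using \<open>set (h # t) \<subseteq> carrier G\<close> Cons by auto
      have "cup (l # w) t + later_faces G (cup (l # w)) (h # t) =
          (?c h + ?c h' - ?c (h \<otimes> h')) * cup w t' -
          ?c h * (cup w t' + later_faces G (cup w) (h' # t'))"
        by (simp add: l False Cons later_faces_mult algebra_simps)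
      also have "\<dots> = int (m r) * int (carry r h h') * cup w t' -
          ?c h * (cup w t' + later_faces G (cup w) (h' # t'))"
        by (simp only: carry_mult[OF hh r])
      finally show ?thesis
        using M IH[of h' t'] \<open>set (h # t) \<subseteq> carrier G\<close> Cons by (simp add: dvd_diff dvd_mult dvd_mult2)
    qed (simp add: l False)
  next
    case True
    show ?thesis
    proof (cases t)
      case (Cons h' t')
      show ?thesis
      proof (cases t')
        case Nil
        then show ?thesis by (simp add: l True Cons)
      next
        case (Cons h'' t'')
        let ?c = "\<lambda>h h'. int (carry r h h')"
        have t: "t = h' # h'' # t''" using \<open>t = h' # t'\<close> Cons by simp
        have hh: "h \<in> carrier G" "h' \<in> carrier G" "h'' \<in> carrier G"
          using \<open>set (h # t) \<subseteq> carrier G\<close> t by auto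
        have "cup (l # w) t + later_faces G (cup (l # w)) (h # t) =
            (?c h' h'' - ?c (h \<otimes> h') h'' + ?c h (h' \<otimes> h'') - ?c h h') * cup w t'' +
            ?c h h' * (cup w t'' + later_faces G (cup w) (h'' # t''))"
          by (simp add: l True t later_faces_mult) (simp add: algebra_simps)
        also have "\<dots> = ?c h h' * (cup w t'' + later_faces G (cup w) (h'' # t''))"
          by (simp add: carry_cocycle[OF hh r])
        finally show ?thesis
          using IH[of h'' t''] \<open>set (h # t) \<subseteq> carrier G\<close> t by (simp add: dvd_mult)
      qed
    qed (simp add: l True)
  qed
qed

lemma cup_value_boundary:
  assumes "letters_in_range w" "\<And>r b. (r, b) \<in> set w \<Longrightarrow> M dvd m r"
    and c: "c \<in> free_chains G (bar_basis G (Suc k))"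
  shows "int M dvd cup_value w (bar.bd c)"
  using c
proof (induction rule: chains_induct)
  case (of g hs)
  obtain h t where [simp]: "hs = h # t" using of by (cases hs) (auto simp: bar_basis_def)
  have hs: "set hs \<subseteq> carrier G" using of by (auto simp: bar_basis_def)
  have "cup_value w (later_faces G (bar_symbol G) hs) =
      later_faces G (\<lambda>x. cup_value w (bar_symbol G x)) hs"
    by (rule later_faces_additive) (auto simp: cup_value_linear)
  also have "\<dots> = later_faces G (cup w) hs"
    using hs assms(1) by (intro later_faces_cong) (auto simp: cup_value_symbol)
  finally have "cup_value w (bar_d G hs) = cup w t + later_faces G (cup w) hs"
    using hs assms(1) by (simp add: bar_d_Cons cup_value_linear cup_value_symbol)
  then show ?case
    using cup_cocycle[of w M h t] assms(1,2) hs by simp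
qed (auto simp: module_ext_linear cup_value_linear)

section \<open>Values of the cup products on the small resolution\<close>

definition power_of :: "nat \<Rightarrow> nat \<Rightarrow> 'a" where
  "power_of r i = set_coord \<one> r i"

definition prepend :: "'a \<Rightarrow> (('a \<times> 'a list) \<Rightarrow>\<^sub>0 int) \<Rightarrow> (('a \<times> 'a list) \<Rightarrow>\<^sub>0 int)" where
  "prepend h c = frag_extend (bar_s G) (act G h c)"

lemma prepend_linear:
  "prepend h 0 = 0" "prepend h (a + b) = prepend h a + prepend h b"
  "prepend h (a - b) = prepend h a - prepend h b"
  "prepend h (frag_cmul z a) = frag_cmul z (prepend h a)"
  by (simp_all add: prepend_def act_linear frag_extend_linear)

lemma power_of_in: "r \<in> {1..n} \<Longrightarrow> i < m r \<Longrightarrow> power_of r i \<in> carrier G"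
  by (simp add: power_of_def set_coord_in)

lemma coord_power_of:
  "r \<in> {1..n} \<Longrightarrow> i < m r \<Longrightarrow> coord (power_of r i) q = (if q = r then i else 0)"
  by (simp add: power_of_def coord_set_coord coord_one)

definition lower :: "nat \<Rightarrow> (nat \<Rightarrow> nat) \<Rightarrow> (nat \<Rightarrow> nat)" where
  "lower r l = l(r := l r - 1)"

lemma lower_in: "l \<in> small_basis (Suc k) \<Longrightarrow> r \<in> {1..n} \<Longrightarrow> 0 < l r \<Longrightarrow> lower r l \<in> small_basis k"
  by (auto simp: small_basis_def multidegrees_def lower_def sum.remove[of _ r])

text \<open>
  Since the contraction of the bar resolution prepends the group coefficient, one step of the chain
  map prepends the group elements that occur in one step of the small boundary.
\<close>

lemma to_bar_Suc:
  "to_bar (Suc k) l = (\<Sum>r\<in>{1..n}. frag_cmul (koszul_sign r l)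
     (if l r = 0 then 0
      else if odd (l r) then prepend (power_of r (Suc 0 mod m r)) (to_bar k (lower r l))
        - prepend \<one> (to_bar k (lower r l))
      else (\<Sum>i<m r. prepend (power_of r i) (to_bar k (lower r l)))))"
  (is "_ = (\<Sum>r\<in>_. ?step r)")
proof -
  have "to_bar (Suc k) l = frag_extend (bar_s G) (module_ext G (to_bar k) (small_d l))"
    by (simp add: to_bar_def)
  also have "\<dots> = (\<Sum>r\<in>{1..n}. frag_extend (bar_s G) (module_ext G (to_bar k) (signed_op r (cyc_d r) (\<one>, l))))"
    by (simp add: small_d_eq module_ext_sum frag_extend_sum')
  also have "\<dots> = (\<Sum>r\<in>{1..n}. ?step r)"
  proof (rule sum.cong[OF refl])
    fix r assume "r \<in> {1..n}"
    have "set_coord \<one> r 0 = \<one>"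
      using set_coord_same[of \<one> r] by (simp add: coord_one)
    then show "frag_extend (bar_s G) (module_ext G (to_bar k) (signed_op r (cyc_d r) (\<one>, l))) =
        ?step r"
      by (simp add: signed_op_def local_op_def cyc_d_def put_def coord_one module_ext_linear
        frag_extend_linear prepend_def power_of_def lower_def module_ext_sum frag_extend_sum')
  qed
  finally show ?thesis .
qed

text \<open>
  The chain map takes values in combinations of bare symbols with coefficient \<open>\<one>\<close>.  Prepending \<open>h\<close> to
  these adds the entry \<open>h\<close> itself, which is what a cup product reads off.
\<close>

definition unit_chains :: "(('a \<times> 'a list) \<Rightarrow>\<^sub>0 int) set" where
  "unit_chains = {c. Poly_Mapping.keys c \<subseteq> {\<one>} \<times> {hs. set hs \<subseteq> carrier G}}"

lemma unit_chains_induct [consumes 1, case_names zero of diff]: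
  assumes "c \<in> unit_chains" "P 0" "\<And>hs. set hs \<subseteq> carrier G \<Longrightarrow> P (frag_of (\<one>, hs))"
    "\<And>a b. P a \<Longrightarrow> P b \<Longrightarrow> P (a - b)"
  shows "P c"
  by (rule frag_induction[of c "{\<one>} \<times> {hs. set hs \<subseteq> carrier G}"])
    (use assms in \<open>auto simp: unit_chains_def\<close>)

lemma bar_s_unit: "h \<in> carrier G \<Longrightarrow> set hs \<subseteq> carrier G \<Longrightarrow>
    Poly_Mapping.keys (bar_s G (h, hs)) \<subseteq> {\<one>} \<times> {hs. set hs \<subseteq> carrier G}"
  by (auto simp: bar_s_def bar_symbol_def)

lemma bar_s_ext_unit:
  assumes "c \<in> free_chains G (bar_basis G k)"
  shows "frag_extend (bar_s G) c \<in> unit_chains"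
proof -
  have "Poly_Mapping.keys (bar_s G x) \<subseteq> {\<one>} \<times> {hs. set hs \<subseteq> carrier G}"
    if "x \<in> Poly_Mapping.keys c" for x
  proof -
    obtain h hs where x: "x = (h, hs)" by (cases x)
    have "h \<in> carrier G" "set hs \<subseteq> carrier G"
      using that assms unfolding x free_chains_def bar_basis_def by blast+
    then show ?thesis unfolding x by (rule bar_s_unit)
  qed
  then show ?thesis
    using keys_frag_extend[of "bar_s G" c] unfolding unit_chains_def by blast
qed

lemma to_bar_unit: "l \<in> small_basis k \<Longrightarrow> to_bar k l \<in> unit_chains"
proof (cases k)
  case 0
  then show ?thesis by (simp add: to_bar_def unit_chains_def)
next
  case (Suc k')
  assume "l \<in> small_basis k"
  then have "module_ext G (to_bar k') (small_d l) \<in> free_chains G (bar_basis G k')"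
    unfolding Suc by (intro module_ext_in_chains[OF small.d_in] to_bar_in)
  then have "frag_extend (bar_s G) (module_ext G (to_bar k') (small_d l)) \<in> unit_chains"
    by (rule bar_s_ext_unit)
  then show ?thesis by (simp add: to_bar_def Suc)
qed

lemma cup_value_prepend_single:
  assumes "h \<in> carrier G" "c \<in> unit_chains" "letters_in_range ((q, False) # w)"
  shows "cup_value ((q, False) # w) (prepend h c) = int (coord h q) * cup_value w c"
  using assms(2)
proof (induction rule: unit_chains_induct)
  case (of hs)
  then show ?case
    using assms(1,3) by (simp add: prepend_def bar_s_def cup_value_symbol)
qed (auto simp: prepend_linear cup_value_linear algebra_simps)

lemma cup_value_prepend_pair:
  assumes "h \<in> carrier G" "h' \<in> carrier G" "c \<in> unit_chains" "letters_in_range ((q, True) # w)"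
  shows "cup_value ((q, True) # w) (prepend h (prepend h' c)) = int (carry q h h') * cup_value w c"
  using assms(3)
proof (induction rule: unit_chains_induct)
  case (of hs)
  show ?case
  proof (cases "\<one> \<in> set (h' # hs)")
    case True
    then have "cup ((q, True) # w) (h # h' # hs) = 0"
      using of assms by (intro cup_normalized) auto
    then show ?thesis
      using True assms of by (auto simp: prepend_def bar_s_def bar_symbol_def)
  next
    case False
    then show ?thesis
      using of assms carry_one(1)[of h' q] by (simp add: prepend_def bar_s_def cup_value_symbol)
        (auto simp: bar_symbol_def)
  qed
qed (auto simp: prepend_linear cup_value_linear algebra_simps)

text \<open>
  A functional that ignores prepended powers of the generators other than the \<open>q\<close>-th, and prepended
  units, retains from one step of the chain map only the summand of the factor \<open>q\<close>.
\<close>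

lemma evaluate_to_bar:
  assumes T: "T 0 = 0" "\<And>a b. T (a + b) = T a + T b" "\<And>a b. T (a - b) = T a - T b"
      "\<And>z a. T (frag_cmul z a) = z * (T a :: int)"
    and l: "l \<in> small_basis (Suc k)" and q: "q \<in> {1..n}"
    and A: "\<And>h v. h \<in> carrier G \<Longrightarrow> v \<in> small_basis k \<Longrightarrow> T (prepend h (to_bar k v)) = A h v"
    and A_one: "\<And>v. A \<one> v = 0"
    and A_other: "\<And>r i v. r \<in> {1..n} \<Longrightarrow> i < m r \<Longrightarrow> r \<noteq> q \<Longrightarrow> A (power_of r i) v = 0"
  shows "T (to_bar (Suc k) l) = (if l q = 0 then 0 else koszul_sign q l *
    (if odd (l q) then A (power_of q (Suc 0 mod m q)) (lower q l)
     else (\<Sum>i<m q. A (power_of q i) (lower q l))))"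
proof -
  have T_sum: "T (sum f B) = (\<Sum>i\<in>B. T (f i))" for f and B :: "nat set"
    by (induction B rule: infinite_finite_induct) (auto simp: T)
  let ?step = "\<lambda>r. if l r = 0 then 0
    else if odd (l r) then A (power_of r (Suc 0 mod m r)) (lower r l)
    else (\<Sum>i<m r. A (power_of r i) (lower r l))"
  have "T (to_bar (Suc k) l) = (\<Sum>r\<in>{1..n}. koszul_sign r l * ?step r)"
    unfolding to_bar_Suc T_sum
  proof (rule sum.cong[OF refl])
    fix r assume r: "r \<in> {1..n}"
    have "Suc 0 mod m r < m r" using m_pos[OF r] by simp
    then show "T (frag_cmul (koszul_sign r l)
     (if l r = 0 then 0
      else if odd (l r) then prepend (power_of r (Suc 0 mod m r)) (to_bar k (lower r l))
        - prepend \<one> (to_bar k (lower r l))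
      else (\<Sum>i<m r. prepend (power_of r i) (to_bar k (lower r l))))) = koszul_sign r l * ?step r"
      using r lower_in[OF l r] by (auto simp: T T_sum A A_one power_of_in)
  qed
  also have "\<dots> = (\<Sum>r\<in>{1..n}. if r = q then koszul_sign q l * ?step q else 0)"
  proof (rule sum.cong[OF refl])
    fix r assume r: "r \<in> {1..n}"
    have "A (power_of r (Suc 0 mod m r)) (lower r l) = 0" "(\<Sum>i<m r. A (power_of r i) (lower r l)) = 0"
      if "r \<noteq> q"
      using r that m_pos[OF r] by (auto intro!: A_other sum.neutral)
    then show "koszul_sign r l * ?step r = (if r = q then koszul_sign q l * ?step q else 0)"
      by (cases "r = q") (simp_all only: if_True if_False if_cancel mult_zero_right simp_thms)
  qed
  also have "\<dots> = (if l q = 0 then 0 else koszul_sign q l *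
    (if odd (l q) then A (power_of q (Suc 0 mod m q)) (lower q l)
     else (\<Sum>i<m q. A (power_of q i) (lower q l))))"
    using q by simp
  finally show ?thesis .
qed

text \<open>
  The word of a multidegree multiplies the factors in descending order; an odd degree is one
  exponent followed by carries.
\<close>

definition block_word :: "nat \<Rightarrow> nat \<Rightarrow> (nat \<times> bool) list" where
  "block_word r k = (if odd k then [(r, False)] else []) @ replicate (k div 2) (r, True)"

primrec word :: "(nat \<Rightarrow> nat) \<Rightarrow> nat \<Rightarrow> (nat \<times> bool) list" where
  "word l 0 = []"
| "word l (Suc r) = block_word (Suc r) (l (Suc r)) @ word l r"

lemma word_cong: "(\<And>j. j \<in> {1..r} \<Longrightarrow> l j = l' j) \<Longrightarrow> word l r = word l' r"
  by (induction r) auto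

lemma word_truncate: "q \<le> r \<Longrightarrow> (\<And>j. q < j \<Longrightarrow> j \<le> r \<Longrightarrow> l j = 0) \<Longrightarrow> word l r = word l q"
  by (induction r rule: dec_induct) (auto simp: block_word_def)

lemma word_letters: "(r, b) \<in> set (word l k) \<Longrightarrow> r \<in> {1..k} \<and> 0 < l r"
proof (induction k)
  case (Suc k)
  have "0 < l (Suc k)" if "(r, b) \<in> set (block_word (Suc k) (l (Suc k)))"
    using that by (cases "l (Suc k) = 0") (auto simp: block_word_def)
  then show ?case using Suc by (auto simp: block_word_def split: if_splits)
qed simp

lemma word_in_range: "letters_in_range (word l n)"
  using word_letters[of _ _ l n] by force

lemma word_odd:
  assumes "q \<in> {1..n}" "\<And>j. q < j \<Longrightarrow> j \<le> n \<Longrightarrow> l j = 0" "odd (l q)"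
  shows "word l n = (q, False) # word (lower q l) n"
proof -
  obtain q' where q: "q = Suc q'" using assms(1) by (cases q) auto
  have "word l n = word l q" "word (lower q l) n = word (lower q l) q"
    using assms by (auto intro!: word_truncate simp: lower_def)
  moreover have "word (lower q l) q' = word l q'"
    by (rule word_cong) (auto simp: lower_def q)
  moreover have "(l q - 1) div 2 = l q div 2" "even (l q - 1)" using assms(3) by (auto elim!: oddE)
  ultimately show ?thesis
    using assms(3) by (simp add: q block_word_def) (simp add: lower_def)
qed

lemma word_even:
  assumes "q \<in> {1..n}" "\<And>j. q < j \<Longrightarrow> j \<le> n \<Longrightarrow> l j = 0" "even (l q)" "0 < l q"
  shows "word l n = (q, True) # word (lower q (lower q l)) n"
proof -
  obtain q' where q: "q = Suc q'" using assms(1) by (cases q) auto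
  have "word l n = word l q" "word (lower q (lower q l)) n = word (lower q (lower q l)) q"
    using assms by (auto intro!: word_truncate simp: lower_def)
  moreover have "word (lower q (lower q l)) q' = word l q'"
    by (rule word_cong) (auto simp: lower_def q)
  moreover obtain j where "l q = Suc (Suc (2 * j))"
    using assms(3,4) by (metis evenE gr0_implies_Suc mult_0_right mult_Suc_right add_2_eq_Suc not_gr0)
  ultimately show ?thesis
    by (simp add: q block_word_def) (simp add: lower_def)
qed

lemma koszul_sign_top: "(\<And>j. q < j \<Longrightarrow> j \<le> n \<Longrightarrow> l j = 0) \<Longrightarrow> koszul_sign q l = 1"
  by (simp add: koszul_sign_def)

lemma koszul_sign_lower: "koszul_sign q (lower q l) = koszul_sign q l"
  by (simp add: lower_def koszul_sign_upd_le)

lemma lower_inj: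
  assumes "lower q l = lower q l'" "0 < l q" "0 < l' q"
  shows "l = l'"
proof
  fix j show "l j = l' j"
    using fun_cong[OF assms(1), of j] fun_cong[OF assms(1), of q] assms(2,3)
    by (cases "j = q") (auto simp: lower_def)
qed

text \<open>
  The cup products are dual to the basis of the small resolution: only letters from the highest
  factor survive in the leading positions, where the exponent \<open>1\<close>, respectively the single
  exponent \<open>m - 1\<close> that produces a carry with \<open>1\<close>, contributes the coefficient \<open>1\<close>.
\<close>

lemma cup_value_to_bar:
  assumes "l \<in> small_basis k" "v \<in> small_basis k" "\<And>r. r \<in> {1..n} \<Longrightarrow> 0 < l r \<Longrightarrow> 1 < m r"
  shows "cup_value (word l n) (to_bar k v) = (if l = v then 1 else 0)"
  using assms
proof (induction k arbitrary: l v rule: less_induct)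
  case (less k)
  show ?case
  proof (cases "k = 0")
    case True
    have zero: "l = (\<lambda>_. 0)" if "l \<in> small_basis 0" for l
    proof
      fix j show "l j = 0"
        using that by (cases "j \<in> {1..n}") (auto simp: small_basis_def multidegrees_def)
    qed
    have "word (\<lambda>_. 0) r = []" for r
      by (induction r) (auto simp: block_word_def)
    moreover have "l = (\<lambda>_. 0)" "v = (\<lambda>_. 0)"
      using less.prems(1,2) True zero by blast+
    ultimately show ?thesis
      using True by (simp add: to_bar_def)
  next
    case False
    define q where "q = Max {j \<in> {1..n}. 0 < l j}"
    have "{j \<in> {1..n}. 0 < l j} \<noteq> {}"
    proof
      assume "{j \<in> {1..n}. 0 < l j} = {}"
      then have "(\<Sum>j\<in>{1..n}. l j) = 0" by auto
      then show False using less.prems(1) False by (auto simp: small_basis_def)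
    qed
    then have "q \<in> {j \<in> {1..n}. 0 < l j}"
      unfolding q_def by (intro Max_in) auto
    then have q: "q \<in> {1..n}" "0 < l q" by auto
    have top: "l j = 0" if "q < j" "j \<le> n" for j
    proof (rule ccontr)
      assume "l j \<noteq> 0"
      then have "j \<le> q" unfolding q_def using that by (intro Max_ge) auto
      then show False using that by simp
    qed
    have mq: "1 < m q" using less.prems(3) q by auto
    obtain k1 where k1: "k = Suc k1" using False by (cases k) auto
    have l1: "lower q l \<in> small_basis k1" using less.prems(1) q by (auto simp: k1 intro: lower_in)
    have m1: "1 < m r" if "r \<in> {1..n}" "0 < lower q l r" for r
      using that less.prems(3)[of r] by (auto simp: lower_def split: if_splits)
    show ?thesis
    proof (cases "odd (l q)")
      case True
      let ?w = "word (lower q l) n"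
      have w: "word l n = (q, False) # ?w" by (rule word_odd[of q l, OF q(1) top True])
      have range: "letters_in_range ((q, False) # ?w)"
        using word_in_range[of "lower q l"] q by simp
      define V where "V u = cup_value ?w (to_bar k1 u)" for u
      have "cup_value (word l n) (to_bar (Suc k1) v) = (if v q = 0 then 0 else koszul_sign q v *
          (if odd (v q) then int (coord (power_of q (Suc 0 mod m q)) q) * V (lower q v)
           else (\<Sum>i<m q. int (coord (power_of q i) q) * V (lower q v))))"
        unfolding w
        by (rule evaluate_to_bar[where k = k1])
          (use less.prems(2) k1 q range in \<open>auto simp: V_def cup_value_linear to_bar_unit
            cup_value_prepend_single coord_one coord_power_of\<close>)
      moreover have "V (lower q v) = (if lower q l = lower q v then 1 else 0)" if "0 < v q"
        unfolding V_def using less.prems(2) k1 q(1) that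
        by (intro less.IH l1 m1) (auto intro: lower_in)
      moreover have "lower q l \<noteq> lower q v" if "even (v q)" "0 < v q"
        using that True q lower_inj[of q l v] by auto
      moreover have "lower q l \<noteq> lower q v" if "l \<noteq> v" "0 < v q"
        using that q lower_inj[of q l v] by auto
      moreover have "koszul_sign q v = 1" if "l = v"
        using koszul_sign_top[of q l, OF top] that by simp
      ultimately show ?thesis
        using True mq q by (auto simp: k1 coord_power_of)
    next
      case False
      then have even: "even (l q)" by simp
      have lq: "2 \<le> l q" using q even by (cases "l q = 1") auto
      have "lower q l q \<le> (\<Sum>j\<in>{1..n}. lower q l j)"
        using q by (intro member_le_sum) auto
      then have "1 \<le> k1" using l1 lq by (simp add: small_basis_def) (simp add: lower_def)
      then obtain k2 where k2: "k1 = Suc k2" by (cases k1) auto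
      let ?l2 = "lower q (lower q l)"
      let ?w = "word ?l2 n"
      have l2: "?l2 \<in> small_basis k2"
        using l1 q(1) unfolding k2 by (rule lower_in) (use lq in \<open>simp add: lower_def\<close>)
      have m2: "1 < m r" if "r \<in> {1..n}" "0 < ?l2 r" for r
        using that less.prems(3)[of r] by (auto simp: lower_def split: if_splits)
      have w: "word l n = (q, True) # ?w" by (rule word_even[of q l, OF q(1) top even q(2)])
      have range: "letters_in_range ((q, True) # ?w)"
        using word_in_range[of ?l2] q by simp
      define V where "V u = cup_value ?w (to_bar k2 u)" for u
      \<comment> \<open>The carry consumes two entries: \<open>C h u\<close> is the result of the second step after the entry \<open>h\<close>.\<close>
      define C where "C h u = (if u q = 0 then 0 else koszul_sign q u *
          (if odd (u q) then int (carry q h (power_of q (Suc 0 mod m q))) * V (lower q u)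
           else (\<Sum>i<m q. int (carry q h (power_of q i)) * V (lower q u))))" for h u
      have inner: "cup_value (word l n) (prepend h (to_bar (Suc k2) u)) = C h u"
        if h: "h \<in> carrier G" and u: "u \<in> small_basis (Suc k2)" for h u
        unfolding w C_def
        by (rule evaluate_to_bar[where k = k2 and T = "\<lambda>c. cup_value ((q, True) # ?w) (prepend h c)"])
          (use u h q range in \<open>auto simp: V_def cup_value_linear prepend_linear to_bar_unit
            cup_value_prepend_pair carry_def coord_one coord_power_of coord_less\<close>)
      have C_0: "C h u = 0" if "coord h q = 0" for h u
      proof -
        have c: "carry q h (power_of q i) = 0" if "i < m q" for i
          using that \<open>coord h q = 0\<close> q by (simp add: carry_def coord_power_of)
        have c1: "carry q h (power_of q (Suc 0 mod m q)) = 0"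
          by (rule c) (use mq in simp)
        show ?thesis unfolding C_def c1 by (simp add: c)
      qed
      have "cup_value (word l n) (to_bar (Suc k1) v) = (if v q = 0 then 0 else koszul_sign q v *
          (if odd (v q) then C (power_of q (Suc 0 mod m q)) (lower q v)
           else (\<Sum>i<m q. C (power_of q i) (lower q v))))"
      proof (rule evaluate_to_bar[where k = k1])
        show "cup_value (word l n) (prepend h (to_bar k1 u)) = C h u"
          if "h \<in> carrier G" "u \<in> small_basis k1" for h u
          using inner[OF that[unfolded k2]] k2 by simp
      qed (use less.prems(2) k1 q in \<open>auto simp: cup_value_linear C_0 coord_one coord_power_of\<close>)
      moreover have V: "V (lower q (lower q v)) = (if ?l2 = lower q (lower q v) then 1 else 0)"
        if "2 \<le> v q"
      proof -
        have "lower q v \<in> small_basis k1"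
          using less.prems(2) k1 q(1) that by (auto intro: lower_in)
        then have "lower q (lower q v) \<in> small_basis k2"
          unfolding k2 using q(1) by (rule lower_in) (use that in \<open>simp add: lower_def\<close>)
        then show ?thesis
          unfolding V_def using k1 k2 by (intro less.IH l2 m2) auto
      qed
      moreover have ne: "?l2 \<noteq> lower q (lower q v)" if "l \<noteq> v" "2 \<le> v q"
        using that lq lower_inj[of q l v] lower_inj[of q "lower q l" "lower q v"]
        by (auto simp: lower_def)
      moreover have "C h (lower q v) = 0" if "l \<noteq> v" "0 < v q" for h
        using that V ne by (cases "2 \<le> v q") (auto simp: C_def lower_def)
      moreover have "(\<Sum>i<m q. C (power_of q i) (lower q v)) = 1" if "l = v"
      proof -
        \<comment> \<open>The second entry is the generator itself, so only the exponent \<open>m q - 1\<close> produces a carry.\<close>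
        have "C (power_of q i) (lower q v) = (if i = m q - 1 then 1 else 0)" if "i < m q" for i
        proof -
          have "odd (lower q v q)" "0 < lower q v q"
            using \<open>l = v\<close> lq even by (auto simp: lower_def)
          moreover have "koszul_sign q (lower q v) = 1"
            using koszul_sign_top[of q l, OF top] \<open>l = v\<close> by (simp add: koszul_sign_lower)
          moreover have "V (lower q (lower q v)) = 1"
            using V \<open>l = v\<close> lq by simp
          moreover have "Suc i div m q = (if i = m q - 1 then 1 else 0)"
            using that mq by (cases "Suc i < m q") (auto simp: le_Suc_eq not_less)
          ultimately show ?thesis
            using that mq q by (simp add: C_def carry_def coord_power_of)
        qed
        then show ?thesis using mq by simp
      qed
      moreover have "koszul_sign q v = 1" if "l = v"
        using koszul_sign_top[of q l, OF top] that by simp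
      ultimately show ?thesis
        using even q by (auto simp: k1)
    qed
  qed
qed

end

section \<open>Roots of unity\<close>

lemma primitive_root_nonzero: "d \<ge> 1 \<Longrightarrow> primitive_root_of_unity d z \<Longrightarrow> z \<noteq> (0 :: 'k :: field)"
  by (auto simp: primitive_root_of_unity_def power_0_left)

lemma primitive_root_powi_eq_1:
  assumes "d \<ge> 1" "primitive_root_of_unity d (z :: 'k :: field)" "z powi e = 1"
  shows "int d dvd e"
proof -
  have z: "z \<noteq> 0" "z ^ d = 1"
    using assms primitive_root_nonzero by (auto simp: primitive_root_of_unity_def)
  have "z powi e = z powi (int d * (e div int d) + e mod int d)"
    by simp
  also have "\<dots> = z powi (int d * (e div int d)) * z powi (e mod int d)"
    by (rule power_int_add) (simp add: z)
  also have "z powi (int d * (e div int d)) = 1"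
    using z by (simp add: power_int_mult)
  also have "1 * z powi (e mod int d) = z ^ nat (e mod int d)"
    using assms(1) by (simp add: power_int_def)
  finally have "z ^ nat (e mod int d) = 1" using assms(3) by simp
  moreover have "nat (e mod int d) < d"
    using assms(1) by (simp add: nat_less_iff)
  ultimately have "nat (e mod int d) = 0"
    using assms(2) unfolding primitive_root_of_unity_def by (metis gr0I)
  moreover have "0 \<le> e mod int d" using assms(1) by simp
  ultimately show ?thesis by (simp add: dvd_eq_mod_eq_0)
qed

text \<open>
  The powers of \<open>z\<close> already exhaust the at most \<open>d\<close> roots of \<open>X ^ d - 1\<close>.
\<close>

lemma primitive_root_generates:
  assumes "d \<ge> 1" "primitive_root_of_unity d (z :: 'k :: field)" "x ^ d = 1"
  shows "\<exists>i<d. x = z ^ i"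
proof -
  let ?p = "monom 1 d - 1 :: 'k poly"
  have root: "poly ?p y = 0 \<longleftrightarrow> y ^ d = 1" for y
    by (simp add: poly_monom)
  have p: "?p \<noteq> 0"
  proof
    assume "?p = 0"
    then have "coeff ?p d = 0" by simp
    then show False using assms(1) by (simp add: coeff_1)
  qed
  have "degree ?p \<le> d"
    by (rule degree_diff_le) (auto simp: degree_monom_le)
  moreover have inj: "inj_on (\<lambda>i. z ^ i) {..<d}"
  proof (rule inj_onI)
    fix i j assume ij: "i \<in> {..<d}" "j \<in> {..<d}" "z ^ i = z ^ j"
    have "z powi (int i - int j) = 1"
      using ij(3) primitive_root_nonzero[OF assms(1,2)] by (simp add: power_int_diff)
    then have "int d dvd int i - int j"
      by (rule primitive_root_powi_eq_1[OF assms(1,2)])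
    then show "i = j"
      using ij(1,2) zdvd_imp_le[of "int d" "int i - int j"] zdvd_imp_le[of "int d" "int j - int i"]
      by (cases i j rule: linorder_cases) (auto simp: dvd_diff_commute)
  qed
  moreover have "(\<lambda>i. z ^ i) ` {..<d} \<subseteq> {y. poly ?p y = 0}"
  proof clarify
    fix i
    have "(z ^ i) ^ d = (z ^ d) ^ i" by (simp only: power_mult[symmetric] mult.commute)
    then show "poly ?p (z ^ i) = 0"
      using assms(2) by (simp add: poly_monom primitive_root_of_unity_def)
  qed
  moreover have "card {y. poly ?p y = 0} \<le> degree ?p" "finite {y. poly ?p y = 0}"
    using card_poly_roots_bound[OF p] poly_roots_finite[OF p] by blast+
  ultimately have "(\<lambda>i. z ^ i) ` {..<d} = {y. poly ?p y = 0}"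
    by (intro card_seteq) (auto simp: card_image)
  then show ?thesis using assms(3) root by (auto simp: image_iff set_eq_iff)
qed

section \<open>Classification of cocycles up to coboundaries\<close>

locale divisible_coordinates = cyclic_coordinates G n m coord
  for G (structure) and n m coord +
  fixes \<zeta> :: "nat \<Rightarrow> 'k :: alg_closed_field"
  assumes m_dvd: "1 \<le> r \<Longrightarrow> r \<le> q \<Longrightarrow> q \<le> n \<Longrightarrow> m r dvd m q"
    and primitive: "d \<ge> 1 \<Longrightarrow> primitive_root_of_unity d (\<zeta> d)"
begin

definition lowest :: "(nat \<Rightarrow> nat) \<Rightarrow> nat" where
  "lowest l = (LEAST j. j \<in> {1..n} \<and> 0 < l j)"

text \<open>
  The multidegrees that carry a parameter.
\<close>

definition odd_basis :: "nat \<Rightarrow> (nat \<Rightarrow> nat) set" where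
  "odd_basis k = {l \<in> small_basis k. odd (l (lowest l))}"

lemma lowest_in:
  assumes "l \<in> small_basis k" "1 \<le> k"
  shows "lowest l \<in> {1..n}" "0 < l (lowest l)"
proof -
  have "\<exists>j. j \<in> {1..n} \<and> 0 < l j"
  proof (rule ccontr)
    assume "\<not> ?thesis"
    then have "(\<Sum>j\<in>{1..n}. l j) = 0" by auto
    then show False using assms by (simp add: small_basis_def)
  qed
  then show "lowest l \<in> {1..n}" "0 < l (lowest l)"
    using LeastI_ex[of "\<lambda>j. j \<in> {1..n} \<and> 0 < l j"] by (auto simp: lowest_def)
qed

lemma lowest_le: "r \<in> {1..n} \<Longrightarrow> 0 < l r \<Longrightarrow> lowest l \<le> r"
  unfolding lowest_def by (rule Least_le) auto

lemma lowest_eqI: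
  "p \<in> {1..n} \<Longrightarrow> 0 < l p \<Longrightarrow> (\<And>j. j \<in> {1..n} \<Longrightarrow> 0 < l j \<Longrightarrow> p \<le> j) \<Longrightarrow> lowest l = p"
  unfolding lowest_def by (rule Least_equality) auto

lemma finite_small_basis: "finite (small_basis k)"
proof (rule finite_subset)
  show "small_basis k \<subseteq> {l. \<forall>j. (j \<in> {1..n} \<longrightarrow> l j \<in> {..k}) \<and> (j \<notin> {1..n} \<longrightarrow> l j = 0)}"
    using member_le_sum[of _ "{1..n}"] by (auto simp: small_basis_def multidegrees_def)
  show "finite {l. \<forall>j. (j \<in> {1..n} \<longrightarrow> l j \<in> {..k}) \<and> (j \<notin> {1..n} \<longrightarrow> l j = 0)}"
    by (rule finite_set_of_finite_funs) auto
qed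

lemma finite_odd_basis: "finite (odd_basis k)"
  by (rule finite_subset[OF _ finite_small_basis[of k]]) (auto simp: odd_basis_def)

lemma m_lowest_dvd:
  assumes "l \<in> small_basis k" "1 \<le> k" "r \<in> {1..n}" "0 < l r"
  shows "m (lowest l) dvd m r"
  using lowest_in[OF assms(1,2)] lowest_le[of r l] assms(3,4) by (intro m_dvd) auto

lemma zeta_nonzero: "d \<ge> 1 \<Longrightarrow> \<zeta> d \<noteq> 0"
  using primitive primitive_root_nonzero by blast

lemma zeta_dvd: "d \<ge> 1 \<Longrightarrow> int d dvd e \<Longrightarrow> \<zeta> d powi e = 1"
  using primitive[of d] by (auto simp: power_int_mult primitive_root_of_unity_def)

lemma zeta_1: "\<zeta> (Suc 0) = 1"
  using primitive[of 1] by (simp add: primitive_root_of_unity_def)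

definition omega :: "nat \<Rightarrow> ((nat \<Rightarrow> nat) \<Rightarrow> int) \<Rightarrow> (('a \<times> 'a list) \<Rightarrow>\<^sub>0 int) \<Rightarrow> 'k" where
  "omega k b c = (\<Prod>l\<in>odd_basis k. \<zeta> (m (lowest l)) powi (b l * cup_value (word l n) c))"

lemma m_lowest_pos: "l \<in> odd_basis k \<Longrightarrow> 1 \<le> k \<Longrightarrow> 1 \<le> m (lowest l)"
  using lowest_in[of l k] m_pos[of "lowest l"] by (auto simp: odd_basis_def)

lemma zeta_lowest_nonzero: "l \<in> odd_basis k \<Longrightarrow> 1 \<le> k \<Longrightarrow> \<zeta> (m (lowest l)) \<noteq> 0"
  by (intro zeta_nonzero m_lowest_pos)

lemma omega_nonzero: "1 \<le> k \<Longrightarrow> omega k b c \<noteq> 0"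
  by (simp add: omega_def finite_odd_basis power_int_eq_0_iff zeta_lowest_nonzero)

lemma omega_add: "1 \<le> k \<Longrightarrow> omega k b (c + c') = omega k b c * omega k b c'"
  unfolding omega_def prod.distrib[symmetric]
  by (rule prod.cong)
    (auto simp: cup_value_linear distrib_left power_int_add zeta_lowest_nonzero)

lemma omega_cochain: "1 \<le> k \<Longrightarrow> restrict (omega k b) (free_chains G (bar_basis G k)) \<in> bar_cochains G k"
  by (rule cochainI) (auto simp: omega_nonzero omega_add, simp add: omega_def)

lemma omega_parameters:
  assumes "1 \<le> k"
  shows "omega k (\<lambda>l. b l - b' l) c = omega k b c / omega k b' c"
  unfolding omega_def prod_dividef[symmetric]
  by (rule prod.cong)
    (use assms in \<open>auto simp: left_diff_distrib power_int_diff zeta_lowest_nonzero\<close>)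

lemma omega_cong_mod:
  assumes "1 \<le> k" "\<And>l. l \<in> odd_basis k \<Longrightarrow> int (m (lowest l)) dvd b l - b' l"
  shows "omega k b c = omega k b' c"
proof -
  have "omega k (\<lambda>l. b l - b' l) c = 1"
    unfolding omega_def
    by (rule prod.neutral) (use assms in \<open>auto intro!: zeta_dvd m_lowest_pos\<close>)
  then show ?thesis
    using omega_parameters[OF assms(1), of b b' c] omega_nonzero[OF assms(1), of b' c] by simp
qed

lemma omega_cocycle:
  assumes "1 \<le> k" "c \<in> free_chains G (bar_basis G (Suc k))"
  shows "omega k b (bar.bd c) = 1"
  unfolding omega_def
proof (rule prod.neutral, rule ballI)
  fix l assume l: "l \<in> odd_basis k"
  then have l': "l \<in> small_basis k" by (simp add: odd_basis_def)
  have "int (m (lowest l)) dvd cup_value (word l n) (bar.bd c)"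
    by (rule cup_value_boundary[OF word_in_range _ assms(2)])
      (use word_letters m_lowest_dvd[OF l' assms(1)] in blast)
  then show "\<zeta> (m (lowest l)) powi (b l * cup_value (word l n) (bar.bd c)) = 1"
    using m_lowest_pos[OF l assms(1)] by (intro zeta_dvd) auto
qed

text \<open>
  The duality of cup products and multidegrees requires nontrivial factors on the support of \<open>l\<close>.  By
  divisibility these are guaranteed unless \<open>m (lowest l) = 1\<close>, and then the root of unity is \<open>1\<close>.
\<close>

lemma omega_to_bar:
  assumes "1 \<le> k" "v \<in> small_basis k"
  shows "omega k b (to_bar k v) = (if v \<in> odd_basis k then \<zeta> (m (lowest v)) powi b v else 1)"
proof -
  have "\<zeta> (m (lowest l)) powi (b l * cup_value (word l n) (to_bar k v)) =
      (if l = v then \<zeta> (m (lowest v)) powi b v else 1)" if l: "l \<in> odd_basis k" for l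
  proof (cases "m (lowest l) = 1")
    case True
    then show ?thesis by (auto simp: zeta_1)
  next
    case False
    have l': "l \<in> small_basis k" using l by (simp add: odd_basis_def)
    have "1 < m r" if "r \<in> {1..n}" "0 < l r" for r
    proof -
      have "m r \<noteq> 1" using m_lowest_dvd[OF l' assms(1) that] False by auto
      then show ?thesis using m_pos[OF that(1)] by simp
    qed
    then show ?thesis
      using cup_value_to_bar[OF l' assms(2)] by simp
  qed
  then have "omega k b (to_bar k v) =
      (\<Prod>l\<in>odd_basis k. if l = v then \<zeta> (m (lowest v)) powi b v else 1)"
    unfolding omega_def by (intro prod.cong) auto
  also have "\<dots> = (if v \<in> odd_basis k then \<zeta> (m (lowest v)) powi b v else 1)"
    by (simp add: prod.delta finite_odd_basis)
  finally show ?thesis .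
qed

subsection \<open>The small complex with multiplicative coefficients\<close>

lemma lowest_lower:
  assumes "l \<in> small_basis k" "1 \<le> k" "even (l (lowest l))" "r \<in> {1..n}" "even (l r)" "0 < l r"
  shows "lowest (lower r l) = lowest l" "r \<noteq> lowest l \<Longrightarrow> lower r l (lowest l) = l (lowest l)"
proof -
  note low = lowest_in[OF assms(1,2)]
  have "2 \<le> l (lowest l)" using low(2) assms(3) by (cases "l (lowest l) = 1") auto
  then show "lowest (lower r l) = lowest l"
    using low(1) lowest_le by (intro lowest_eqI) (auto simp: lower_def split: if_splits)
  show "r \<noteq> lowest l \<Longrightarrow> lower r l (lowest l) = l (lowest l)"
    by (simp add: lower_def)
qed

text \<open>
  In a boundary of a multidegree whose lowest component is even, every term but that of the lowest
  factor again has an even lowest component.  A function that is trivial on those is therefore seen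
  by the boundary only through the lowest factor.
\<close>

lemma mult_ext_lowest:
  fixes \<phi> :: "(nat \<Rightarrow> nat) \<Rightarrow> 'k"
  assumes \<phi>: "\<And>v. \<phi> v \<noteq> 0"
    and trivial: "\<And>v. v \<in> small_basis k \<Longrightarrow> 0 < v (lowest v) \<Longrightarrow> even (v (lowest v)) \<Longrightarrow> \<phi> v = 1"
    and l: "l \<in> small_basis (Suc k)" "even (l (lowest l))"
  shows "mult_ext \<phi> (\<Sum>r\<in>{1..n}. if even (l r) \<and> 0 < l r
      then frag_cmul (e r) (frag_of (lower r l)) else 0) = \<phi> (lower (lowest l) l) powi e (lowest l)"
proof -
  let ?p = "lowest l"
  have p: "?p \<in> {1..n}" "0 < l ?p" using lowest_in[OF l(1)] by auto
  have "mult_ext \<phi> (\<Sum>r\<in>{1..n}. if even (l r) \<and> 0 < l r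
      then frag_cmul (e r) (frag_of (lower r l)) else 0) =
      (\<Prod>r\<in>{1..n}. if r = ?p then \<phi> (lower ?p l) powi e ?p else 1)"
    unfolding mult_ext_sum[of \<phi>, OF \<phi>]
  proof (rule prod.cong[OF refl])
    fix r assume r: "r \<in> {1..n}"
    show "mult_ext \<phi> (if even (l r) \<and> 0 < l r then frag_cmul (e r) (frag_of (lower r l)) else 0) =
        (if r = ?p then \<phi> (lower ?p l) powi e ?p else 1)"
    proof (cases "r = ?p \<or> \<not> (even (l r) \<and> 0 < l r)")
      case True
      then show ?thesis using p l by (auto simp: mult_ext_cmul)
    next
      case False
      then have "lowest (lower r l) = ?p" "lower r l ?p = l ?p"
        using lowest_lower[OF l(1) _ l(2) r] by auto
      then have "\<phi> (lower r l) = 1"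
        using False p l r by (intro trivial lower_in) auto
      then show ?thesis using False by (simp add: mult_ext_cmul)
    qed
  qed
  also have "\<dots> = \<phi> (lower ?p l) powi e ?p" using p by simp
  finally show ?thesis .
qed

lemma reduced_d_lower: "reduced_d l = (\<Sum>r\<in>{1..n}. if even (l r) \<and> 0 < l r
    then frag_cmul (koszul_sign r l * int (m r)) (frag_of (lower r l)) else 0)"
  unfolding reduced_d_def lower_def ..

definition raise :: "(nat \<Rightarrow> nat) \<Rightarrow> (nat \<Rightarrow> nat)" where
  "raise l = l(lowest l := Suc (l (lowest l)))"

lemma raise:
  assumes "l \<in> small_basis k" "1 \<le> k"
  shows "raise l \<in> small_basis (Suc k)" "lowest (raise l) = lowest l"
    "raise l (lowest l) = Suc (l (lowest l))" "lower (lowest l) (raise l) = l"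
proof -
  note low = lowest_in[OF assms]
  show "raise l \<in> small_basis (Suc k)"
    using assms(1) low(1) by (auto simp: small_basis_def multidegrees_def raise_def
      sum.remove[of _ "lowest l"])
  show "lowest (raise l) = lowest l"
    using low(1) lowest_le by (intro lowest_eqI) (auto simp: raise_def split: if_splits)
qed (auto simp: raise_def lower_def)

lemma koszul_sign_cases: "koszul_sign r l = 1 \<or> koszul_sign r l = -1"
  unfolding koszul_sign_def using neg_one_even_power neg_one_odd_power by metis

lemma exists_root: "0 < d \<Longrightarrow> \<exists>y :: 'k. y ^ d = x"
  by (rule nth_root_exists)

text \<open>
  Since \<open>m (lowest l)\<close>-th roots exist, a coboundary removes the values on multidegrees with even
  lowest component.  For odd lowest component the cocycle condition one degree up then says that
  the remaining value is a root of unity of order dividing \<open>m (lowest l)\<close>.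
\<close>

lemma normal_form_exists:
  fixes F :: "(nat \<Rightarrow> nat) \<Rightarrow> 'k"
  assumes F: "\<And>l. F l \<noteq> 0" and k: "1 \<le> k"
    and cocycle: "\<And>l. l \<in> small_basis (Suc k) \<Longrightarrow> mult_ext F (reduced_d l) = 1"
  shows "\<exists>h b. (\<forall>l. h l \<noteq> 0) \<and>
    (\<forall>l\<in>small_basis k. F l = (if l \<in> odd_basis k then \<zeta> (m (lowest l)) powi b l else 1) *
      mult_ext h (reduced_d l))"
proof -
  obtain k' where k': "k = Suc k'" using k by (cases k) auto
  \<comment> \<open>The cochain \<open>h\<close> is trivial where the lowest component is even, so that its coboundary can be
    prescribed independently on each multidegree whose lowest component is even.\<close>
  have "\<exists>y. y \<noteq> 0 \<and> (v \<in> small_basis k' \<longrightarrow> 0 < v (lowest v) \<longrightarrow>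
      (if odd (v (lowest v)) then lowest v \<in> {1..n} \<longrightarrow>
        y ^ m (lowest v) = F (raise v) powi koszul_sign (lowest v) (raise v) else y = 1))" for v
  proof (cases "odd (v (lowest v)) \<and> lowest v \<in> {1..n}")
    case True
    obtain y where y: "y ^ m (lowest v) = F (raise v) powi koszul_sign (lowest v) (raise v)"
      using exists_root[OF m_pos] True by blast
    then have "y \<noteq> 0"
      using F m_pos[of "lowest v"] True by (auto simp: power_int_eq_0_iff power_0_left)
    then show ?thesis using y True by (intro exI[of _ y]) auto
  qed (auto intro: exI[of _ 1])
  then obtain h where h0: "h v \<noteq> 0" and h: "v \<in> small_basis k' \<Longrightarrow> 0 < v (lowest v) \<Longrightarrow>
      (if odd (v (lowest v)) then lowest v \<in> {1..n} \<longrightarrow>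
        h v ^ m (lowest v) = F (raise v) powi koszul_sign (lowest v) (raise v) else h v = 1)" for v
    by metis
  define F' where "F' l = F l / mult_ext h (reduced_d l)" for l
  have F': "F' l \<noteq> 0" for l
    by (simp add: F'_def F mult_ext_nonzero h0)
  have even: "F' l = 1" if l: "l \<in> small_basis k" "even (l (lowest l))" for l
  proof -
    let ?p = "lowest l" and ?v = "lower (lowest l) l"
    have p: "?p \<in> {1..n}" "0 < l ?p" using lowest_in[OF l(1) k] by auto
    have "2 \<le> l ?p" using p(2) l(2) by (cases "l ?p = 1") auto
    then have v: "lowest ?v = ?p" "odd (?v ?p)" "0 < ?v ?p" "raise ?v = l"
      using lowest_lower(1)[OF l(1) k l(2) p(1) l(2) p(2)] l(2)
      by (auto simp: lower_def raise_def)
    have "?v \<in> small_basis k'" using l p by (auto simp: k' intro: lower_in)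
    then have hv: "h ?v ^ m ?p = F l powi koszul_sign ?p l"
      using h[of ?v] v p by auto
    have "mult_ext h (reduced_d l) = h ?v powi (koszul_sign ?p l * int (m ?p))"
      unfolding reduced_d_lower
      by (rule mult_ext_lowest[where k = k']) (use h0 h l k' in \<open>auto split: if_splits\<close>)
    also have "\<dots> = (h ?v ^ m ?p) powi koszul_sign ?p l"
      by (simp add: power_int_mult mult.commute[of "koszul_sign _ _"])
    also have "\<dots> = F l"
      using koszul_sign_cases[of ?p l] by (auto simp: hv power_int_minus)
    finally show ?thesis using F by (simp add: F'_def)
  qed
  have "\<exists>b. F' l = \<zeta> (m (lowest l)) powi b" if l: "l \<in> odd_basis k" for l
  proof -
    let ?p = "lowest l" and ?u = "raise l"
    have l': "l \<in> small_basis k" "odd (l ?p)" using l by (auto simp: odd_basis_def)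
    note u = raise[OF l'(1) k]
    have "mult_ext F' (reduced_d ?u) = mult_ext F (reduced_d ?u) /
        mult_ext (\<lambda>l. mult_ext h (reduced_d l)) (reduced_d ?u)"
      by (simp add: F'_def mult_ext_def power_int_divide_distrib prod_dividef)
    also have "mult_ext (\<lambda>l. mult_ext h (reduced_d l)) (reduced_d ?u) =
        mult_ext h (frag_extend reduced_d (reduced_d ?u))"
      by (simp add: mult_ext_extend h0)
    also have "\<dots> = 1"
      using reduced_d_d[of ?u k'] u(1) k' by simp
    finally have "mult_ext F' (reduced_d ?u) = 1"
      using cocycle[OF u(1)] by simp
    moreover have "mult_ext F' (reduced_d ?u) = F' l powi (koszul_sign ?p ?u * int (m ?p))"
      unfolding reduced_d_lower
      using mult_ext_lowest[of F' k ?u "\<lambda>r. koszul_sign r ?u * int (m r)"] F' even u l'(2) by simp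
    moreover have "F' l powi (koszul_sign ?p ?u * int (m ?p)) = (F' l ^ m ?p) powi koszul_sign ?p ?u"
      by (simp add: power_int_mult mult.commute[of "koszul_sign _ _"])
    ultimately have "F' l ^ m ?p = 1"
      using koszul_sign_cases[of ?p ?u] by (auto simp: power_int_minus)
    then obtain i where "i < m ?p" "F' l = \<zeta> (m ?p) ^ i"
      using primitive_root_generates[OF _ primitive] m_lowest_pos[OF l k] by blast
    then show ?thesis by (intro exI[of _ "int i"]) simp
  qed
  then obtain b where b: "l \<in> odd_basis k \<Longrightarrow> F' l = \<zeta> (m (lowest l)) powi b l" for l
    by metis
  have "F l = (if l \<in> odd_basis k then \<zeta> (m (lowest l)) powi b l else 1) * mult_ext h (reduced_d l)"
    if l: "l \<in> small_basis k" for l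
  proof -
    have "F' l = (if l \<in> odd_basis k then \<zeta> (m (lowest l)) powi b l else 1)"
      using b[of l] even[OF l] l by (auto simp: odd_basis_def)
    moreover have "F l = F' l * mult_ext h (reduced_d l)"
      by (simp add: F'_def mult_ext_nonzero h0)
    ultimately show ?thesis by simp
  qed
  then show ?thesis
    by (intro exI[of _ h] exI[of _ b] conjI ballI allI) (auto simp: h0 b)
qed

text \<open>
  The boundary of \<open>raise l\<close> is divisible by \<open>m (lowest l)\<close>, and the quotient is a cycle because
  the complex is torsion free.  Coboundaries are trivial on that cycle, where a function in normal
  form takes its value at \<open>l\<close>.
\<close>

lemma normal_form_unique:
  fixes h :: "(nat \<Rightarrow> nat) \<Rightarrow> 'k"
  assumes h: "\<And>l. h l \<noteq> 0" and k: "1 \<le> k"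
    and even: "\<And>l. l \<in> small_basis k \<Longrightarrow> even (l (lowest l)) \<Longrightarrow> mult_ext h (reduced_d l) = 1"
    and l: "l \<in> odd_basis k"
  shows "mult_ext h (reduced_d l) = 1"
proof -
  let ?p = "lowest l" and ?u = "raise l" and ?F = "\<lambda>l. mult_ext h (reduced_d l)"
  have l': "l \<in> small_basis k" "odd (l ?p)" using l by (auto simp: odd_basis_def)
  obtain k' where k': "k = Suc k'" using k by (cases k) auto
  note u = raise[OF l'(1) k]
  define z where "z = (\<Sum>r\<in>{1..n}. if even (?u r) \<and> 0 < ?u r
    then frag_cmul (koszul_sign r ?u * int (m r div m ?p)) (frag_of (lower r ?u)) else 0)"
  have "frag_cmul (int (m ?p)) z = reduced_d ?u"
    unfolding z_def reduced_d_lower frag_cmul_sum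
  proof (rule sum.cong[OF refl])
    fix r assume r: "r \<in> {1..n}"
    have "int (m ?p) * int (m r div m ?p) = int (m r)" if "0 < ?u r"
      using m_lowest_dvd[OF u(1) _ r that] u(2) by (simp flip: of_nat_mult)
    then show "frag_cmul (int (m ?p)) (if even (?u r) \<and> 0 < ?u r
        then frag_cmul (koszul_sign r ?u * int (m r div m ?p)) (frag_of (lower r ?u)) else 0) =
        (if even (?u r) \<and> 0 < ?u r
        then frag_cmul (koszul_sign r ?u * int (m r)) (frag_of (lower r ?u)) else 0)"
      by (auto simp: mult.left_commute[of "int (m (lowest l))"])
  qed
  then have "frag_cmul (int (m ?p)) (frag_extend reduced_d z) = 0"
    using reduced_d_d[of ?u k'] u(1) k' by (simp flip: frag_extend_cmul)
  then have "frag_extend reduced_d z = 0"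
    using m_lowest_pos[OF l k] by simp
  then have "mult_ext ?F z = 1"
    using mult_ext_extend[of h reduced_d z] h by simp
  moreover have "mult_ext ?F z = ?F l powi (koszul_sign ?p ?u * int (m ?p div m ?p))"
    unfolding z_def
    using mult_ext_lowest[of ?F k ?u "\<lambda>r. koszul_sign r ?u * int (m r div m ?p)"] even u l'(2) h
    by (simp add: mult_ext_nonzero)
  moreover have "m ?p div m ?p = 1" using m_lowest_pos[OF l k] by simp
  ultimately show ?thesis
    using koszul_sign_cases[of ?p ?u] by (auto simp: power_int_minus)
qed

text \<open>
  The normal form of the restriction of \<open>f\<close> supplies the parameters; dividing by the corresponding
  \<open>omega\<close> leaves a cocycle whose restriction is a coboundary.
\<close>

theorem cocycle_representative:
  assumes f: "(f :: (('a \<times> 'a list) \<Rightarrow>\<^sub>0 int) \<Rightarrow> 'k) \<in> bar_cochains G k" and k: "1 \<le> k"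
    and cocycle: "\<And>c. c \<in> free_chains G (bar_basis G (Suc k)) \<Longrightarrow> f (bar.bd c) = 1"
  shows "\<exists>b. \<exists>u\<in>bar_cochains G (k - 1). \<forall>c\<in>free_chains G (bar_basis G k).
    f c = omega k b c * u (bar.bd c)"
proof -
  obtain k' where k': "k = Suc k'" using k by (cases k) auto
  obtain h b where h: "\<And>l. h l \<noteq> 0"
    and F: "\<And>l. l \<in> small_basis k \<Longrightarrow> pullback f k l =
      (if l \<in> odd_basis k then \<zeta> (m (lowest l)) powi b l else 1) * mult_ext h (reduced_d l)"
    using normal_form_exists[of "pullback f k" k, OF pullback_nonzero[OF f] k
      pullback_cocycle[OF f _ cocycle]] by blast
  let ?C = "free_chains G (bar_basis G k)"
  define f' where "f' c = f c / omega k b c" for c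
  have "restrict f' ?C \<in> bar_cochains G k"
  proof (rule cochainI)
    show "f' (act G g c) = f' c" if "g \<in> carrier G" "c \<in> ?C" for g c
      using cochain_act[OF f that] by (simp add: f'_def omega_def)
  qed (auto simp: f'_def omega_nonzero[OF k] omega_add[OF k] cochain_add[OF f] cochain_nonzero[OF f])
  moreover have "restrict f' ?C (bar.bd c) = 1" if "c \<in> free_chains G (bar_basis G (Suc k))" for c
    using cocycle[OF that] omega_cocycle[OF k that] bar.bd_in[OF that] by (simp add: f'_def)
  moreover have "pullback (restrict f' ?C) k l = mult_ext h (reduced_d l)" if l: "l \<in> small_basis k" for l
  proof -
    have "\<zeta> (m (lowest l)) powi b l \<noteq> 0" if "l \<in> odd_basis k"
      using zeta_nonzero[OF m_lowest_pos[OF that k]] by (simp add: power_int_eq_0_iff)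
    then show ?thesis
      using F[OF l] l to_bar_in[OF l] by (auto simp: pullback_def f'_def omega_to_bar[OF k l])
  qed
  ultimately obtain u where u: "u \<in> bar_cochains G k'"
      "\<forall>c\<in>?C. restrict f' ?C c = u (bar.bd c)"
    using coboundary_if_pullback[of "restrict f' ?C" k' h] h unfolding k' by blast
  have "f c = omega k b c * u (bar.bd c)" if "c \<in> ?C" for c
    using u(2) that omega_nonzero[OF k, of b c] by (auto simp: f'_def field_simps)
  then show ?thesis using u(1) k' by auto
qed

text \<open>
  The restriction of \<open>u\<close> to the small resolution has as coboundary the quotient of the two normal
  forms, which must be trivial by \<open>normal_form_unique\<close>.
\<close>

theorem parameters_unique:
  assumes k: "1 \<le> k" and u: "(u :: (('a \<times> 'a list) \<Rightarrow>\<^sub>0 int) \<Rightarrow> 'k) \<in> bar_cochains G (k - 1)"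
    and eq: "\<And>c. c \<in> free_chains G (bar_basis G k) \<Longrightarrow> omega k b c = omega k b' c * u (bar.bd c)"
    and l: "l \<in> odd_basis k"
  shows "int (m (lowest l)) dvd b l - b' l"
proof -
  obtain k' where k': "k = Suc k'" using k by (cases k) auto
  have u': "u \<in> bar_cochains G k'" using u k' by simp
  let ?F = "\<lambda>v. mult_ext (pullback u k') (reduced_d v)"
  have F: "?F v = (if v \<in> odd_basis k then \<zeta> (m (lowest v)) powi (b v - b' v) else 1)"
    if v: "v \<in> small_basis k" for v
  proof -
    have "?F v = u (bar.bd (to_bar k v))"
      using pullback_coboundary[OF u', of v] v k' by simp
    also have "\<dots> = omega k (\<lambda>l. b l - b' l) (to_bar k v)"
      using eq[OF to_bar_in[OF v]] omega_nonzero[OF k, of b'] by (simp add: omega_parameters[OF k])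
    finally show ?thesis by (simp add: omega_to_bar[OF k v])
  qed
  have "?F l = 1"
  proof (rule normal_form_unique[OF _ k _ l])
    show "?F v = 1" if "v \<in> small_basis k" "even (v (lowest v))" for v
      using F[OF that(1)] that(2) by (simp add: odd_basis_def)
  qed (rule pullback_nonzero[OF u'])
  then have "\<zeta> (m (lowest l)) powi (b l - b' l) = 1"
    using F[of l] l by (simp add: odd_basis_def)
  then show ?thesis
    using m_lowest_pos[OF l k] by (intro primitive_root_powi_eq_1[OF _ primitive]) auto
qed

end

section \<open>The explicit exponents as cup products\<close>

text \<open>
  The product in \<open>eta\<close> lists the pairs from the highest position downwards, whereas a word is read
  from the first position on; the two lemmas below reverse the order.
\<close>

lemma eta_even:
  assumes "0 < j"
  shows "eta m \<alpha> r 1 (2 * j) = (\<Prod>i<j. (\<alpha> (2 * i + 2) r + \<alpha> (2 * i + 1) r) div m r)"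
proof -
  have "eta m \<alpha> r 1 (2 * j) = (\<Prod>i<j. (\<alpha> (2 * j - 2 * i) r + \<alpha> (2 * j - 2 * i - 1) r) div m r)"
    using assms by (simp add: eta_def)
  also have "\<dots> = (\<Prod>i<j. (\<alpha> (2 * (j - Suc i) + 2) r + \<alpha> (2 * (j - Suc i) + 1) r) div m r)"
  proof (rule prod.cong[OF refl])
    fix i assume "i \<in> {..<j}"
    then have "2 * j - 2 * i = 2 * (j - Suc i) + 2" by auto
    then show "(\<alpha> (2 * j - 2 * i) r + \<alpha> (2 * j - 2 * i - 1) r) div m r =
        (\<alpha> (2 * (j - Suc i) + 2) r + \<alpha> (2 * (j - Suc i) + 1) r) div m r"
      by simp
  qed
  also have "\<dots> = (\<Prod>i<j. (\<alpha> (2 * i + 2) r + \<alpha> (2 * i + 1) r) div m r)"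
    by (rule prod.nat_diff_reindex)
  finally show ?thesis .
qed

lemma eta_odd:
  "eta m \<alpha> r 1 (2 * j + 1) = (\<Prod>i<j. (\<alpha> (2 * i + 3) r + \<alpha> (2 * i + 2) r) div m r) * \<alpha> 1 r"
proof -
  have "eta m \<alpha> r 1 (2 * j + 1) =
      (\<Prod>i<j. (\<alpha> (2 * j + 1 - 2 * i) r + \<alpha> (2 * j - 2 * i) r) div m r) * \<alpha> 1 r"
    by (simp add: eta_def)
  also have "(\<Prod>i<j. (\<alpha> (2 * j + 1 - 2 * i) r + \<alpha> (2 * j - 2 * i) r) div m r) =
      (\<Prod>i<j. (\<alpha> (2 * (j - Suc i) + 3) r + \<alpha> (2 * (j - Suc i) + 2) r) div m r)"
  proof (rule prod.cong[OF refl])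
    fix i assume "i \<in> {..<j}"
    then have "2 * j + 1 - 2 * i = 2 * (j - Suc i) + 3" "2 * j - 2 * i = 2 * (j - Suc i) + 2" by auto
    then show "(\<alpha> (2 * j + 1 - 2 * i) r + \<alpha> (2 * j - 2 * i) r) div m r =
        (\<alpha> (2 * (j - Suc i) + 3) r + \<alpha> (2 * (j - Suc i) + 2) r) div m r"
      by simp
  qed
  also have "\<dots> = (\<Prod>i<j. (\<alpha> (2 * i + 3) r + \<alpha> (2 * i + 2) r) div m r)"
    by (rule prod.nat_diff_reindex)
  finally show ?thesis .
qed

lemma eta_cong:
  assumes "a \<le> b" "\<And>u. a \<le> u \<Longrightarrow> u \<le> b \<Longrightarrow> \<alpha> u r = \<beta> u r"
  shows "eta m \<alpha> r a b = eta m \<beta> r a b"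
proof -
  have eq: "\<alpha> (b - 2 * i) r = \<beta> (b - 2 * i) r" "\<alpha> (b - 2 * i - 1) r = \<beta> (b - 2 * i - 1) r"
    if "i \<in> {..<(b - a + 1) div 2}" for i
    using that assms(1) by (auto intro!: assms(2))
  have "{..<(b - a) div 2} \<subseteq> {..<(b - a + 1) div 2}" by auto
  note eq' = eq[OF subsetD[OF this]]
  have "(\<Prod>i<(b - a + 1) div 2. (\<alpha> (b - 2 * i) r + \<alpha> (b - 2 * i - 1) r) div m r) =
      (\<Prod>i<(b - a + 1) div 2. (\<beta> (b - 2 * i) r + \<beta> (b - 2 * i - 1) r) div m r)"
    by (rule prod.cong[OF refl]) (simp only: eq)
  moreover have "(\<Prod>i<(b - a) div 2. (\<alpha> (b - 2 * i) r + \<alpha> (b - 2 * i - 1) r) div m r) =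
      (\<Prod>i<(b - a) div 2. (\<beta> (b - 2 * i) r + \<beta> (b - 2 * i - 1) r) div m r)"
    by (rule prod.cong[OF refl]) (simp only: eq')
  moreover have "\<alpha> a r = \<beta> a r" using assms(1) by (intro assms(2)) auto
  ultimately show ?thesis by (simp only: eta_def)
qed

lemma eta_shift:
  assumes "1 \<le> a" "a \<le> b"
  shows "eta m (\<lambda>u. \<alpha> (u + x)) r a b = eta m \<alpha> r (a + x) (b + x)"
proof -
  have eq: "b - 2 * i + x = b + x - 2 * i" "b - 2 * i - 1 + x = b + x - 2 * i - 1"
    if "i \<in> {..<(b - a + 1) div 2}" for i
    using that assms by auto
  have "{..<(b - a) div 2} \<subseteq> {..<(b - a + 1) div 2}" by auto
  note eq' = eq[OF subsetD[OF this]]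
  have "(\<Prod>i<(b - a + 1) div 2. (\<alpha> (b - 2 * i + x) r + \<alpha> (b - 2 * i - 1 + x) r) div m r) =
      (\<Prod>i<(b - a + 1) div 2. (\<alpha> (b + x - 2 * i) r + \<alpha> (b + x - 2 * i - 1) r) div m r)"
    by (rule prod.cong[OF refl]) (simp only: eq)
  moreover have "(\<Prod>i<(b - a) div 2. (\<alpha> (b - 2 * i + x) r + \<alpha> (b - 2 * i - 1 + x) r) div m r) =
      (\<Prod>i<(b - a) div 2. (\<alpha> (b + x - 2 * i) r + \<alpha> (b + x - 2 * i - 1) r) div m r)"
    by (rule prod.cong[OF refl]) (simp only: eq')
  moreover have "b + x - (a + x) = b - a" by simp
  ultimately show ?thesis by (simp only: eta_def)
qed

context cyclic_coordinates
begin

text \<open>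
  Positions in a symbol are counted from one.
\<close>

definition exponents :: "'a list \<Rightarrow> nat \<Rightarrow> nat \<Rightarrow> nat" where
  "exponents hs u = coord (hs ! (u - 1))"

lemma exponents_drop:
  "1 \<le> u \<Longrightarrow> x \<le> length hs \<Longrightarrow> exponents (drop x hs) u = exponents hs (u + x)"
  by (simp add: exponents_def add.commute)

lemma cup_pairs:
  "2 * j \<le> length hs \<Longrightarrow> cup (replicate j (r, True) @ w) hs =
    (\<Prod>i<j. int (carry r (hs ! (2 * i)) (hs ! (2 * i + 1)))) * cup w (drop (2 * j) hs)"
proof (induction j arbitrary: hs)
  case (Suc j)
  obtain h h' t where hs: "hs = h # h' # t"
    using Suc.prems by (cases hs; cases "tl hs") auto
  have "cup (replicate (Suc j) (r, True) @ w) hs =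
      int (carry r h h') * ((\<Prod>i<j. int (carry r (t ! (2 * i)) (t ! (2 * i + 1)))) * cup w (drop (2 * j) t))"
    using Suc.IH[of t] Suc.prems by (simp add: hs)
  also have "\<dots> = (\<Prod>i<Suc j. int (carry r (hs ! (2 * i)) (hs ! (2 * i + 1)))) * cup w (drop (2 * Suc j) hs)"
    by (subst prod.lessThan_Suc_shift) (simp add: hs)
  finally show ?case .
qed simp

lemma cup_block:
  assumes "1 \<le> k" "k \<le> length hs"
  shows "cup (block_word r k @ w) hs = int (eta m (exponents hs) r 1 k) * cup w (drop k hs)"
proof (cases "even k")
  case True
  then obtain j where j: "k = 2 * j" by (auto elim: evenE)
  have "(\<Prod>i<j. int (carry r (hs ! (2 * i)) (hs ! (2 * i + 1)))) = int (eta m (exponents hs) r 1 k)"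
    unfolding j using assms(1) j
    by (subst eta_even) (auto simp: of_nat_prod carry_def exponents_def add.commute)
  then show ?thesis
    using cup_pairs[of j hs r w] assms j by (simp add: block_word_def)
next
  case False
  then obtain j where j: "k = 2 * j + 1" by (auto elim: oddE)
  obtain h t where hs: "hs = h # t" using assms by (cases hs) auto
  have "(\<Prod>i<j. int (carry r (t ! (2 * i)) (t ! (2 * i + 1)))) * int (coord h r) =
      int (eta m (exponents hs) r 1 k)"
    unfolding j by (subst eta_odd)
      (auto simp: of_nat_prod carry_def exponents_def hs add.commute eval_nat_numeral)
  then show ?thesis
    using cup_pairs[of j t r w] assms j by (simp add: block_word_def hs mult.assoc[symmetric] mult.commute)
qed

text \<open>
  The last entry of \<open>rs\<close> owns the first positions of the symbol, so the blocks are peeled off from the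
  end of the lists while the arguments are shifted.
\<close>

lemma cup_blocks:
  assumes "length rs = length ls" "\<forall>x\<in>set ls. 1 \<le> x" "length hs = sum_list ls"
  shows "cup (concat (map (\<lambda>(r, k). block_word r k) (rev (zip rs ls)))) hs =
    (\<Prod>u<length ls. int (eta m (exponents hs) (rs ! u) (block_lo ls u) (block_hi ls u)))"
  using assms
proof (induction ls arbitrary: rs hs rule: rev_induct)
  case (snoc x ls)
  define N where "N = length ls"
  obtain rs' r where rs: "rs = rs' @ [r]" "length rs' = length ls"
    using snoc.prems(1) by (cases rs rule: rev_cases) auto
  have x: "1 \<le> x" "x \<le> length hs" using snoc.prems by auto
  have top: "block_lo (ls @ [x]) N = 1" "block_hi (ls @ [x]) N = x"
    by (simp_all add: block_lo_def block_hi_def N_def)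
  have shift: "block_lo (ls @ [x]) u = block_lo ls u + x" "block_hi (ls @ [x]) u = block_hi ls u + x"
    if "u < N" for u
    using that by (simp_all add: block_lo_def block_hi_def N_def nth_append)
  have le: "block_lo ls u \<le> block_hi ls u" "1 \<le> block_lo ls u" if "u < N" for u
  proof -
    have "1 \<le> ls ! u" using snoc.prems(2) that by (auto simp: N_def)
    then show "block_lo ls u \<le> block_hi ls u"
      using that by (simp add: block_lo_def block_hi_def N_def sum.atLeast_Suc_lessThan)
  qed (simp add: block_lo_def)
  have "cup (concat (map (\<lambda>(r, k). block_word r k) (rev (zip rs (ls @ [x]))))) hs =
      int (eta m (exponents hs) r 1 x) *
      cup (concat (map (\<lambda>(r, k). block_word r k) (rev (zip rs' ls)))) (drop x hs)"
    using rs x by (simp add: cup_block)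
  also have "cup (concat (map (\<lambda>(r, k). block_word r k) (rev (zip rs' ls)))) (drop x hs) =
      (\<Prod>u<N. int (eta m (exponents (drop x hs)) (rs' ! u) (block_lo ls u) (block_hi ls u)))"
    using snoc.prems rs unfolding N_def by (intro snoc.IH) auto
  also have "\<dots> = (\<Prod>u<N. int (eta m (exponents hs) (rs ! u) (block_lo (ls @ [x]) u) (block_hi (ls @ [x]) u)))"
  proof (rule prod.cong[OF refl])
    fix u assume u: "u \<in> {..<N}"
    have "eta m (exponents (drop x hs)) (rs' ! u) (block_lo ls u) (block_hi ls u) =
        eta m (\<lambda>v. exponents hs (v + x)) (rs' ! u) (block_lo ls u) (block_hi ls u)"
      using le[of u] u x by (intro eta_cong) (auto simp: exponents_drop)
    also have "\<dots> = eta m (exponents hs) (rs' ! u) (block_lo ls u + x) (block_hi ls u + x)"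
      using le[of u] u by (intro eta_shift) auto
    finally show "int (eta m (exponents (drop x hs)) (rs' ! u) (block_lo ls u) (block_hi ls u)) =
        int (eta m (exponents hs) (rs ! u) (block_lo (ls @ [x]) u) (block_hi (ls @ [x]) u))"
      using u shift[of u] rs by (simp add: nth_append N_def)
  qed
  also have "int (eta m (exponents hs) r 1 x) *
      (\<Prod>u<N. int (eta m (exponents hs) (rs ! u) (block_lo (ls @ [x]) u) (block_hi (ls @ [x]) u))) =
      (\<Prod>u<Suc N. int (eta m (exponents hs) (rs ! u) (block_lo (ls @ [x]) u) (block_hi (ls @ [x]) u)))"
  proof -
    have "rs ! N = r" by (simp add: rs nth_append N_def)
    then show ?thesis by (simp add: top mult.commute)
  qed
  finally show ?case by (simp add: N_def)
qed simp

definition support_list :: "(nat \<Rightarrow> nat) \<Rightarrow> nat list" where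
  "support_list l = filter (\<lambda>j. 0 < l j) [1..<Suc n]"

definition index_of :: "(nat \<Rightarrow> nat) \<Rightarrow> nat list \<times> nat list" where
  "index_of l = (support_list l, map l (support_list l))"

lemma set_support_list: "set (support_list l) = {j \<in> {1..n}. 0 < l j}"
  by (auto simp: support_list_def)

lemma word_support_list:
  "word l n = concat (map (\<lambda>(r, k). block_word r k) (rev (zip (support_list l) (map l (support_list l)))))"
proof -
  have "word l q = concat (map (\<lambda>r. block_word r (l r)) (rev (filter (\<lambda>j. 0 < l j) [1..<Suc q])))" for q
    by (induction q) (auto simp: block_word_def)
  moreover have "zip xs (map l xs) = map (\<lambda>r. (r, l r)) xs" for xs
    by (induction xs) auto
  ultimately show ?thesis
    by (simp add: support_list_def rev_map o_def)
qed

lemma sum_list_support: "sum_list (map l (support_list l)) = (\<Sum>j\<in>{1..n}. l j)"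
proof -
  have "sum_list (map l (filter (\<lambda>j. 0 < l j) xs)) = sum_list (map l xs)" for xs
    by (induction xs) auto
  then have "sum_list (map l (support_list l)) = sum_list (map l [1..<Suc n])"
    by (simp add: support_list_def)
  also have "\<dots> = (\<Sum>j\<in>{1..<Suc n}. l j)"
    by (simp only: interv_sum_list_conv_sum_set_nat set_upt)
  finally show ?thesis by (simp only: atLeastLessThanSuc_atLeastAtMost)
qed

lemma sorted_support_list: "sorted_wrt (<) (support_list l)"
  unfolding support_list_def by (rule sorted_wrt_filter) (rule sorted_wrt_upt)

end

context divisible_coordinates
begin

lemma support_list_hd:
  assumes "l \<in> small_basis k" "1 \<le> k"
  shows "support_list l \<noteq> []" "support_list l ! 0 = lowest l"
proof -
  have "lowest l \<in> set (support_list l)"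
    using lowest_in[OF assms] by (simp add: set_support_list)
  then show ne: "support_list l \<noteq> []" by auto
  have le: "support_list l ! 0 \<le> j" if "j \<in> set (support_list l)" for j
    using that sorted_support_list[of l] ne by (cases "support_list l") auto
  have "support_list l ! 0 \<in> set (support_list l)" using ne by simp
  then have "lowest l = support_list l ! 0"
    using le by (intro lowest_eqI) (auto simp: set_support_list)
  then show "support_list l ! 0 = lowest l" by simp
qed

text \<open>
  A multidegree is recovered from its support, listed in increasing order, together with its values
  there; the first support element is its lowest factor.
\<close>

lemma index_of_bij:
  assumes k: "1 \<le> k"
  shows "bij_betw index_of (odd_basis k) (\<Union>c\<in>{1..k}. index_set n k c)"
proof (rule bij_betw_imageI)
  show "inj_on index_of (odd_basis k)"
  proof (rule inj_onI, rule ext)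
    fix l l' j
    assume l: "l \<in> odd_basis k" "l' \<in> odd_basis k" and eq: "index_of l = index_of l'"
    show "l j = l' j"
    proof (cases "j \<in> set (support_list l)")
      case True
      then show ?thesis using eq by (auto simp: index_of_def)
    next
      case False
      then have "j \<notin> set (support_list l')" using eq by (simp add: index_of_def)
      then show ?thesis
        using l False by (cases "j \<in> {1..n}")
          (auto simp: set_support_list odd_basis_def small_basis_def multidegrees_def)
    qed
  qed
  show "index_of ` odd_basis k = (\<Union>c\<in>{1..k}. index_set n k c)"
  proof (intro equalityI subsetI)
    fix x assume "x \<in> index_of ` odd_basis k"
    then obtain l where l: "l \<in> odd_basis k" and x: "x = index_of l" by auto
    have l': "l \<in> small_basis k" using l by (simp add: odd_basis_def)
    let ?c = "length (support_list l)"
    have sum: "sum_list (map l (support_list l)) = k"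
      using l' by (simp add: sum_list_support small_basis_def)
    have pos: "1 \<le> l j" if "j \<in> set (support_list l)" for j
      using that by (simp add: set_support_list)
    have "sum_list (map (\<lambda>_. 1) (support_list l)) \<le> sum_list (map l (support_list l))"
      by (rule sum_list_mono) (rule pos)
    then have "?c \<le> k" by (simp add: sum sum_list_triv)
    moreover have "1 \<le> ?c"
      using support_list_hd(1)[OF l' k] by (cases "support_list l") auto
    moreover have "x \<in> index_set n k ?c"
      using support_list_hd[OF l' k] l sum pos[OF nth_mem] sorted_support_list[of l]
      by (auto simp: x index_of_def index_set_def set_support_list odd_basis_def)
    ultimately show "x \<in> (\<Union>c\<in>{1..k}. index_set n k c)" by auto
  next
    fix x assume "x \<in> (\<Union>c\<in>{1..k}. index_set n k c)"
    then obtain c where c: "1 \<le> c" "x \<in> index_set n k c" by auto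
    obtain rs ls where x: "x = (rs, ls)" by (cases x)
    have xs: "length rs = c" "length ls = c" "sorted_wrt (<) rs" "set rs \<subseteq> {1..n}" "sum_list ls = k"
      "\<And>i. i < c \<Longrightarrow> 1 \<le> ls ! i" "odd (ls ! 0)"
      using c(2) by (auto simp: x index_set_def)
    have dist: "distinct rs" using xs(3) by (simp add: strict_sorted_iff)
    define l where "l j = (case map_of (zip rs ls) j of None \<Rightarrow> 0 | Some y \<Rightarrow> y)" for j
    have l_nth: "l (rs ! i) = ls ! i" if "i < c" for i
      using that xs dist by (simp add: l_def map_of_zip_nth)
    have l_out: "l j = 0" if "j \<notin> set rs" for j
      using that xs by (simp add: l_def map_of_zip_is_None[THEN iffD2])
    have l_pos: "0 < l j \<longleftrightarrow> j \<in> set rs" for j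
      using l_out[of j] l_nth xs(6) xs(1) by (metis gr0I in_set_conv_nth less_numeral_extra(3)
          not_one_le_zero zero_less_iff_neq_zero)
    have "support_list l = rs"
    proof (rule sorted_distinct_set_unique)
      show "sorted (support_list l)" "distinct (support_list l)" "sorted rs" "distinct rs"
        using sorted_support_list[of l] xs(3) by (simp_all add: strict_sorted_iff)
      show "set (support_list l) = set rs"
        using xs(4) by (auto simp: set_support_list l_pos)
    qed
    moreover have "map l rs = ls"
      using xs l_nth by (intro nth_equalityI) auto
    ultimately have idx: "index_of l = x" by (simp add: index_of_def x)
    have "(\<Sum>j\<in>{1..n}. l j) = k"
      using sum_list_support[of l] \<open>support_list l = rs\<close> \<open>map l rs = ls\<close> xs(5) by simp
    moreover have "l j = 0" if "j \<notin> {1..n}" for j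
      by (rule l_out) (use that xs(4) in blast)
    ultimately have l': "l \<in> small_basis k"
      unfolding small_basis_def multidegrees_def by blast
    then have "lowest l = rs ! 0"
      using support_list_hd[OF l' k] \<open>support_list l = rs\<close> by simp
    then have "l \<in> odd_basis k"
      using l' l_nth[of 0] c(1) xs(7) by (simp add: odd_basis_def)
    then show "x \<in> index_of ` odd_basis k" using idx by blast
  qed
qed

text \<open>
  The sign of the explicit formula is absorbed into the parameter.
\<close>

definition signed_parameters :: "(nat list \<times> nat list \<Rightarrow> int) \<Rightarrow> (nat \<Rightarrow> nat) \<Rightarrow> int" where
  "signed_parameters a l = (-1) ^ sign_exponent (snd (index_of l)) * a (index_of l)"

lemma omega_value_eq:
  assumes k: "1 \<le> k" and hs: "length hs = k" "set hs \<subseteq> carrier G"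
    and \<alpha>: "\<And>u r. u \<in> {1..k} \<Longrightarrow> r \<in> {1..n} \<Longrightarrow> coord (hs ! (u - 1)) r = \<alpha> u r"
  shows "omega_value n m \<zeta> k a \<alpha> = omega k (signed_parameters a) (bar_symbol G hs)"
proof -
  define E where "E = (\<lambda>(rs, ls). \<zeta> (m (rs ! 0)) powi ((-1) ^ sign_exponent ls *
    (\<Prod>u<length rs. int (eta m \<alpha> (rs ! u) (block_lo ls u) (block_hi ls u))) * a (rs, ls)))"
  have fin: "finite (index_set n k c)" if "c \<in> {1..k}" for c
    by (rule finite_subset[of _ "\<Union>c\<in>{1..k}. index_set n k c"])
      (use that bij_betw_finite[OF index_of_bij[OF k]] finite_odd_basis in auto)
  have "omega_value n m \<zeta> k a \<alpha> = (\<Prod>c\<in>{1..k}. \<Prod>x\<in>index_set n k c. E x)"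
    unfolding omega_value_def E_def
    by (intro prod.cong refl) (auto simp: index_set_def)
  also have "\<dots> = (\<Prod>x\<in>(\<Union>c\<in>{1..k}. index_set n k c). E x)"
    by (rule prod.UNION_disjoint[symmetric]) (use fin in \<open>auto simp: index_set_def\<close>)
  also have "\<dots> = (\<Prod>l\<in>odd_basis k. E (index_of l))"
    by (rule prod.reindex_bij_betw[OF index_of_bij[OF k], symmetric])
  also have "\<dots> = omega k (signed_parameters a) (bar_symbol G hs)"
    unfolding omega_def
  proof (rule prod.cong[OF refl])
    fix l assume l: "l \<in> odd_basis k"
    have l': "l \<in> small_basis k" using l by (simp add: odd_basis_def)
    let ?S = "support_list l" and ?L = "map l (support_list l)"
    have sum: "sum_list ?L = k" using l' by (simp add: sum_list_support small_basis_def)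
    have pos: "\<forall>x\<in>set ?L. 1 \<le> x" by (auto simp: set_support_list)
    have "cup_value (word l n) (bar_symbol G hs) = cup (word l n) hs"
      by (rule cup_value_symbol[OF hs(2) word_in_range])
    also have "\<dots> = (\<Prod>u<length ?L. int (eta m (exponents hs) (?S ! u) (block_lo ?L u) (block_hi ?L u)))"
      unfolding word_support_list by (rule cup_blocks) (use pos hs sum in auto)
    also have "\<dots> = (\<Prod>u<length ?S. int (eta m \<alpha> (?S ! u) (block_lo ?L u) (block_hi ?L u)))"
    proof (rule prod.cong)
      fix u assume u: "u \<in> {..<length ?S}"
      have "?S ! u \<in> {1..n}" using u nth_mem[of u ?S] by (auto simp: set_support_list)
      have "1 \<le> ?L ! u" using pos u by auto
      then have lo: "block_lo ?L u \<le> block_hi ?L u" "1 \<le> block_lo ?L u"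
        using u by (simp_all add: block_lo_def block_hi_def sum.atLeast_Suc_lessThan)
      have "block_hi ?L u \<le> (\<Sum>i\<in>{0..<length ?L}. ?L ! i)"
        unfolding block_hi_def by (rule sum_mono2) auto
      then have "block_hi ?L u \<le> k" using sum by (simp add: sum_list_sum_nth)
      then show "int (eta m (exponents hs) (?S ! u) (block_lo ?L u) (block_hi ?L u)) =
          int (eta m \<alpha> (?S ! u) (block_lo ?L u) (block_hi ?L u))"
        using lo \<open>?S ! u \<in> {1..n}\<close>
        by (intro arg_cong[where f = int] eta_cong) (simp_all add: exponents_def \<alpha>[unfolded One_nat_def])
    qed simp
    finally have "cup_value (word l n) (bar_symbol G hs) =
        (\<Prod>u<length ?S. int (eta m \<alpha> (?S ! u) (block_lo ?L u) (block_hi ?L u)))" .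
    then show "E (index_of l) = \<zeta> (m (lowest l)) powi
        (signed_parameters a l * cup_value (word l n) (bar_symbol G hs))"
      using support_list_hd(2)[OF l' k]
      by (simp add: E_def index_of_def signed_parameters_def mult.assoc mult.commute[of "a _"])
  qed
  finally show ?thesis .
qed

end

section \<open>Coordinates of a product of cyclic groups\<close>

lemma comm_group_cyclic_product: "comm_group (cyclic_product n m)"
proof -
  have "group (cyclic_product n m)"
    unfolding cyclic_product_def by (rule product_group) simp
  then show ?thesis
    by (rule group.group_comm_groupI)
      (auto simp: cyclic_product_def add.commute intro!: restrict_ext)
qed

lemma factor_embed_in:
  assumes "j \<in> {1..n} \<Longrightarrow> x \<in> carrier (integer_mod_group (m j))"
  shows "factor_embed n j x \<in> carrier (cyclic_product n m)"
  using assms by (auto simp: cyclic_product_def factor_embed_def)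

lemma factor_embed_power:
  assumes "j \<in> {1..n}" "0 < m j"
  shows "factor_embed n j x [^]\<^bsub>cyclic_product n m\<^esub> (a :: nat) = factor_embed n j (int a * x mod int (m j))"
proof (induction a)
  case 0
  then show ?case
    by (auto simp: cyclic_product_def factor_embed_def fun_eq_iff)
next
  case (Suc a)
  have "(int a * x mod int (m j) + x) mod int (m j) = int (Suc a) * x mod int (m j)"
    by (simp add: mod_simps algebra_simps)
  then show ?case
    using Suc by (auto simp: cyclic_product_def factor_embed_def fun_eq_iff)
qed

locale cyclic_generators =
  fixes n :: nat and m :: "nat \<Rightarrow> nat" and g :: "nat \<Rightarrow> int"
  assumes m_ge_1: "i \<in> {1..n} \<Longrightarrow> m i \<ge> 1"
    and generator: "i \<in> {1..n} \<Longrightarrow> g i \<in> carrier (integer_mod_group (m i))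
      \<and> generate (integer_mod_group (m i)) {g i} = carrier (integer_mod_group (m i))"
begin

abbreviation "G \<equiv> cyclic_product n m"

sublocale G: comm_group G by (rule comm_group_cyclic_product)

lemma gen_power_eq:
  "gen_power n m g \<alpha> = (\<lambda>j\<in>{1..n}. int (\<alpha> j) * g j mod int (m j))"
proof -
  have in_G: "factor_embed n j (int (\<alpha> j) * g j mod int (m j)) \<in> carrier G" if "j \<in> {1..n}" for j
    using that m_ge_1[OF that] by (intro factor_embed_in) (simp add: carrier_integer_mod_group)
  have partial: "(\<Otimes>\<^bsub>G\<^esub>j\<in>A. factor_embed n j (int (\<alpha> j) * g j mod int (m j))) =
      (\<lambda>j\<in>{1..n}. if j \<in> A then int (\<alpha> j) * g j mod int (m j) else 0)"
    if "finite A" "A \<subseteq> {1..n}" for A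
    using that
  proof (induction A rule: finite_induct)
    case empty
    then show ?case
      unfolding G.finprod_empty by (auto simp: cyclic_product_def fun_eq_iff)
  next
    case (insert j A)
    have "(\<Otimes>\<^bsub>G\<^esub>j\<in>insert j A. factor_embed n j (int (\<alpha> j) * g j mod int (m j))) =
        factor_embed n j (int (\<alpha> j) * g j mod int (m j)) \<otimes>\<^bsub>G\<^esub>
        (\<Otimes>\<^bsub>G\<^esub>j\<in>A. factor_embed n j (int (\<alpha> j) * g j mod int (m j)))"
      using insert in_G by (intro G.finprod_insert) auto
    also have "\<dots> = factor_embed n j (int (\<alpha> j) * g j mod int (m j)) \<otimes>\<^bsub>G\<^esub>
        (\<lambda>j\<in>{1..n}. if j \<in> A then int (\<alpha> j) * g j mod int (m j) else 0)"
      using insert by (simp only: insert_subset simp_thms)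
    also have "\<dots> = (\<lambda>j'\<in>{1..n}. if j' \<in> insert j A then int (\<alpha> j') * g j' mod int (m j') else 0)"
      using insert by (auto simp: cyclic_product_def factor_embed_def fun_eq_iff)
    finally show ?case .
  qed
  have "gen_power n m g \<alpha> = (\<Otimes>\<^bsub>G\<^esub>j\<in>{1..n}. factor_embed n j (int (\<alpha> j) * g j mod int (m j)))"
    unfolding gen_power_def
  proof (rule G.finprod_cong')
    fix j assume j: "j \<in> {1..n}"
    have "0 < m j" using m_ge_1[OF j] by simp
    then show "factor_embed n j (g j) [^]\<^bsub>G\<^esub> \<alpha> j = factor_embed n j (int (\<alpha> j) * g j mod int (m j))"
      by (rule factor_embed_power[OF j])
  qed (use in_G in auto)
  also have "\<dots> = (\<lambda>j\<in>{1..n}. int (\<alpha> j) * g j mod int (m j))"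
    by (subst partial) (auto simp: fun_eq_iff)
  finally show ?thesis .
qed

text \<open>
  Powers of a generator exhaust the factor, so the exponents below its order are mapped onto it, hence
  bijectively.
\<close>

lemma exponent_bij:
  assumes i: "i \<in> {1..n}"
  shows "bij_betw (\<lambda>x. int x * g i mod int (m i)) {..<m i} {0..<int (m i)}"
proof -
  have m: "0 < m i" using m_ge_1[OF i] by simp
  let ?f = "\<lambda>x. int x * g i mod int (m i)"
  have surj: "?f ` {..<m i} = {0..<int (m i)}"
  proof (intro equalityI subsetI)
    fix y assume y: "y \<in> {0..<int (m i)}"
    interpret Z: group "integer_mod_group (m i)" by simp
    have "y \<in> generate (integer_mod_group (m i)) {g i}"
      using y generator[OF i] m by (simp add: carrier_integer_mod_group)
    then obtain z :: int where "y = g i [^]\<^bsub>integer_mod_group (m i)\<^esub> z"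
      using Z.generate_pow[of "g i"] generator[OF i] by auto
    then have z: "y = z * g i mod int (m i)"
      by (simp add: int_pow_integer_mod_group)
    have "int (nat (z mod int (m i))) = z mod int (m i)" using m by simp
    then have "?f (nat (z mod int (m i))) = y"
      unfolding z by (simp add: mod_mult_left_eq)
    moreover have "nat (z mod int (m i)) < m i" using m by (simp add: nat_less_iff)
    ultimately show "y \<in> ?f ` {..<m i}"
      by (intro image_eqI[of _ _ "nat (z mod int (m i))"]) simp_all
  qed (use m in auto)
  moreover have "inj_on ?f {..<m i}"
    by (rule eq_card_imp_inj_on) (simp_all add: surj)
  ultimately show ?thesis by (simp add: bij_betw_def)
qed

lemma carrier_G: "carrier G = (\<Pi>\<^sub>E i\<in>{1..n}. {0..<int (m i)})"
proof -
  have "carrier (integer_mod_group (m i)) = {0..<int (m i)}" if "i \<in> {1..n}" for i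
    using m_ge_1[OF that] by (simp add: carrier_integer_mod_group)
  then show ?thesis
    unfolding cyclic_product_def carrier_product_group by (rule PiE_cong)
qed

lemma gen_power_bij: "bij_betw (gen_power n m g) (exponent_vectors n m) (carrier G)"
proof (rule bij_betw_imageI)
  show "inj_on (gen_power n m g) (exponent_vectors n m)"
  proof (rule inj_onI, rule ext)
    fix x y j
    assume x: "x \<in> exponent_vectors n m" and y: "y \<in> exponent_vectors n m"
      and eq: "gen_power n m g x = gen_power n m g y"
    show "x j = y j"
    proof (cases "j \<in> {1..n}")
      case True
      then have "int (x j) * g j mod int (m j) = int (y j) * g j mod int (m j)"
        using fun_cong[OF eq, of j] by (simp add: gen_power_eq)
      moreover have "x j < m j" "y j < m j"
        using x y True by (auto simp: exponent_vectors_def split: if_splits)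
      ultimately show ?thesis
        using bij_betw_imp_inj_on[OF exponent_bij[OF True]] by (auto dest: inj_onD)
    next
      case False
      then show ?thesis using x y by (auto simp: exponent_vectors_def split: if_splits)
    qed
  qed
  show "gen_power n m g ` exponent_vectors n m = carrier G"
  proof (intro equalityI subsetI)
    fix y assume y: "y \<in> carrier G"
    have "\<exists>x<m j. int x * g j mod int (m j) = y j" if j: "j \<in> {1..n}" for j
    proof -
      have "y j \<in> (\<lambda>x. int x * g j mod int (m j)) ` {..<m j}"
        using y j bij_betw_imp_surj_on[OF exponent_bij[OF j]] by (auto simp: carrier_G)
      then show ?thesis by auto
    qed
    then obtain x where x: "\<And>j. j \<in> {1..n} \<Longrightarrow> x j < m j \<and> int (x j) * g j mod int (m j) = y j"
      by metis
    let ?x = "\<lambda>j. if j \<in> {1..n} then x j else 0"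
    have "gen_power n m g ?x = y"
      using x y by (auto simp: gen_power_eq carrier_G fun_eq_iff PiE_iff extensional_def)
    moreover have "?x \<in> exponent_vectors n m" using x by (auto simp: exponent_vectors_def)
    ultimately show "y \<in> gen_power n m g ` exponent_vectors n m" by blast
  qed (use m_ge_1 in \<open>auto simp: gen_power_eq carrier_G Suc_le_eq\<close>)
qed

definition exponent_of :: "(nat \<Rightarrow> int) \<Rightarrow> nat \<Rightarrow> nat" where
  "exponent_of = inv_into (exponent_vectors n m) (gen_power n m g)"

lemma exponent_of_gen_power: "x \<in> exponent_vectors n m \<Longrightarrow> exponent_of (gen_power n m g x) = x"
  using bij_betw_imp_inj_on[OF gen_power_bij] by (simp add: exponent_of_def)

lemma gen_power_exponent_of: "h \<in> carrier G \<Longrightarrow> gen_power n m g (exponent_of h) = h"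
  using bij_betw_imp_surj_on[OF gen_power_bij] by (simp add: exponent_of_def f_inv_into_f)

lemma exponent_of_bij: "bij_betw exponent_of (carrier G) (exponent_vectors n m)"
  unfolding exponent_of_def by (rule bij_betw_inv_into[OF gen_power_bij])

lemma exponent_of_mult:
  assumes h: "h \<in> carrier G" "h' \<in> carrier G" and j: "j \<in> {1..n}"
  shows "exponent_of (h \<otimes>\<^bsub>G\<^esub> h') j = (exponent_of h j + exponent_of h' j) mod m j"
proof -
  let ?x = "exponent_of h" and ?y = "exponent_of h'"
  let ?z = "\<lambda>j. if j \<in> {1..n} then (?x j + ?y j) mod m j else 0"
  have z: "?z \<in> exponent_vectors n m"
    using m_ge_1 by (auto simp: exponent_vectors_def Suc_le_eq)
  have "gen_power n m g ?z = gen_power n m g ?x \<otimes>\<^bsub>G\<^esub> gen_power n m g ?y"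
    by (auto simp: gen_power_eq cyclic_product_def fun_eq_iff zmod_int mod_simps distrib_right)
  then have "gen_power n m g ?z = h \<otimes>\<^bsub>G\<^esub> h'"
    using h by (simp add: gen_power_exponent_of)
  then have "exponent_of (h \<otimes>\<^bsub>G\<^esub> h') = ?z"
    using exponent_of_gen_power[OF z] by simp
  then show ?thesis using j by simp
qed

lemma coordinates: "cyclic_coordinates G n m exponent_of"
proof
  show "0 < m j" if "j \<in> {1..n}" for j using m_ge_1[OF that] by simp
qed (rule exponent_of_bij, rule exponent_of_mult)

end

lemma dvd_chain:
  assumes "\<And>i. 1 \<le> i \<Longrightarrow> i \<le> n - 1 \<Longrightarrow> m i dvd m (i + 1 :: nat)" "1 \<le> r" "r \<le> q" "q \<le> n"
  shows "m r dvd (m q :: nat)"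
  using assms(3,4)
proof (induction q rule: dec_induct)
  case (step q)
  then have "m q dvd m (q + 1)" using assms(2) by (intro assms(1)) auto
  then show ?case using step by (auto intro: dvd_trans)
qed simp

section \<open>The classification theorem\<close>

locale classification = cyclic_generators n m g for n m g +
  fixes \<zeta> :: "nat \<Rightarrow> 'k :: alg_closed_field"
  assumes dvd_Suc: "1 \<le> i \<Longrightarrow> i \<le> n - 1 \<Longrightarrow> m i dvd m (i + 1)"
    and primitive_root: "d \<ge> 1 \<Longrightarrow> primitive_root_of_unity d (\<zeta> d)"
begin

sublocale divisible_coordinates G n m exponent_of \<zeta>
proof -
  interpret cyclic_coordinates G n m exponent_of by (rule coordinates)
  show "divisible_coordinates G n m exponent_of \<zeta>"
  proof unfold_locales
    show "m r dvd m q" if "1 \<le> r" "r \<le> q" "q \<le> n" for r q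
      by (rule dvd_chain[of n m r q, OF dvd_Suc that])
  qed (rule primitive_root)
qed

abbreviation omega_cochain_of :: "nat \<Rightarrow> (nat list \<times> nat list \<Rightarrow> int) \<Rightarrow>
    (((nat \<Rightarrow> int) \<times> (nat \<Rightarrow> int) list) \<Rightarrow>\<^sub>0 int) \<Rightarrow> 'k" where
  "omega_cochain_of k a \<equiv> restrict (omega k (signed_parameters a)) (free_chains G (bar_basis G k))"

lemma gen_power_in: "(\<And>j. j \<in> {1..n} \<Longrightarrow> x j < m j) \<Longrightarrow> gen_power n m g x \<in> carrier G"
  using m_ge_1 by (auto simp: gen_power_eq carrier_G Suc_le_eq)

lemma exponent_of_gen_power':
  assumes "\<And>j. j \<in> {1..n} \<Longrightarrow> x j < m j" "j \<in> {1..n}"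
  shows "exponent_of (gen_power n m g x) j = x j"
proof -
  let ?x = "\<lambda>j. if j \<in> {1..n} then x j else 0"
  have "gen_power n m g x = gen_power n m g ?x"
    by (auto simp: gen_power_eq fun_eq_iff)
  moreover have "?x \<in> exponent_vectors n m"
    using assms(1) by (auto simp: exponent_vectors_def)
  ultimately show ?thesis using assms(2) by (simp add: exponent_of_gen_power)
qed

text \<open>
  Every normalized symbol has the form \<open>[g ^ \<alpha>\<^sub>1, \<dots>, g ^ \<alpha>\<^sub>k]\<close>, so the prescribed values determine the
  cochain.  On symbols with a trivial entry the formula gives \<open>1\<close>, as the cup products vanish there.
\<close>

lemma is_omega_iff:
  assumes k: "1 \<le> k"
  shows "is_omega n m g \<zeta> k a \<omega> \<longleftrightarrow> \<omega> = omega_cochain_of k a"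
proof -
  have on_symbols: "omega_cochain_of k a (bar_symbol G (map (\<lambda>u. gen_power n m g (\<alpha> u)) [1..<k+1])) =
      omega_value n m \<zeta> k a \<alpha>" if \<alpha>: "\<forall>u\<in>{1..k}. \<forall>j\<in>{1..n}. \<alpha> u j < m j" for \<alpha>
  proof -
    let ?hs = "map (\<lambda>u. gen_power n m g (\<alpha> u)) [1..<k+1]"
    have hs: "length ?hs = k" "set ?hs \<subseteq> carrier G"
      using \<alpha> by (auto intro!: gen_power_in simp del: upt_Suc)
    have "omega_value n m \<zeta> k a \<alpha> = omega k (signed_parameters a) (bar_symbol G ?hs)"
    proof (rule omega_value_eq[OF k hs])
      fix u r assume ur: "u \<in> {1..k}" "r \<in> {1..n}"
      then have "?hs ! (u - 1) = gen_power n m g (\<alpha> u)"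
        by (subst nth_map) (auto simp: nth_upt simp del: upt_Suc)
      moreover have "exponent_of (gen_power n m g (\<alpha> u)) r = \<alpha> u r"
        by (rule exponent_of_gen_power') (use \<alpha> ur in auto)
      ultimately show "exponent_of (?hs ! (u - 1)) r = \<alpha> u r"
        by (simp only:)
    qed
    then show ?thesis
      using G.bar_symbol_in_chains[OF hs(2,1)] by simp
  qed
  show ?thesis
  proof
    assume om: "is_omega n m g \<zeta> k a \<omega>"
    show "\<omega> = omega_cochain_of k a"
    proof (rule G.cochain_eqI[OF _ omega_cochain[OF k]])
      show "\<omega> \<in> bar_cochains G k" using om by (simp add: is_omega_def)
      fix hs assume hs: "hs \<in> bar_basis G k"
      define \<alpha> where "\<alpha> u = exponent_of (hs ! (u - 1))" for u
      have len: "length hs = k" and sub: "set hs \<subseteq> carrier G" and ne: "\<one>\<^bsub>G\<^esub> \<notin> set hs"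
        using hs by (auto simp: bar_basis_def)
      have in_G: "hs ! (u - 1) \<in> carrier G" if "u \<in> {1..k}" for u
        using that sub len by (intro subsetD[OF sub] nth_mem) auto
      have \<alpha>: "\<forall>u\<in>{1..k}. \<forall>j\<in>{1..n}. \<alpha> u j < m j"
        using in_G by (auto simp: \<alpha>_def intro!: coord_less)
      have "gen_power n m g (exponent_of (hs ! i)) = hs ! i" if "i < k" for i
        using in_G[of "Suc i"] that by (simp add: gen_power_exponent_of)
      then have "hs = map (\<lambda>u. gen_power n m g (\<alpha> u)) [1..<k+1]"
        using len by (intro nth_equalityI) (auto simp: \<alpha>_def simp del: upt_Suc)
      moreover have "bar_symbol G hs = frag_of (\<one>\<^bsub>G\<^esub>, hs)"
        using ne by (simp add: bar_symbol_def)
      ultimately show "\<omega> (frag_of (\<one>\<^bsub>G\<^esub>, hs)) = omega_cochain_of k a (frag_of (\<one>\<^bsub>G\<^esub>, hs))"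
        using om \<alpha> on_symbols[OF \<alpha>] by (metis is_omega_def)
    qed
  next
    assume "\<omega> = omega_cochain_of k a"
    then show "is_omega n m g \<zeta> k a \<omega>"
      using on_symbols omega_cochain[OF k] by (simp add: is_omega_def)
  qed
qed

lemma bar_cocycles_iff:
  "f \<in> bar_cocycles G k \<longleftrightarrow>
    f \<in> bar_cochains G k \<and> (\<forall>c\<in>free_chains G (bar_basis G (Suc k)). f (bar.bd c) = 1)"
  by (auto simp: bar_cocycles_def bar_coboundary_def carrier_bar_module bar_boundary_eq)

lemma cohomologous_iff:
  assumes "1 \<le> k"
  shows "cohomologous G k f f' \<longleftrightarrow>
    (\<exists>u\<in>bar_cochains G (k - 1). \<forall>c\<in>free_chains G (bar_basis G k). f c = f' c * u (bar.bd c))"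
proof -
  obtain k' where "k = Suc k'" using assms by (cases k) auto
  then show ?thesis
    by (auto simp: cohomologous_def bar_coboundary_def carrier_bar_module bar_boundary_eq)
qed

lemma parameters_iff:
  assumes "1 \<le> k"
  shows "a \<in> parameters n m k \<longleftrightarrow> a \<in> extensional (index_of ` odd_basis k) \<and>
    (\<forall>l\<in>odd_basis k. 0 \<le> a (index_of l) \<and> a (index_of l) < int (m (lowest l)))"
proof -
  have "fst (index_of l) ! 0 = lowest l" if "l \<in> odd_basis k" for l
    using that support_list_hd(2)[of l k] assms by (simp add: index_of_def odd_basis_def)
  then show ?thesis
    unfolding parameters_def bij_betw_imp_surj_on[OF index_of_bij[OF assms], symmetric]
    by (auto simp: PiE_iff case_prod_unfold)
qed

text \<open>
  The classification is insensitive to parameters modulo \<open>m (lowest l)\<close> and to the fixed signs, so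
  reducing signed parameters gives the unique representatives in the prescribed range.
\<close>

lemma unique_parameters:
  assumes k: "1 \<le> k" and f: "f \<in> bar_cocycles G k"
  shows "\<exists>!a. a \<in> parameters n m k \<and> (\<exists>\<omega>. is_omega n m g \<zeta> k a \<omega> \<and> cohomologous G k f \<omega>)"
proof -
  have char: "(\<exists>\<omega>. is_omega n m g \<zeta> k a \<omega> \<and> cohomologous G k f \<omega>) \<longleftrightarrow>
      (\<exists>u\<in>bar_cochains G (k - 1). \<forall>c\<in>free_chains G (bar_basis G k).
        f c = omega k (signed_parameters a) c * u (bar.bd c))" for a
    by (simp add: is_omega_iff[OF k] cohomologous_iff[OF k])
  have f': "f \<in> bar_cochains G k" "\<And>c. c \<in> free_chains G (bar_basis G (Suc k)) \<Longrightarrow> f (bar.bd c) = 1"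
    using f by (auto simp: bar_cocycles_iff)
  obtain k' where k': "k = Suc k'" using k by (cases k) auto
  have inj: "inj_on index_of (odd_basis k)"
    by (rule bij_betw_imp_inj_on[OF index_of_bij[OF k]])
  have sign: "(-1) ^ e * ((-1) ^ e * z) = (z :: int)" for e z
    using neg_one_even_power[of e] neg_one_odd_power[of e] by (cases "even e") auto
  show ?thesis
    unfolding char
  proof (rule ex_ex1I)
    obtain b u where u: "u \<in> bar_cochains G (k - 1)"
      and fb: "\<And>c. c \<in> free_chains G (bar_basis G k) \<Longrightarrow> f c = omega k b c * u (bar.bd c)"
      using cocycle_representative[OF f'(1) k f'(2)] by blast
    define a where "a = restrict (\<lambda>x. let l = inv_into (odd_basis k) index_of x in
      ((-1) ^ sign_exponent (snd x) * b l) mod int (m (lowest l))) (index_of ` odd_basis k)"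
    have a: "a (index_of l) = ((-1) ^ sign_exponent (snd (index_of l)) * b l) mod int (m (lowest l))"
      if "l \<in> odd_basis k" for l
      using that by (simp add: a_def Let_def inv_into_f_f[OF inj])
    have "a \<in> extensional (index_of ` odd_basis k)"
      unfolding a_def by (rule restrict_extensional)
    then have "a \<in> parameters n m k"
      unfolding parameters_iff[OF k]
      using m_lowest_pos[OF _ k] by (auto simp: a Suc_le_eq)
    moreover have "omega k (signed_parameters a) c = omega k b c" for c
    proof (rule omega_cong_mod[OF k])
      fix l assume l: "l \<in> odd_basis k"
      let ?s = "(-1) ^ sign_exponent (snd (index_of l)) :: int" and ?M = "int (m (lowest l))"
      have "?M dvd (?s * b l) mod ?M - ?s * b l"
        by (simp add: mod_eq_dvd_iff[symmetric])
      then have "?M dvd ?s * ((?s * b l) mod ?M - ?s * b l)" by (rule dvd_mult)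
      then show "?M dvd signed_parameters a l - b l"
        by (simp add: signed_parameters_def a[OF l] right_diff_distrib sign)
    qed
    ultimately show "\<exists>a. a \<in> parameters n m k \<and> (\<exists>u\<in>bar_cochains G (k - 1).
        \<forall>c\<in>free_chains G (bar_basis G k). f c = omega k (signed_parameters a) c * u (bar.bd c))"
      using u fb by (intro exI[of _ a] conjI bexI[of _ u] ballI) simp_all
  next
    fix a a'
    assume "a \<in> parameters n m k \<and> (\<exists>u\<in>bar_cochains G (k - 1).
        \<forall>c\<in>free_chains G (bar_basis G k). f c = omega k (signed_parameters a) c * u (bar.bd c))"
    then obtain u where a: "a \<in> parameters n m k" and u: "u \<in> bar_cochains G (k - 1)"
      "\<And>c. c \<in> free_chains G (bar_basis G k) \<Longrightarrow> f c = omega k (signed_parameters a) c * u (bar.bd c)"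
      by blast
    assume "a' \<in> parameters n m k \<and> (\<exists>u\<in>bar_cochains G (k - 1).
        \<forall>c\<in>free_chains G (bar_basis G k). f c = omega k (signed_parameters a') c * u (bar.bd c))"
    then obtain u' where a': "a' \<in> parameters n m k" and u': "u' \<in> bar_cochains G (k - 1)"
      "\<And>c. c \<in> free_chains G (bar_basis G k) \<Longrightarrow> f c = omega k (signed_parameters a') c * u' (bar.bd c)"
      by blast
    define w where "w = restrict (\<lambda>c. u' c / u c) (free_chains G (bar_basis G (k - 1)))"
    have w: "w \<in> bar_cochains G (k - 1)"
      unfolding w_def
      by (rule G.cochainI) (simp_all add: G.cochain_nonzero[OF u(1)] G.cochain_nonzero[OF u'(1)]
        G.cochain_add[OF u(1)] G.cochain_add[OF u'(1)] G.cochain_act[OF u(1)] G.cochain_act[OF u'(1)])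
    have eq: "omega k (signed_parameters a) c = omega k (signed_parameters a') c * w (bar.bd c)"
      if c: "c \<in> free_chains G (bar_basis G k)" for c
    proof -
      have bc: "bar.bd c \<in> free_chains G (bar_basis G (k - 1))"
        using bar.bd_in[of c k'] c k' by simp
      have "omega k (signed_parameters a) c * u (bar.bd c) =
          omega k (signed_parameters a') c * u' (bar.bd c)"
        using u(2)[OF c] u'(2)[OF c] by simp
      then show ?thesis
        using G.cochain_nonzero[OF u(1) bc] bc by (simp add: w_def field_simps)
    qed
    have "a (index_of l) = a' (index_of l)" if l: "l \<in> odd_basis k" for l
    proof -
      let ?s = "(-1) ^ sign_exponent (snd (index_of l)) :: int" and ?M = "int (m (lowest l))"
      have "?M dvd signed_parameters a l - signed_parameters a' l"
        by (rule parameters_unique[OF k w eq l])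
      then have "?M dvd ?s * (signed_parameters a l - signed_parameters a' l)"
        by (rule dvd_mult)
      then have "?M dvd a (index_of l) - a' (index_of l)"
        by (simp add: signed_parameters_def right_diff_distrib sign)
      then have "a (index_of l) mod ?M = a' (index_of l) mod ?M"
        by (simp add: mod_eq_dvd_iff)
      then show ?thesis
        using a a' l by (simp add: parameters_iff[OF k])
    qed
    then show "a = a'"
      using a a' by (intro extensionalityI[of a "index_of ` odd_basis k"])
        (auto simp: parameters_iff[OF k])
  qed
qed

end

theorem corollary2p5:
  fixes n k :: nat
    and m :: "nat \<Rightarrow> nat"
    and g :: "nat \<Rightarrow> int"
    and \<zeta> :: "nat \<Rightarrow> 'k::{alg_closed_field, field_char_0}"
  assumes "n \<ge> 1" and "k \<ge> 1"
    and "\<And>i. i \<in> {1..n} \<Longrightarrow> m i \<ge> 1"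
    and "\<And>i. 1 \<le> i \<Longrightarrow> i \<le> n - 1 \<Longrightarrow> m i dvd m (i + 1)"
    and "\<And>i. i \<in> {1..n} \<Longrightarrow> g i \<in> carrier (integer_mod_group (m i))
           \<and> generate (integer_mod_group (m i)) {g i} = carrier (integer_mod_group (m i))"
    and "\<And>d. d \<ge> 1 \<Longrightarrow> primitive_root_of_unity d (\<zeta> d)"
  shows "(\<forall>a\<in>parameters n m k. \<exists>!\<omega>. is_omega n m g \<zeta> k a \<omega>)
       \<and> (\<forall>a\<in>parameters n m k. \<forall>\<omega>. is_omega n m g \<zeta> k a \<omega> \<longrightarrow>
            \<omega> \<in> bar_cocycles (cyclic_product n m) k)
       \<and> (\<forall>f\<in>(bar_cocycles (cyclic_product n m) k
               :: ((((nat \<Rightarrow> int) \<times> (nat \<Rightarrow> int) list) \<Rightarrow>\<^sub>0 int) \<Rightarrow> 'k) set).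
            \<exists>!a. a \<in> parameters n m k
              \<and> (\<exists>\<omega>. is_omega n m g \<zeta> k a \<omega> \<and> cohomologous (cyclic_product n m) k f \<omega>))"
proof -
  interpret classification n m g \<zeta>
    by unfold_locales (fact assms)+
  have "\<exists>!\<omega>. is_omega n m g \<zeta> k a \<omega>" for a
    by (simp add: is_omega_iff[OF assms(2)])
  moreover have "\<omega> \<in> bar_cocycles G k" if "is_omega n m g \<zeta> k a \<omega>" for a \<omega>
    using that omega_cochain[OF assms(2)] omega_cocycle[OF assms(2)] bar.bd_in
    by (auto simp: is_omega_iff[OF assms(2)] bar_cocycles_iff)
  ultimately show ?thesis
    using unique_parameters[OF assms(2)] by blast
qed

end
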